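(* Let $\mathscr T=(V,\mathcal E)$ be the directed Cartesian product of locally finite rooted directed trees $\mathscr T_1,\ldots,\mathscr T_d$, of finite joint branching index. Let $S_{\boldsymbol\lambda_{\mathfrak c}}$ be a multishift belonging to $\mathcal S_{\mathscr T}$ and let $(\mathscr M_z,\mathscr H_{\mathfrak c}(\mathscr T))$ be the analytic model of $S_{\boldsymbol\lambda_{\mathfrak c}}$ on $\mathscr T$. Then the following statements are equivalent: (i) $\mathscr H_{\mathfrak c}(\mathscr T)$ admits a representing measure $\rho_{\mathscr T}\times\nu_{\mathscr T}=(\rho_u\times\nu_u)_{u\in\Omega_F,F\in\mathscr P}$ supported on $[0,\sup\mathfrak c]\times\partial\mathbb B^d$. (ii) The sequence $\{\mathfrak a_n\}_{n\in\mathbb N}$ given by $\mathfrak a_0=1$ and $\mathfrak a_n=\prod_{j=0}^{n-1}\mathfrak c(j)$ for $n\geq 1$ is a Hausdorff moment sequence. If either of the two equivalent statements (i) and (ii) holds, then for $u\in\Omega_F$ and $F\in\mathscr P$, the positive scalar-valued measures $\rho_u$ and $\nu_u$ are given by $$d\rho_u(s)=\frac{s^{|\mathsf d_u|}}{\mathfrak a_{|\mathsf d_u|}}\,d\rho_{\mathsf{root}}(s),\qquad d\nu_u(z)=\frac{|z^{\mathsf d_u}|^2}{\|z^{\mathsf d_u}\|^2_{L^2(\partial\mathbb B^d,\sigma)}}\,d\sigma(z),$$ where $\rho_{\mathsf{root}}$ is the representing measure of $\{\mathfrak a_n\}_{n\in\mathbb N}$ supported on $[0,\sup\mathfrak c]$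 and $\sigma$ is the normalized surface area measure on $\partial\mathbb B^d$.
   Context: Conventions: $\mathbb N=\{0,1,2,\ldots\}$; for $\alpha\in\mathbb N^d$, $\alpha!=\prod_j\alpha_j!$ and $|\alpha|=\sum_j\alpha_j$; empty products are $1$. $\mathscr P$ is the set of all subsets of $\{1,\ldots,d\}$. $\mathbb B^d$ and $\partial\mathbb B^d$ are the unit ball and unit sphere of $\mathbb C^d$, and $\mathbb B^d_r$ the open ball of radius $r$ about $0$. Trees: a rooted directed tree is a connected directed graph without circuits in which every vertex has at most one parent and exactly one vertex (the root) has no parent. $\mathsf{Chi}(u)$ is the set of children of $u$; for a non-root $u$, $\mathsf{par}(u)$ is its parent and $\mathsf{sib}(u)=\mathsf{Chi}(\mathsf{par}(u))$ (so $u\in\mathsf{sib}(u)$). All directed trees are assumed countably infinite and leafless (every vertex has at least one child). Locally finite: every $\mathsf{Chi}(u)$ is finite. The depth of $u$ is the length of the path from the root to $u$. Products: for rooted directed trees $\mathscr T_j=(V_j,\mathcal E_j)$ with roots $\mathsf{root}_j$, the directed Cartesian product $\mathscr T=(V,\mathcal E)$ has $V=V_1\times\cdots\times V_d$ and $(v,w)\in\mathcal E$ iff there is $k$ with $v_j=w_j$ for $j\neq k$ and $(v_k,w_k)\in\mathcal E_k$. Put $\mathsf{root}=(\mathsf{root}_1,\ldots,\mathsf{root}_d)$. The depth of $v\in V$ is $\mathsf d_v=(\mathsf d_{v_1},\ldots,\mathsf d_{v_d})$, $\mathsf d_{v_j}$ being the depth of $v_j$ in $\mathscr T_j$. $\mathsf{Chi}_j(v)$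 (resp. $\mathsf{sib}_j(v)$, for $v_j\neq\mathsf{root}_j$) is the set of $w\in V$ with $w_i=v_i$ for $i\ne j$ and $w_j\in\mathsf{Chi}(v_j)$ (resp. $w_j\in\mathsf{sib}(v_j)$). $\mathscr T$ is of finite joint branching index if, for each $j$, the set of depths of the branching vertices of $\mathscr T_j$ (vertices with at least two children) is bounded (possibly empty). Family $\mathcal S_{\mathscr T}$: for a sequence $\mathfrak c:\mathbb N\to(0,\infty)$ put $$\lambda_j(w)=\sqrt{\frac{\mathfrak c(|\mathsf d_v|)}{\mathrm{card}(\mathsf{Chi}_j(v))}}\sqrt{\frac{\mathsf d_{v_j}+1}{|\mathsf d_v|+d}},\quad w\in\mathsf{Chi}_j(v),\ v\in V,\ j=1,\ldots,d.$$ On $l^2(V)$ with orthonormal basis $\{e_v\}_{v\in V}$ of indicator functions, $S_{\boldsymbol\lambda_{\mathfrak c}}=(S_1,\ldots,S_d)$ is the commuting multishift $S_je_v=\sum_{w\in\mathsf{Chi}_j(v)}\lambda_j(w)e_w$. $\mathcal S_{\mathscr T}=\{S_{\boldsymbol\lambda_{\mathfrak c}}:\inf\mathfrak c>0,\ \sup\mathfrak c<\infty\}$. Put $E=\bigcap_{j=1}^d\ker S_j^*$. Spaces $\mathcal L_{u,F}$: for $F\in\mathscr P$ let $\Phi_F=\{v\in V: v_j\neq\mathsf{root}_j\text{ if }j\in F,\ v_j=\mathsf{root}_j\text{ if }j\notin F\}$. For $u\in\Phi_F$, $\mathsf{sib}_F(u)$ is the set of $w\in V$ with $w_j\in\mathsf{sib}(u_j)$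 for $j\in F$ and $w_j=u_j$ for $j\notin F$. These sets partition $\Phi_F$, and $\Omega_F$ is any set containing exactly one element of each class. For $G\in\mathscr P$, $v_G$ is $v$ with all coordinates $v_j$, $j\notin G$, replaced by $\mathsf{root}_j$; $\mathsf{sib}_{F,G}(u)=\{v_G: v\in\mathsf{sib}_F(u)\}$ for $G\subseteq F$; for $j\notin G$, $v_G|u_j$ is $v_G$ with $j$-th coordinate replaced by $u_j$. $\mathcal L_{u,F}\subseteq l^2(\mathsf{sib}_F(u))$ is the space of $f$ with $\sum_{w\in\mathsf{sib}_j(v_G|u_j)}f(w)\lambda_j(w)=0$ for all $j\in F$, $G=F\setminus\{j\}$, $v_G\in\mathsf{sib}_{F,G}(u)$ ($\mathcal L_{\mathsf{root},\emptyset}$ is the span of $e_{\mathsf{root}}$). One has $E=\bigoplus_{F\in\mathscr P}\bigoplus_{u\in\Omega_F}\mathcal L_{u,F}$, and $E$ is finite dimensional under finite joint branching index. Analytic model: $\mathscr H_{\mathfrak c}(\mathscr T)$ is the Hilbert space of $E$-valued power series $f(z)=\sum_{\alpha\in\mathbb N^d}f_\alpha z^\alpha$, $f_\alpha\in E$, with $\|f\|^2=\sum_\alpha\|S_{\boldsymbol\lambda_{\mathfrak c}}^\alpha f_\alpha\|^2_{l^2(V)}<\infty$; these are holomorphic functions on some ball $\mathbb B^d_r$, $r>0$, and $\mathscr M_z$ is the $d$-tuple of multiplications by coordinate functions, unitarily equivalent to $S_{\boldsymbol\lambda_{\mathfrak c}}$. $E$ is identified with the constant functions. Representing measure: $\mathscr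 H_{\mathfrak c}(\mathscr T)$ admits a representing measure if there exists a $B(E)$-valued product measure $\rho_{\mathscr T}\times\nu_{\mathscr T}=(\rho_u\times\nu_u)_{u\in\Omega_F,F\in\mathscr P}$ supported on $[0,b]\times\partial\mathbb B^d$, $b>0$, such that: (1) for any $f\in E$ and $\alpha\in\mathbb N^d$, $\|z^\alpha f\|^2_{\mathscr H_{\mathfrak c}(\mathscr T)}=\int_{[0,b]}\int_{\partial\mathbb B^d}s^{|\alpha|}|z^\alpha|^2\langle d\rho_{\mathscr T}(s)\times d\nu_{\mathscr T}(z)f,f\rangle$; (2) $\rho_u$ and $\nu_u$ are scalar-valued measures such that for $g_{u,F}\in\mathcal L_{u,F}$, $d\rho_{\mathscr T}(s)\times d\nu_{\mathscr T}(z)\big(\sum_F\sum_{u\in\Omega_F}g_{u,F}\big)=\sum_F\sum_{u\in\Omega_F}d\rho_u(s)\,d\nu_u(z)\,g_{u,F}$; (3) $\rho_{\mathsf{root}}$ and $\nu_{\mathsf{root}}$ are probability measures. Hausdorff moment sequence: $\{\mathfrak a_n\}$ is a Hausdorff moment sequence if there are $b>0$ and a positive Borel measure $\mu$ on the finite interval $[0,b]$ with $\mathfrak a_n=\int_{[0,b]}s^n\,d\mu(s)$ for all $n\in\mathbb N$; $\mu$, which is unique, is its representing measure.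
   Formalization: The formulas are shown to give a representing measure; for an arbitrary one, ρ_root is as stated, but ρ_u×ν_u is identified only when L_{u,F}≠0 and only after replacing z by (|z_1|,…,|z_d|), since literal uniqueness fails (d=1: any probability measure on the circle can be ν_root). *)

theory Defs
  imports "HOL-Probability.Probability_Measure" "Graph_Theory.Digraph_Component"
begin

section \<open>Rooted directed trees and their directed Cartesian products\<close>

text \<open>The library's \<open>tree\<close> means: connected (as an undirected graph) and without
  directed cycles, loops included.\<close>

definition rooted_directed_tree :: "'a pair_pre_digraph \<Rightarrow> bool" where
  "rooted_directed_tree G \<longleftrightarrow> pair_wf_digraph G \<and> Digraph_Component.tree (with_proj G) \<and>
     (\<forall>u u' v. (u, v) \<in> parcs G \<and> (u', v) \<in> parcs G \<longrightarrow> u = u') \<and>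
     (\<exists>!r. r \<in> pverts G \<and> (\<forall>u. (u, r) \<notin> parcs G))"

definition root :: "'a pair_pre_digraph \<Rightarrow> 'a" where
  "root G = (THE r. r \<in> pverts G \<and> (\<forall>u. (u, r) \<notin> parcs G))"

definition chi :: "'a pair_pre_digraph \<Rightarrow> 'a \<Rightarrow> 'a set" where
  "chi G u = {w. (u, w) \<in> parcs G}"

definition par :: "'a pair_pre_digraph \<Rightarrow> 'a \<Rightarrow> 'a" where
  "par G u = (THE p. (p, u) \<in> parcs G)"

definition sib :: "'a pair_pre_digraph \<Rightarrow> 'a \<Rightarrow> 'a set" where
  "sib G u = chi G (par G u)"

definition depth :: "'a pair_pre_digraph \<Rightarrow> 'a \<Rightarrow> nat" where
  "depth G u = (THE n. (root G, u) \<in> parcs G ^^ n)"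

definition leafless :: "'a pair_pre_digraph \<Rightarrow> bool" where
  "leafless G \<longleftrightarrow> (\<forall>u\<in>pverts G. chi G u \<noteq> {})"

definition locally_finite :: "'a pair_pre_digraph \<Rightarrow> bool" where
  "locally_finite G \<longleftrightarrow> (\<forall>u\<in>pverts G. finite (chi G u))"

definition branching_vertices :: "'a pair_pre_digraph \<Rightarrow> 'a set" where
  "branching_vertices G = {u \<in> pverts G. \<exists>w\<in>chi G u. \<exists>w'\<in>chi G u. w \<noteq> w'}"

text \<open>The index set \<open>{1, \<dots>, d}\<close> is a finite type \<open>'d\<close>; a family of trees is a function \<open>T\<close>
  on \<open>'d\<close>, and vertices of the product are functions on \<open>'d\<close>.\<close>

definition dcprod :: "('d \<Rightarrow> 'a pair_pre_digraph) \<Rightarrow> ('d \<Rightarrow> 'a) pair_pre_digraph" where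
  "dcprod T = \<lparr> pverts = {v. \<forall>j. v j \<in> pverts (T j)},
     parcs = {(v, w). (\<forall>j. v j \<in> pverts (T j)) \<and> (\<forall>j. w j \<in> pverts (T j)) \<and>
                (\<exists>k. (\<forall>j. j \<noteq> k \<longrightarrow> v j = w j) \<and> (v k, w k) \<in> parcs (T k))} \<rparr>"

abbreviation prod_verts :: "('d \<Rightarrow> 'a pair_pre_digraph) \<Rightarrow> ('d \<Rightarrow> 'a) set" where
  "prod_verts T \<equiv> pverts (dcprod T)"

definition prod_root :: "('d \<Rightarrow> 'a pair_pre_digraph) \<Rightarrow> 'd \<Rightarrow> 'a" where
  "prod_root T = (\<lambda>j. root (T j))"

definition prod_depth :: "('d \<Rightarrow> 'a pair_pre_digraph) \<Rightarrow> ('d \<Rightarrow> 'a) \<Rightarrow> 'd \<Rightarrow> nat" where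
  "prod_depth T v = (\<lambda>j. depth (T j) (v j))"

definition prod_chi :: "('d \<Rightarrow> 'a pair_pre_digraph) \<Rightarrow> 'd \<Rightarrow> ('d \<Rightarrow> 'a) \<Rightarrow> ('d \<Rightarrow> 'a) set" where
  "prod_chi T j v = {w \<in> prod_verts T. (\<forall>i. i \<noteq> j \<longrightarrow> w i = v i) \<and> w j \<in> chi (T j) (v j)}"

definition prod_par :: "('d \<Rightarrow> 'a pair_pre_digraph) \<Rightarrow> 'd \<Rightarrow> ('d \<Rightarrow> 'a) \<Rightarrow> ('d \<Rightarrow> 'a)" where
  "prod_par T j w = w(j := par (T j) (w j))"

definition prod_sib :: "('d \<Rightarrow> 'a pair_pre_digraph) \<Rightarrow> 'd \<Rightarrow> ('d \<Rightarrow> 'a) \<Rightarrow> ('d \<Rightarrow> 'a) set" where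
  "prod_sib T j v = {w \<in> prod_verts T. (\<forall>i. i \<noteq> j \<longrightarrow> w i = v i) \<and> w j \<in> sib (T j) (v j)}"

definition finite_joint_branching_index :: "('d \<Rightarrow> 'a pair_pre_digraph) \<Rightarrow> bool" where
  "finite_joint_branching_index T \<longleftrightarrow>
     (\<forall>j. bdd_above (depth (T j) ` branching_vertices (T j)))"


section \<open>Square-summable functions\<close>

text \<open>Elements of \<open>l\<^sup>2(V)\<close> are functions on the ambient type that vanish outside \<open>V\<close>.\<close>

definition l2 :: "'v set \<Rightarrow> ('v \<Rightarrow> complex) set" where
  "l2 V = {f. (\<forall>v. v \<notin> V \<longrightarrow> f v = 0) \<and> (\<lambda>v. (cmod (f v))\<^sup>2) summable_on V}"

definition l2_inner :: "'v set \<Rightarrow> ('v \<Rightarrow> complex) \<Rightarrow> ('v \<Rightarrow> complex) \<Rightarrow> complex" where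
  "l2_inner V f g = (\<Sum>\<^sub>\<infinity>v\<in>V. f v * cnj (g v))"

definition l2_norm :: "'v set \<Rightarrow> ('v \<Rightarrow> complex) \<Rightarrow> real" where
  "l2_norm V f = sqrt (\<Sum>\<^sub>\<infinity>v\<in>V. (cmod (f v))\<^sup>2)"

definition l2_adjoint ::
  "'v set \<Rightarrow> (('v \<Rightarrow> complex) \<Rightarrow> ('v \<Rightarrow> complex)) \<Rightarrow> ('v \<Rightarrow> complex) \<Rightarrow> ('v \<Rightarrow> complex)" where
  "l2_adjoint V S f =
     (THE h. h \<in> l2 V \<and> (\<forall>g\<in>l2 V. l2_inner V (S g) f = l2_inner V g h))"

definition basis_vec :: "'v \<Rightarrow> 'v \<Rightarrow> complex" where
  "basis_vec v = (\<lambda>w. if w = v then 1 else 0)"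

text \<open>\<open>S\<^sup>\<alpha>\<close> for a commuting tuple \<open>S\<close>. The fold over the (unordered) index type is meaningful
  precisely because the factors commute.\<close>

definition multi_power :: "('d::finite \<Rightarrow> 'x \<Rightarrow> 'x) \<Rightarrow> ('d \<Rightarrow> nat) \<Rightarrow> 'x \<Rightarrow> 'x" where
  "multi_power S \<alpha> = Finite_Set.fold (\<lambda>j R. (S j ^^ \<alpha> j) \<circ> R) id UNIV"

definition msize :: "('d::finite \<Rightarrow> nat) \<Rightarrow> nat" where
  "msize \<alpha> = (\<Sum>j\<in>UNIV. \<alpha> j)"

definition mmonom :: "complex ^ 'd::finite \<Rightarrow> ('d \<Rightarrow> nat) \<Rightarrow> complex" where
  "mmonom z \<alpha> = (\<Prod>j\<in>UNIV. (z $ j) ^ \<alpha> j)"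


section \<open>The multishift and its joint cokernel\<close>

text \<open>\<open>\<lambda>\<^sub>j(w)\<close>; only used when \<open>w j\<close> is not the root of \<open>T j\<close>, so that \<open>prod_par T j w\<close> is
  the vertex \<open>v\<close> with \<open>w \<in> Chi\<^sub>j(v)\<close>.\<close>

definition weight ::
  "('d::finite \<Rightarrow> 'a pair_pre_digraph) \<Rightarrow> (nat \<Rightarrow> real) \<Rightarrow> 'd \<Rightarrow> ('d \<Rightarrow> 'a) \<Rightarrow> real" where
  "weight T c j w =
     (let v = prod_par T j w; n = msize (prod_depth T v) in
        sqrt (c n / real (card (prod_chi T j v))) *
        sqrt ((real (prod_depth T v j) + 1) / (real n + real CARD('d))))"

text \<open>The continuous linear extension of \<open>S\<^sub>j e\<^sub>v = (\<Sum>w\<in>Chi\<^sub>j(v). \<lambda>\<^sub>j(w) e\<^sub>w)\<close> written in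
  coordinates: every \<open>w\<close> with \<open>w j\<close> not the root lies in \<open>Chi\<^sub>j(v)\<close> for exactly one \<open>v\<close>.
  See \<open>multishift_basis_vec\<close> below.\<close>

definition multishift ::
  "('d::finite \<Rightarrow> 'a pair_pre_digraph) \<Rightarrow> (nat \<Rightarrow> real) \<Rightarrow> 'd \<Rightarrow>
     (('d \<Rightarrow> 'a) \<Rightarrow> complex) \<Rightarrow> (('d \<Rightarrow> 'a) \<Rightarrow> complex)" where
  "multishift T c j f =
     (\<lambda>w. if w \<in> prod_verts T \<and> w j \<noteq> root (T j)
          then of_real (weight T c j w) * f (prod_par T j w) else 0)"

definition joint_cokernel ::
  "('d::finite \<Rightarrow> 'a pair_pre_digraph) \<Rightarrow> (nat \<Rightarrow> real) \<Rightarrow> (('d \<Rightarrow> 'a) \<Rightarrow> complex) set" where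
  "joint_cokernel T c =
     {f \<in> l2 (prod_verts T). \<forall>j. l2_adjoint (prod_verts T) (multishift T c j) f = (\<lambda>_. 0)}"


section \<open>The spaces \<open>L\<^sub>u\<^sub>,\<^sub>F\<close>\<close>

definition Phi :: "('d \<Rightarrow> 'a pair_pre_digraph) \<Rightarrow> 'd set \<Rightarrow> ('d \<Rightarrow> 'a) set" where
  "Phi T F = {v \<in> prod_verts T. \<forall>j. (j \<in> F \<longrightarrow> v j \<noteq> root (T j)) \<and> (j \<notin> F \<longrightarrow> v j = root (T j))}"

definition sib_on :: "('d \<Rightarrow> 'a pair_pre_digraph) \<Rightarrow> 'd set \<Rightarrow> ('d \<Rightarrow> 'a) \<Rightarrow> ('d \<Rightarrow> 'a) set" where
  "sib_on T F u = {w \<in> prod_verts T. \<forall>j. (j \<in> F \<longrightarrow> w j \<in> sib (T j) (u j)) \<and> (j \<notin> F \<longrightarrow> w j = u j)}"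

definition sib_transversal ::
  "('d \<Rightarrow> 'a pair_pre_digraph) \<Rightarrow> 'd set \<Rightarrow> ('d \<Rightarrow> 'a) set \<Rightarrow> bool" where
  "sib_transversal T F X \<longleftrightarrow> X \<subseteq> Phi T F \<and> (\<forall>u\<in>Phi T F. \<exists>!x. x \<in> X \<and> x \<in> sib_on T F u)"

definition restrict_to :: "('d \<Rightarrow> 'a pair_pre_digraph) \<Rightarrow> 'd set \<Rightarrow> ('d \<Rightarrow> 'a) \<Rightarrow> 'd \<Rightarrow> 'a" where
  "restrict_to T G v = (\<lambda>j. if j \<in> G then v j else root (T j))"

definition sib_on_restrict ::
  "('d \<Rightarrow> 'a pair_pre_digraph) \<Rightarrow> 'd set \<Rightarrow> 'd set \<Rightarrow> ('d \<Rightarrow> 'a) \<Rightarrow> ('d \<Rightarrow> 'a) set" where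
  "sib_on_restrict T F G u = restrict_to T G ` sib_on T F u"

definition Lspace ::
  "('d::finite \<Rightarrow> 'a pair_pre_digraph) \<Rightarrow> (nat \<Rightarrow> real) \<Rightarrow> 'd set \<Rightarrow> ('d \<Rightarrow> 'a) \<Rightarrow>
     (('d \<Rightarrow> 'a) \<Rightarrow> complex) set" where
  "Lspace T c F u =
     {f \<in> l2 (sib_on T F u).
        \<forall>j\<in>F. \<forall>x\<in>sib_on_restrict T F (F - {j}) u.
          (\<Sum>w\<in>prod_sib T j (x(j := u j)). f w * of_real (weight T c j w)) = 0}"


section \<open>The analytic model\<close>

text \<open>A power series \<open>\<Sum>\<alpha>. f\<^sub>\<alpha> z\<^sup>\<alpha>\<close> is represented by its family of coefficients.\<close>

type_synonym ('d, 'v) series = "('d \<Rightarrow> nat) \<Rightarrow> 'v \<Rightarrow> complex"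

definition model_space ::
  "('d::finite \<Rightarrow> 'a pair_pre_digraph) \<Rightarrow> (nat \<Rightarrow> real) \<Rightarrow> ('d, 'd \<Rightarrow> 'a) series set" where
  "model_space T c =
     {f. (\<forall>\<alpha>. f \<alpha> \<in> joint_cokernel T c) \<and>
         (\<lambda>\<alpha>. (l2_norm (prod_verts T) (multi_power (multishift T c) \<alpha> (f \<alpha>)))\<^sup>2) summable_on UNIV}"

definition model_norm ::
  "('d::finite \<Rightarrow> 'a pair_pre_digraph) \<Rightarrow> (nat \<Rightarrow> real) \<Rightarrow> ('d, 'd \<Rightarrow> 'a) series \<Rightarrow> real" where
  "model_norm T c f =
     sqrt (\<Sum>\<^sub>\<infinity>\<alpha>. (l2_norm (prod_verts T) (multi_power (multishift T c) \<alpha> (f \<alpha>)))\<^sup>2)"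

definition const_series :: "('v \<Rightarrow> complex) \<Rightarrow> ('d, 'v) series" where
  "const_series g = (\<lambda>\<alpha>. if \<alpha> = (\<lambda>_. 0) then g else (\<lambda>_. 0))"

definition coord_mult :: "'d \<Rightarrow> ('d, 'v) series \<Rightarrow> ('d, 'v) series" where
  "coord_mult j f = (\<lambda>\<alpha>. if \<alpha> j = 0 then (\<lambda>_. 0) else f (\<alpha>(j := \<alpha> j - 1)))"


section \<open>Normalized surface measure on the unit sphere\<close>

text \<open>The cone construction: \<open>\<sigma>(A)\<close> is the normalized volume of the part of the unit ball
  lying over \<open>A\<close>. It is regarded as a Borel measure on \<open>\<complex>\<^sup>d\<close> concentrated on the sphere.\<close>

definition sphere_measure :: "'n::euclidean_space measure" where
  "sphere_measure = distr (uniform_measure lborel (ball 0 1)) borel (\<lambda>z. z /\<^sub>R norm z)"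


section \<open>Representing measures\<close>

text \<open>A \<open>B(E)\<close>-valued measure on the Borel sets, countably additive in the weak operator sense.\<close>

definition operator_measure ::
  "'v set \<Rightarrow> ('v \<Rightarrow> complex) set \<Rightarrow>
     ('p::topological_space set \<Rightarrow> ('v \<Rightarrow> complex) \<Rightarrow> ('v \<Rightarrow> complex)) \<Rightarrow> bool" where
  "operator_measure V E R \<longleftrightarrow>
     (\<forall>A\<in>sets borel.
        (\<forall>f\<in>E. R A f \<in> E) \<and>
        (\<forall>f\<in>E. \<forall>g\<in>E. R A (\<lambda>v. f v + g v) = (\<lambda>v. R A f v + R A g v)) \<and>
        (\<forall>f\<in>E. \<forall>k. R A (\<lambda>v. k * f v) = (\<lambda>v. k * R A f v)) \<and>
        (\<exists>K. \<forall>f\<in>E. l2_norm V (R A f) \<le> K * l2_norm V f)) \<and>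
     (\<forall>A :: nat \<Rightarrow> 'p set. range A \<subseteq> sets borel \<and> disjoint_family A \<longrightarrow>
        (\<forall>f\<in>E. \<forall>g\<in>E. (\<lambda>n. l2_inner V (R (A n) f) g) sums l2_inner V (R (\<Union>n. A n) f) g))"

text \<open>The scalar measure \<open>A \<mapsto> \<langle>R(A) f, f\<rangle>\<close>.\<close>

definition quadratic_measure ::
  "'v set \<Rightarrow> ('p::topological_space set \<Rightarrow> ('v \<Rightarrow> complex) \<Rightarrow> ('v \<Rightarrow> complex)) \<Rightarrow>
     ('v \<Rightarrow> complex) \<Rightarrow> 'p measure" where
  "quadratic_measure V R f =
     measure_of UNIV (sets borel) (\<lambda>A. ennreal (Re (l2_inner V (R A f) f)))"

text \<open>\<open>R\<close> is the \<open>B(E)\<close>-valued product measure and \<open>\<rho> u\<close>, \<open>\<nu> u\<close> are the scalar measures;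
  since the sets \<open>Phi T F\<close> are disjoint, \<open>u\<close> alone determines \<open>F\<close>. The sums over
  \<open>u \<in> \<Omega> F\<close> are taken pointwise: the members of the family have disjoint supports.\<close>

definition representing_measure ::
  "('d::finite \<Rightarrow> 'a pair_pre_digraph) \<Rightarrow> (nat \<Rightarrow> real) \<Rightarrow> ('d set \<Rightarrow> ('d \<Rightarrow> 'a) set) \<Rightarrow> real \<Rightarrow>
     ((real \<times> (complex ^ 'd)) set \<Rightarrow> (('d \<Rightarrow> 'a) \<Rightarrow> complex) \<Rightarrow> (('d \<Rightarrow> 'a) \<Rightarrow> complex)) \<Rightarrow>
     (('d \<Rightarrow> 'a) \<Rightarrow> real measure) \<Rightarrow> (('d \<Rightarrow> 'a) \<Rightarrow> (complex ^ 'd) measure) \<Rightarrow> bool" where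
  "representing_measure T c \<Omega> b R \<rho> \<nu> \<longleftrightarrow>
     b > 0 \<and>
     operator_measure (prod_verts T) (joint_cokernel T c) R \<and>
     (\<forall>F. \<forall>u\<in>\<Omega> F.
        finite_measure (\<rho> u) \<and> sets (\<rho> u) = sets borel \<and> emeasure (\<rho> u) (- {0..b}) = 0 \<and>
        finite_measure (\<nu> u) \<and> sets (\<nu> u) = sets borel \<and> emeasure (\<nu> u) (- sphere 0 1) = 0) \<and>
     (\<forall>f\<in>joint_cokernel T c. \<forall>\<alpha>.
        (model_norm T c (multi_power coord_mult \<alpha> (const_series f)))\<^sup>2 =
        (LINT p : {0..b} \<times> sphere 0 1 | quadratic_measure (prod_verts T) R f.
           fst p ^ msize \<alpha> * (cmod (mmonom (snd p) \<alpha>))\<^sup>2)) \<and>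
     (\<forall>g. (\<forall>F. \<forall>u\<in>\<Omega> F. g F u \<in> Lspace T c F u) \<longrightarrow>
        (\<forall>A\<in>sets borel.
           R A (\<lambda>v. \<Sum>F\<in>UNIV. \<Sum>\<^sub>\<infinity>u\<in>\<Omega> F. g F u v) =
           (\<lambda>v. \<Sum>F\<in>UNIV. \<Sum>\<^sub>\<infinity>u\<in>\<Omega> F. of_real (measure (\<rho> u \<Otimes>\<^sub>M \<nu> u) A) * g F u v))) \<and>
     prob_space (\<rho> (prod_root T)) \<and> prob_space (\<nu> (prod_root T))"


section \<open>Hausdorff moment sequences\<close>

definition hausdorff_representing :: "real \<Rightarrow> (nat \<Rightarrow> real) \<Rightarrow> real measure \<Rightarrow> bool" where
  "hausdorff_representing b a \<mu> \<longleftrightarrow>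
     finite_measure \<mu> \<and> sets \<mu> = sets borel \<and> emeasure \<mu> (- {0..b}) = 0 \<and>
     (\<forall>n. a n = (LINT s : {0..b} | \<mu>. s ^ n))"

definition hausdorff_moment_seq :: "(nat \<Rightarrow> real) \<Rightarrow> bool" where
  "hausdorff_moment_seq a \<longleftrightarrow> (\<exists>b>0. \<exists>\<mu>. hausdorff_representing b a \<mu>)"

definition moment_seq :: "(nat \<Rightarrow> real) \<Rightarrow> nat \<Rightarrow> real" where
  "moment_seq c n = (\<Prod>j<n. c j)"

definition rho_formula ::
  "('d::finite \<Rightarrow> 'a pair_pre_digraph) \<Rightarrow> (nat \<Rightarrow> real) \<Rightarrow> real measure \<Rightarrow> ('d \<Rightarrow> 'a) \<Rightarrow> real measure" where
  "rho_formula T c \<mu> u =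
     (let n = msize (prod_depth T u) in density \<mu> (\<lambda>s. ennreal (s ^ n / moment_seq c n)))"

definition nu_formula ::
  "('d::finite \<Rightarrow> 'a pair_pre_digraph) \<Rightarrow> ('d \<Rightarrow> 'a) \<Rightarrow> (complex ^ 'd) measure" where
  "nu_formula T u =
     density sphere_measure
       (\<lambda>z. ennreal ((cmod (mmonom z (prod_depth T u)))\<^sup>2 /
              (LINT z|sphere_measure. (cmod (mmonom z (prod_depth T u)))\<^sup>2)))"

text \<open>The defining conditions see \<open>z\<close> only through the moduli \<open>\<bar>z\<^sub>j\<bar>\<close>, and see \<open>\<rho> u\<close> and \<open>\<nu> u\<close>
  only through their product; a representing measure is therefore determined at best up to
  replacing \<open>(\<rho> u, \<nu> u)\<close> by \<open>(t \<rho> u, t\<inverse> \<nu> u)\<close> and up to phases. (For \<open>d = 1\<close> every probability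
  measure on the unit circle may serve as \<open>\<nu> u\<close>.) The following image of the product forgets
  exactly these data.\<close>

definition modulus_image ::
  "real measure \<Rightarrow> (complex ^ 'd::finite) measure \<Rightarrow> (real \<times> (real ^ 'd)) measure" where
  "modulus_image \<rho> \<nu> = distr (\<rho> \<Otimes>\<^sub>M \<nu>) borel (\<lambda>(s, z). (s, \<chi> j. cmod (z $ j)))"


section \<open>Consistency of the definitions\<close>

lemma chi_par:
  assumes "rooted_directed_tree G" "w \<in> chi G v"
  shows "par G w = v" "w \<noteq> root G" "v \<in> pverts G" "w \<in> pverts G"
proof -
  have wf: "pair_wf_digraph G" and vw: "(v, w) \<in> parcs G"
    using assms by (auto simp: rooted_directed_tree_def chi_def)
  show "par G w = v"
    unfolding par_def using assms(1) vw by (intro the_equality) (auto simp: rooted_directed_tree_def)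
  have "\<exists>!r. r \<in> pverts G \<and> (\<forall>u. (u, r) \<notin> parcs G)"
    using assms(1) by (auto simp: rooted_directed_tree_def)
  from theI'[OF this] show "w \<noteq> root G" using vw by (auto simp: root_def)
  show "v \<in> pverts G" "w \<in> pverts G"
    using pair_wf_digraph.in_arcsD1[OF wf vw] pair_wf_digraph.in_arcsD2[OF wf vw] .
qed

lemma par_arc:
  assumes "rooted_directed_tree G" "w \<in> pverts G" "w \<noteq> root G"
  shows "(par G w, w) \<in> parcs G"
proof -
  have "\<exists>!r. r \<in> pverts G \<and> (\<forall>u. (u, r) \<notin> parcs G)"
    using assms(1) by (auto simp: rooted_directed_tree_def)
  then have "\<exists>u. (u, w) \<in> parcs G"
    using assms(2,3) the1_equality[of "\<lambda>r. r \<in> pverts G \<and> (\<forall>u. (u, r) \<notin> parcs G)" w]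
    by (auto simp: root_def)
  then obtain u where "(u, w) \<in> parcs G" by blast
  then show ?thesis using chi_par(1)[OF assms(1), of w u] by (simp add: chi_def)
qed

lemma root_in: assumes "rooted_directed_tree G"
  shows "root G \<in> pverts G" "(u, root G) \<notin> parcs G"
proof -
  have "\<exists>!r. r \<in> pverts G \<and> (\<forall>u. (u, r) \<notin> parcs G)"
    using assms(1) by (auto simp: rooted_directed_tree_def)
  from theI'[OF this] show "root G \<in> pverts G" "(u, root G) \<notin> parcs G" by (auto simp: root_def)
qed

lemma root_reaches:
  assumes "rooted_directed_tree G" "w \<in> pverts G"
  shows "(root G, w) \<in> (parcs G)\<^sup>*"
proof -
  have uniq: "\<And>u u' v. (u, v) \<in> parcs G \<Longrightarrow> (u', v) \<in> parcs G \<Longrightarrow> u = u'"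
    using assms(1) by (auto simp: rooted_directed_tree_def)
  have "root G \<rightarrow>\<^sup>*\<^bsub>with_proj (mk_symmetric (with_proj G))\<^esub> w"
    using assms root_in(1)[OF assms(1)]
    by (auto simp: rooted_directed_tree_def tree_def connected_def strongly_connected_def mk_symmetric_def)
  then have "(root G, w) \<in> (parcs (mk_symmetric (with_proj G)))\<^sup>*"
    by (auto simp: reachable_def dest!: rtrancl_on_rtranclI)
  then show ?thesis
  proof (induction rule: rtrancl_induct)
    case (step y z)
    then consider "(y, z) \<in> parcs G" | "(z, y) \<in> parcs G"
      by (auto simp: mk_symmetric_def)
    then show ?case
    proof cases
      case 2
      then have "y \<noteq> root G" using root_in(2)[OF assms(1)] by auto
      then obtain p where "(root G, p) \<in> (parcs G)\<^sup>*" "(p, y) \<in> parcs G"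
        using step.IH by (metis rtranclE)
      then show ?thesis using uniq 2 by blast
    qed (use step in auto)
  qed simp
qed

lemma depth_unique:
  assumes "rooted_directed_tree G" "(root G, w) \<in> parcs G ^^ m" "(root G, w) \<in> parcs G ^^ n"
  shows "m = n"
  using assms(2,3)
proof (induction m arbitrary: n w)
  case 0
  then show ?case using root_in(2)[OF assms(1)] by (cases n) auto
next
  case (Suc m)
  then obtain p where p: "(root G, p) \<in> parcs G ^^ m" "(p, w) \<in> parcs G" by auto
  then have "n \<noteq> 0" using Suc.prems root_in(2)[OF assms(1)] by (cases n) auto
  then obtain n' where n': "n = Suc n'" by (cases n) auto
  then obtain q where q: "(root G, q) \<in> parcs G ^^ n'" "(q, w) \<in> parcs G" using Suc.prems by auto
  then have "p = q" using p assms(1) unfolding rooted_directed_tree_def by blast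
  then show ?case using Suc.IH p q n' by auto
qed

lemma depth_eqI:
  assumes "rooted_directed_tree G" "(root G, w) \<in> parcs G ^^ n" 
  shows "depth G w = n"
  unfolding depth_def using assms depth_unique[OF assms(1)] by (intro the_equality) auto

lemma depth_chi:
  assumes "rooted_directed_tree G" "w \<in> chi G v" shows "depth G w = Suc (depth G v)"
proof -
  have "(root G, v) \<in> (parcs G)\<^sup>*" using root_reaches[OF assms(1) chi_par(3)[OF assms]] .
  then obtain n where n: "(root G, v) \<in> parcs G ^^ n" by (metis rtrancl_imp_relpow)
  then have "(root G, w) \<in> parcs G ^^ Suc n" using assms by (auto simp: chi_def)
  then show ?thesis using n depth_eqI[OF assms(1)] by metis
qed

lemma multishift_basis_vec:
  assumes "\<And>j. rooted_directed_tree (T j)" "\<And>j. locally_finite (T j)" "v \<in> prod_verts T"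
  shows "finite (prod_chi T j v)"
    and "multishift T c j (basis_vec v) =
      (\<lambda>u. \<Sum>w\<in>prod_chi T j v. of_real (weight T c j w) * basis_vec w u)"
proof -
  have "prod_chi T j v \<subseteq> (\<lambda>x. v(j := x)) ` chi (T j) (v j)"
    by (force simp: prod_chi_def)
  moreover have "finite (chi (T j) (v j))" using assms by (auto simp: locally_finite_def dcprod_def)
  ultimately show fin: "finite (prod_chi T j v)" by (meson finite_imageI finite_subset)
  show "multishift T c j (basis_vec v) =
      (\<lambda>u. \<Sum>w\<in>prod_chi T j v. of_real (weight T c j w) * basis_vec w u)"
  proof
    fix u
    have "u \<in> prod_chi T j v \<longleftrightarrow> u \<in> prod_verts T \<and> u j \<noteq> root (T j) \<and> prod_par T j u = v"
    proof safe
      assume u: "u \<in> prod_chi T j v"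
      then have uj: "u j \<in> chi (T j) (v j)" by (simp add: prod_chi_def)
      show "u \<in> prod_verts T" using u by (simp add: prod_chi_def)
      show "u j = root (T j) \<Longrightarrow> False" using chi_par(2)[OF assms(1) uj] by simp
      show "prod_par T j u = v"
        using u chi_par(1)[OF assms(1) uj] by (auto simp: prod_par_def prod_chi_def fun_eq_iff)
    next
      assume "u \<in> prod_verts T" "u j \<noteq> root (T j)" "v = prod_par T j u"
      then show "u \<in> prod_chi T j (prod_par T j u)"
        using par_arc[OF assms(1), of "u j" j] by (auto simp: prod_chi_def prod_par_def chi_def dcprod_def)
    qed
    then show "multishift T c j (basis_vec v) u =
       (\<Sum>w\<in>prod_chi T j v. of_real (weight T c j w) * basis_vec w u)"
      using fin by (auto simp: multishift_def basis_vec_def if_distrib sum.delta' cong: if_cong)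
  qed
qed

lemma multishift_commute:
  assumes T: "\<And>j. rooted_directed_tree (T j)"
  shows "multishift T c i (multishift T c j f) = multishift T c j (multishift T c i f)"
proof (cases "i = j")
  case False
  show ?thesis
  proof
    fix w
    show "multishift T c i (multishift T c j f) w = multishift T c j (multishift T c i f) w"
    proof (cases "w \<in> prod_verts T \<and> w i \<noteq> root (T i) \<and> w j \<noteq> root (T j)")
      case True
      have arc: "(par (T k) (w k), w k) \<in> parcs (T k)" if "k \<in> {i, j}" for k
        using par_arc[OF T, of "w k" k] True that by (auto simp: dcprod_def)
      have V: "prod_par T k w \<in> prod_verts T" if "k \<in> {i, j}" for k
        using True chi_par(3)[OF T, of "w k" k] arc[OF that] by (auto simp: prod_par_def dcprod_def chi_def)
      have dep: "depth (T k) (w k) = Suc (depth (T k) (par (T k) (w k)))" if "k \<in> {i, j}" for k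
        using depth_chi[OF T] arc[OF that] by (simp add: chi_def)
      have sum: "msize (prod_depth T w) = Suc (msize (prod_depth T (prod_par T k w)))" if "k \<in> {i, j}" for k
      proof -
        have "msize (prod_depth T w) = depth (T k) (w k) + (\<Sum>l\<in>UNIV-{k}. depth (T l) (w l))"
          by (simp add: msize_def prod_depth_def sum.remove[of UNIV k])
        moreover have "msize (prod_depth T (prod_par T k w)) = depth (T k) (par (T k) (w k)) + (\<Sum>l\<in>UNIV-{k}. depth (T l) (w l))"
          by (simp add: msize_def prod_depth_def prod_par_def sum.remove[of UNIV k])
        ultimately show ?thesis using dep[OF that] by simp
      qed
      have sumeq: "msize (prod_depth T (prod_par T i w)) = msize (prod_depth T (prod_par T j w))"
        using sum[of i] sum[of j] by simp
      have comm: "prod_par T i (prod_par T j w) = prod_par T j (prod_par T i w)"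
        using False by (auto simp: prod_par_def fun_eq_iff)
      have card: "card (prod_chi T k v) = card (chi (T k) (v k))" if "v \<in> prod_verts T" for k v
      proof -
        have "prod_chi T k v = (\<lambda>x. v(k := x)) ` chi (T k) (v k)"
          using that chi_par(4)[OF T] by (force simp: prod_chi_def dcprod_def)
        moreover have "inj_on (\<lambda>x. v(k := x)) (chi (T k) (v k))" by (auto simp: inj_on_def dest: fun_upd_eqD)
        ultimately show ?thesis by (simp add: card_image)
      qed
      have V2: "prod_par T i (prod_par T j w) \<in> prod_verts T"
        using V[of i] V[of j] False by (auto simp: prod_par_def dcprod_def split: if_splits)
      have pji: "prod_par T j w i = w i" "prod_par T i w j = w j" "prod_par T j w j = par (T j) (w j)" "prod_par T i w i = par (T i) (w i)"
        using False by (auto simp: prod_par_def)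
      have q: "prod_par T i (prod_par T j w) i = par (T i) (w i)" "prod_par T i (prod_par T j w) j = par (T j) (w j)"
        using False by (auto simp: prod_par_def)
      show ?thesis
        using True V pji
        apply (simp add: multishift_def comm flip: of_real_mult mult.assoc)
        apply (rule disjI2)
        apply (simp add: weight_def Let_def comm[symmetric] card V V2 q pji sumeq prod_depth_def)
        apply (simp add: real_sqrt_mult real_sqrt_divide sumeq[unfolded prod_depth_def] mult_ac)
        done
    next
      case False
      then show ?thesis using \<open>i \<noteq> j\<close> by (auto simp: multishift_def prod_par_def)
    qed
  qed
qed simp

lemma multi_power_coord_mult:
  "multi_power coord_mult \<alpha> (const_series g) = (\<lambda>\<beta>. if \<beta> = \<alpha> then g else (\<lambda>_. 0))"
  for \<alpha> :: "'d::finite \<Rightarrow> nat"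
proof -
  let ?M = "\<lambda>\<gamma>. (\<lambda>\<beta>. if \<beta> = \<gamma> then g else (\<lambda>_. 0)) :: ('d, _) series"
  let ?m = "\<lambda>j. coord_mult j :: ('d, _) series \<Rightarrow> _"
  have c1: "?m i (?m j x) = ?m j (?m i x)" for i j x
    by (cases "i = j") (auto simp: coord_mult_def fun_eq_iff fun_upd_twist)
  have c2: "(?m i ^^ m) (?m j x) = ?m j ((?m i ^^ m) x)" for i j m x
    by (induction m) (simp, simp only: funpow.simps comp_apply c1)
  have c3: "(?m i ^^ m) ((?m j ^^ n) x) = (?m j ^^ n) ((?m i ^^ m) x)" for i j m n x
    by (induction n) (simp, simp only: funpow.simps comp_apply c2)
  interpret comp_fun_commute "\<lambda>j R. (?m j ^^ \<alpha> j) \<circ> R :: ('d, 'a) series \<Rightarrow> ('d, 'a) series"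
    by standard (simp add: fun_eq_iff c3[unfolded fun_eq_iff])
  have st: "?m j (?M \<gamma>) = ?M (\<gamma>(j := Suc (\<gamma> j)))" for j \<gamma>
    by (auto simp: coord_mult_def fun_eq_iff)
  have pw: "(?m j ^^ n) (?M \<gamma>) = ?M (\<gamma>(j := \<gamma> j + n))" for j n \<gamma>
    by (induction n) (simp, simp add: st fun_upd_def cong: if_cong)
  have "Finite_Set.fold (\<lambda>j R. (?m j ^^ \<alpha> j) \<circ> R) id A (?M (\<lambda>_. 0)) = ?M (\<lambda>j. if j \<in> A then \<alpha> j else 0)"
    if "finite A" for A
    using that
  proof (induction A)
    case (insert j A)
    have u: "(\<lambda>k. if k \<in> A then \<alpha> k else 0)(j := (if j \<in> A then \<alpha> j else 0) + \<alpha> j) = (\<lambda>k. if k \<in> insert j A then \<alpha> k else 0)"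
      using insert by auto
    show ?case
      unfolding fold_insert[OF insert.hyps] comp_apply[of "?m j ^^ \<alpha> j"] insert.IH pw u ..
  qed simp
  from this[of UNIV] show ?thesis by (simp add: multi_power_def const_series_def)
qed

lemma prob_space_sphere_measure: "prob_space (sphere_measure :: 'n::euclidean_space measure)"
proof -
  have "emeasure lborel (ball (0::'n) 1) = ennreal (measure lborel (ball (0::'n) 1))"
    using emeasure_bounded_finite[of "ball (0::'n) 1"] by (intro emeasure_eq_ennreal_measure) auto
  moreover have "measure lborel (ball (0::'n) 1) > 0" by (simp add: content_ball_pos)
  ultimately have "prob_space (uniform_measure lborel (ball (0::'n) 1))"
    by (intro prob_space_uniform_measure) auto
  then show ?thesis
    unfolding sphere_measure_def by (rule prob_space.prob_space_distr) simp
qed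

lemma emeasure_sphere_measure_Compl_sphere:
  "emeasure (sphere_measure :: 'n::euclidean_space measure) (- sphere 0 1) = 0"
proof -
  have n: "norm (z /\<^sub>R norm z) = (if z = 0 then 0 else 1)" for z :: 'n
    by simp
  have "(\<lambda>z::'n. z /\<^sub>R norm z) -` (- sphere 0 1) = {z. norm (z /\<^sub>R norm z) \<noteq> 1}"
    by (auto simp del: norm_scaleR)
  also have "\<dots> = {0}"
    unfolding n by auto
  finally have "(\<lambda>z::'n. z /\<^sub>R norm z) -` (- sphere 0 1) = {0}" .
  then show ?thesis
    by (simp add: sphere_measure_def emeasure_distr emeasure_uniform_measure)
qed

end

(*
  Put a_n = c(0) ... c(n-1), N(beta) = int |z^beta|^2 d sigma and Q(beta) = a_|beta| N(beta).
  The weights are such that  || S^alpha f ||^2 = sum_v |f(v)|^2 Q(d_v + alpha) / Q(d_v)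
  for f in E. Since N(beta) = beta! (d-1)! / (|beta|+d-1)!, the formula measures for rho_u and
  nu_u have exactly these moments whenever mu represents a_n, and multiplication by
  (rho_v x nu_v)(A) at the vertex v preserves E because it is constant on siblings.
  Conversely, a representing measure satisfies
    int s^|alpha| d rho_u * int |z^alpha|^2 d nu_u = Q(d_u + alpha) / Q(d_u),
  and |z| = 1 on the sphere turns this into a recursion for the moments of rho_u. All mixed
  moments are thereby determined, and the Stone-Weierstrass theorem recovers the image of
  rho_u x nu_u under (s, z) |-> (s, |z_1|, ..., |z_d|).
*)
theory Submission
  imports Defs "HOL-Probability.Distributions"
begin

section \<open>Measures with equal moments on a compact set\<close>

text \<open>The norm formula holds because the factors by which \<open>S\<^sub>j\<close> stretches
  basis vectors have Q as a potential: after division by Q each \<open>S\<^sub>j\<close> only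
  translates depths by one in direction j. The formula is a finite sum because an only child must
  carry the value 0, so that under a finite joint branching index all of E lives on one finite set
  of vertices. For the converse, the obstacle is that condition (1) ties the power of s to |alpha|:
  moments of rho_u and nu_u enter only through products of linked size, and neither factor is known
  alone. The recursion unlinks them. Its multiplier is c(|d_u| + k), free of alpha, because the
  numbers (beta_j + 1) / (|beta| + d) add up to 1 over j. At the root, nu has mass 1, and the
  moments of rho can be read off. A Hausdorff moment sequence comes with an unspecified interval;
  a_n <= (sup c)^n forces its measure into [0, sup c]. The closed form of N(beta) comes from a
  Gaussian integral over C^d, evaluated once in polar coordinates and once as a product of planar
  integrals.\<close>

lemma finite_measure_eqI_closed:
  fixes M N :: "'a::topological_space measure"
  assumes "finite_measure M" "sets M = sets borel" "sets N = sets borel"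
    and eq: "\<And>C. closed C \<Longrightarrow> emeasure M C = emeasure N C"
  shows "M = N"
proof (rule measure_eqI_generator_eq[where E = "Collect closed" and \<Omega> = UNIV and A = "\<lambda>_. UNIV"])
  show "Int_stable (Collect closed :: 'a set set)"
    by (auto simp: Int_stable_def)
  show "sets M = sigma_sets UNIV (Collect closed)" "sets N = sigma_sets UNIV (Collect closed)"
    using assms(2,3) by (simp_all add: borel_eq_closed)
  show "emeasure M UNIV \<noteq> \<infinity>" for i :: nat
    using finite_measure.emeasure_finite[OF assms(1)] by simp
qed (use eq in auto)

lemma abs_integral_diff_le:
  fixes f g :: "'a \<Rightarrow> real"
  assumes "finite_measure M" "AE x in M. \<bar>f x - g x\<bar> \<le> e" "integrable M f" "integrable M g"
  shows "\<bar>(\<integral>x. f x \<partial>M) - (\<integral>x. g x \<partial>M)\<bar> \<le> e * measure M (space M)"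
proof -
  interpret finite_measure M by fact
  have "\<bar>(\<integral>x. f x \<partial>M) - (\<integral>x. g x \<partial>M)\<bar> = \<bar>\<integral>x. f x - g x \<partial>M\<bar>"
    using assms by simp
  also have "\<dots> \<le> (\<integral>x. \<bar>f x - g x\<bar> \<partial>M)"
    by (rule integral_abs_bound)
  also have "\<dots> \<le> (\<integral>x. e \<partial>M)"
    using assms by (intro integral_mono_AE) auto
  finally show ?thesis by (simp add: mult.commute)
qed

text \<open>The indicator of a closed set C is the pointwise limit of the continuous functions
  max(0, 1 - n dist(x, C)), all bounded by 1. Dominated convergence then recovers the measures of
  closed sets.\<close>

lemma finite_measure_eqI_continuous:
  fixes M N :: "'a::metric_space measure"
  assumes M: "finite_measure M" "sets M = sets borel" and N: "finite_measure N" "sets N = sets borel"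
    and eq: "\<And>f :: 'a \<Rightarrow> real. continuous_on UNIV f \<Longrightarrow> (\<And>x. \<bar>f x\<bar> \<le> 1) \<Longrightarrow> (\<integral>x. f x \<partial>M) = (\<integral>x. f x \<partial>N)"
  shows "M = N"
proof (rule finite_measure_eqI_closed[OF M N(2)])
  fix C :: "'a set" assume C: "closed C"
  show "emeasure M C = emeasure N C"
  \<comment> \<open>By convention \<open>infdist x {}\<close> is 0, so for empty C the functions
    below would be constantly 1.\<close>
  proof (cases "C = {}")
    case False
    define f where "f n x = max 0 (1 - real n * infdist x C)" for n x
    have cont: "continuous_on UNIV (f n)" for n
      unfolding f_def by (intro continuous_intros)
    have bound: "\<bar>f n x\<bar> \<le> 1" for n x
      by (auto simp: f_def infdist_nonneg)
    have lim: "(\<lambda>n. f n x) \<longlonglongrightarrow> indicator C x" for x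
    proof (cases "x \<in> C")
      case False
      then have pos: "infdist x C > 0"
        using infdist_pos_not_in_closed[OF C \<open>C \<noteq> {}\<close>] by auto
      obtain n0 where n0: "1 / infdist x C < real n0" using reals_Archimedean2 by blast
      have "f n x = 0" if "n \<ge> n0" for n
      proof -
        have "1 / infdist x C \<le> real n" using n0 that by linarith
        then show ?thesis using pos by (simp add: f_def field_simps max_def)
      qed
      then have "eventually (\<lambda>n. f n x = 0) sequentially"
        by (auto simp: eventually_sequentially)
      then show ?thesis using False by (simp add: tendsto_eventually)
    qed (simp add: f_def)
    have conv: "(\<lambda>n. \<integral>x. f n x \<partial>L) \<longlonglongrightarrow> measure L C"
      if "finite_measure L" "sets L = sets borel" for L :: "'a measure"
    proof -
      interpret finite_measure L by fact
      have "(\<lambda>n. \<integral>x. f n x \<partial>L) \<longlonglongrightarrow> (\<integral>x. indicator C x \<partial>L)"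
      proof (rule integral_dominated_convergence[where w = "\<lambda>_. 1"])
        show "f n \<in> borel_measurable L" for n
          using cont by (simp add: borel_measurable_continuous_onI measurable_cong_sets[OF that(2) refl])
        show "indicator C \<in> borel_measurable L"
          using C by (simp add: measurable_cong_sets[OF that(2) refl])
      qed (use lim bound in \<open>auto\<close>)
      also have "(\<integral>x. indicator C x \<partial>L) = measure L C"
        using sets_eq_imp_space_eq[OF that(2)] by simp
      finally show ?thesis .
    qed
    have "measure M C = measure N C"
      using conv[OF M] conv[OF N] eq[OF cont bound] by (simp add: LIMSEQ_unique)
    then show ?thesis
      using M N by (simp add: finite_measure.emeasure_eq_measure)
  qed simp
qed

text \<open>The linear span, generated by appending one scaled member of B at a time, so that every
  closure property is a short induction. For B closed under products it is the algebra to which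
  Stone-Weierstrass is applied.\<close>

inductive_set lin_comb :: "('a \<Rightarrow> real) set \<Rightarrow> ('a \<Rightarrow> real) set" for B where
  zero: "(\<lambda>_. 0) \<in> lin_comb B"
| add_scaled: "f \<in> lin_comb B \<Longrightarrow> g \<in> B \<Longrightarrow> (\<lambda>x. f x + k * g x) \<in> lin_comb B"

lemma lin_comb_base: "g \<in> B \<Longrightarrow> (\<lambda>x. k * g x) \<in> lin_comb B"
  using lin_comb.add_scaled[OF lin_comb.zero] by simp

lemma lin_comb_add:
  assumes "f \<in> lin_comb B" "g \<in> lin_comb B" shows "(\<lambda>x. f x + g x) \<in> lin_comb B"
  using assms(2)
proof induction
  case (add_scaled g h k)
  from lin_comb.add_scaled[OF add_scaled.IH add_scaled.hyps(2), of k] show ?case by (simp add: add.assoc)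
qed (simp add: assms)

text \<open>Bilinearity in two stages: a single factor from B is multiplied into f by induction on
  f, and the general second factor is then built up term by term.\<close>

lemma lin_comb_mult:
  assumes B: "\<And>f g. f \<in> B \<Longrightarrow> g \<in> B \<Longrightarrow> (\<lambda>x. f x * g x) \<in> B"
    and f: "f \<in> lin_comb B" and g: "g \<in> lin_comb B"
  shows "(\<lambda>x. f x * g x) \<in> lin_comb B"
proof -
  have base: "(\<lambda>x. f x * h x) \<in> lin_comb B" if "h \<in> B" for h
    using f
  proof induction
    case (add_scaled f b k)
    from lin_comb.add_scaled[OF add_scaled.IH B[OF add_scaled.hyps(2) that], of k]
    show ?case by (simp add: algebra_simps)
  qed (simp add: lin_comb.zero)
  have scale: "(\<lambda>x. k * h x) \<in> lin_comb B" if "h \<in> lin_comb B" for h k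
    using that
  proof induction
    case (add_scaled f b l)
    from lin_comb.add_scaled[OF add_scaled.IH add_scaled.hyps(2), of "k * l"]
    show ?case by (simp add: algebra_simps)
  qed (simp add: lin_comb.zero)
  show ?thesis
    using g
  proof induction
    case (add_scaled g b k)
    from lin_comb_add[OF add_scaled.IH scale[OF base[OF add_scaled.hyps(2)], of k]]
    show ?case by (simp add: algebra_simps)
  qed (simp add: lin_comb.zero)
qed

text \<open>By linearity the integrals agree on the span of B, an algebra that separates the points
  of K. It approximates every continuous function uniformly on K, and this suffices because K
  carries both measures.\<close>

lemma finite_measure_eqI_moments:
  fixes M N :: "'a::metric_space measure" and B :: "('a \<Rightarrow> real) set"
  assumes M: "finite_measure M" "sets M = sets borel" "emeasure M (- K) = 0"
    and N: "finite_measure N" "sets N = sets borel" "emeasure N (- K) = 0"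
    and K: "compact K"
    and B: "(\<lambda>_. 1) \<in> B" "\<And>f. f \<in> B \<Longrightarrow> continuous_on UNIV f"
      "\<And>f g. f \<in> B \<Longrightarrow> g \<in> B \<Longrightarrow> (\<lambda>x. f x * g x) \<in> B"
    and sep: "\<And>x y. x \<in> K \<Longrightarrow> y \<in> K \<Longrightarrow> x \<noteq> y \<Longrightarrow> \<exists>f\<in>B. f x \<noteq> f y"
    and eq: "\<And>f. f \<in> B \<Longrightarrow> (\<integral>x. f x \<partial>M) = (\<integral>x. f x \<partial>N)"
  shows "M = N"
proof (rule finite_measure_eqI_continuous[OF M(1,2) N(1,2)])
  have contR: "continuous_on UNIV g" if "g \<in> lin_comb B" for g
    using that by induction (simp_all add: B(2) continuous_on_add continuous_on_mult_left)
  have AEK: "AE x in L. x \<in> K" if L: "sets L = sets borel" "emeasure L (- K) = 0" for L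
    by (rule AE_I'[of "- K"]) (use L K in \<open>auto simp: null_sets_def compact_imp_closed\<close>)
  have int: "integrable L g"
    if L: "finite_measure L" "sets L = sets borel" "emeasure L (- K) = 0" and g: "continuous_on UNIV g"
    for L and g :: "'a \<Rightarrow> real"
  proof -
    have "compact (g ` K)"
      using K g by (meson compact_continuous_image continuous_on_subset subset_UNIV)
    then obtain b where b: "\<And>x. x \<in> K \<Longrightarrow> \<bar>g x\<bar> \<le> b"
      by (force dest!: compact_imp_bounded simp: bounded_iff)
    have "AE x in L. norm (g x) \<le> b"
      using AEK[OF L(2,3)] by eventually_elim (simp add: b)
    moreover have "g \<in> borel_measurable L"
      using g by (simp add: borel_measurable_continuous_onI measurable_cong_sets[OF L(2) refl])
    ultimately show ?thesis
      by (rule finite_measure.integrable_const_bound[OF L(1)])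
  qed
  have eqR: "(\<integral>x. g x \<partial>M) = (\<integral>x. g x \<partial>N)" if "g \<in> lin_comb B" for g
    using that
  proof induction
    case (add_scaled f g k)
    then show ?case
      using int[OF M contR[of f]] int[OF N contR[of f]] int[OF M B(2)[of g]] int[OF N B(2)[of g]]
      by (simp add: eq)
  qed simp
  interpret function_ring_on "lin_comb B" K
  proof
    show "compact K" by fact
    show "continuous_on K f" if "f \<in> lin_comb B" for f
      using contR[OF that] continuous_on_subset by blast
    show "(\<lambda>x. f x + g x) \<in> lin_comb B" if "f \<in> lin_comb B" "g \<in> lin_comb B" for f g
      using lin_comb_add that .
    show "(\<lambda>x. f x * g x) \<in> lin_comb B" if "f \<in> lin_comb B" "g \<in> lin_comb B" for f g
      by (rule lin_comb_mult[OF B(3) that])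
    show "(\<lambda>_. c) \<in> lin_comb B" for c
      using lin_comb_base[OF B(1), of c] by simp
    show "\<exists>f\<in>lin_comb B. f x \<noteq> f y" if "x \<in> K" "y \<in> K" "x \<noteq> y" for x y
      using sep[OF that] lin_comb_base[of _ B 1] by auto
  qed
  fix f :: "'a \<Rightarrow> real" assume f: "continuous_on UNIV f"
  define m where "m = measure M (space M) + measure N (space N)"
  have m: "m \<ge> 0" by (simp add: m_def)
  show "(\<integral>x. f x \<partial>M) = (\<integral>x. f x \<partial>N)"
  proof (rule ccontr)
    assume "(\<integral>x. f x \<partial>M) \<noteq> (\<integral>x. f x \<partial>N)"
    then have pos: "\<bar>(\<integral>x. f x \<partial>M) - (\<integral>x. f x \<partial>N)\<bar> > 0" (is "?D > 0") by simp
    \<comment> \<open>Each approximation costs e times the mass of one measure, hence e * m in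
      total, and this stays below the supposed difference. The summand 1 keeps the denominator
      positive when both measures vanish.\<close>
    define e where "e = ?D / (2 * (m + 1))"
    have "e > 0" using pos m by (simp add: e_def)
    then obtain g where g: "g \<in> lin_comb B" "\<And>x. x \<in> K \<Longrightarrow> \<bar>f x - g x\<bar> < e"
      using Stone_Weierstrass_basic[of f e] f continuous_on_subset by (metis subset_UNIV)
    have "\<bar>(\<integral>x. f x \<partial>L) - (\<integral>x. g x \<partial>L)\<bar> \<le> e * measure L (space L)"
      if L: "finite_measure L" "sets L = sets borel" "emeasure L (- K) = 0" for L
    proof (rule abs_integral_diff_le[OF L(1) _ int[OF L f] int[OF L contR[OF g(1)]]])
      show "AE x in L. \<bar>f x - g x\<bar> \<le> e"
        using AEK[OF L(2,3)] by eventually_elim (use g(2) in \<open>auto intro: less_imp_le\<close>)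
    qed
    from this[OF M] this[OF N] have "?D \<le> e * m"
      using eqR[OF g(1)] unfolding m_def by (simp add: algebra_simps)
    also have "\<dots> < e * (2 * (m + 1))" using \<open>e > 0\<close> m by (intro mult_strict_left_mono) auto
    also have "\<dots> = ?D" using m by (simp add: e_def)
    finally show False by simp
  qed
qed


section \<open>Moments of the surface measure\<close>

text \<open>Lebesgue measure is determined by the volumes of boxes. A box of vectors is the product
  of its coordinate boxes, and since the basis consists of the vectors \<open>axis j b\<close>, the
  volume can be grouped by \<open>j\<close>.\<close>

lemma lborel_vec_eq_PiM:
  "(lborel :: ('b::euclidean_space ^ 'd::finite) measure) =
     distr (Pi\<^sub>M UNIV (\<lambda>_. lborel)) borel (\<lambda>f. \<chi> j. f j)"
proof (rule lborel_eqI)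
  interpret product_sigma_finite "\<lambda>_ :: 'd. lborel :: 'b measure" ..
  let ?P = "Pi\<^sub>M (UNIV :: 'd set) (\<lambda>_. lborel :: 'b measure)"
  have meas: "(\<lambda>f. \<chi> j. f j) \<in> measurable ?P (borel :: ('b ^ 'd) measure)"
    by (subst borel_measurable_euclidean_space) (auto simp: Basis_vec_def inner_axis)
  fix l u :: "'b ^ 'd"
  assume le: "\<And>b. b \<in> Basis \<Longrightarrow> l \<bullet> b \<le> u \<bullet> b"
  have le': "l $ j \<bullet> b \<le> u $ j \<bullet> b" if "b \<in> Basis" for j b
    using le[of "axis j b"] that by (simp add: inner_axis)
  have vim: "(\<lambda>f. \<chi> j. f j) -` box l u \<inter> space ?P = (\<Pi>\<^sub>E j\<in>UNIV. box (l $ j) (u $ j))"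
    by (auto simp: mem_box Basis_vec_def inner_axis space_PiM PiE_def Pi_iff)
  have basis: "(\<Prod>b\<in>Basis. (u - l) \<bullet> b) = (\<Prod>j\<in>UNIV. \<Prod>b\<in>Basis. (u $ j - l $ j) \<bullet> b)"
  proof -
    have "Basis = (\<lambda>(j, b). axis j b :: 'b ^ 'd) ` (UNIV \<times> Basis)"
      by (auto simp: Basis_vec_def)
    moreover have "inj_on (\<lambda>(j, b). axis j b :: 'b ^ 'd) (UNIV \<times> Basis)"
      by (auto simp: inj_on_def axis_eq_axis)
    ultimately have "(\<Prod>b\<in>Basis. (u - l) \<bullet> b) = (\<Prod>p\<in>UNIV \<times> Basis. (u - l) \<bullet> (case p of (j, b) \<Rightarrow> axis j b))"
      by (metis (mono_tags, lifting) prod.cong prod.reindex_cong)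
    then show ?thesis
      by (simp add: prod.cartesian_product case_prod_beta inner_axis)
  qed
  show "emeasure (distr ?P borel (\<lambda>f. \<chi> j. f j)) (box l u) = (\<Prod>b\<in>Basis. (u - l) \<bullet> b)"
    unfolding basis using le'
    by (simp add: emeasure_distr[OF meas] vim emeasure_PiM emeasure_lborel_box_eq
        prod_ennreal[symmetric] prod_nonneg inner_diff_left)
qed simp

text \<open>Tonelli, with coordinate spaces of arbitrary dimension: for \<open>complex\<close> each
  factor is a planar integral, where the Gaussian is radial.\<close>

lemma nn_integral_lborel_vec_prod:
  fixes f :: "'d::finite \<Rightarrow> 'b::euclidean_space \<Rightarrow> ennreal"
  assumes [measurable]: "\<And>j. f j \<in> borel_measurable borel"
  shows "(\<integral>\<^sup>+z. (\<Prod>j\<in>UNIV. f j (z $ j)) \<partial>lborel) = (\<Prod>j\<in>UNIV. \<integral>\<^sup>+x. f j x \<partial>lborel)"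
proof -
  interpret product_sigma_finite "\<lambda>_ :: 'd. lborel :: 'b measure" ..
  let ?P = "Pi\<^sub>M (UNIV :: 'd set) (\<lambda>_. lborel :: 'b measure)"
  have meas: "(\<lambda>f. \<chi> j. f j) \<in> measurable ?P (borel :: ('b ^ 'd) measure)"
    by (subst borel_measurable_euclidean_space) (auto simp: Basis_vec_def inner_axis)
  have nth: "(\<lambda>z :: 'b ^ 'd. z $ j) \<in> borel_measurable borel" for j
    by (intro borel_measurable_continuous_onI continuous_intros)
  have [measurable]: "(\<lambda>z. \<Prod>j\<in>UNIV. f j (z $ j)) \<in> borel_measurable (borel :: ('b ^ 'd) measure)"
    by (intro borel_measurable_prod_ennreal measurable_compose[OF nth]) simp
  have "(\<integral>\<^sup>+z. (\<Prod>j\<in>UNIV. f j (z $ j)) \<partial>lborel) = (\<integral>\<^sup>+x. (\<Prod>j\<in>UNIV. f j (x j)) \<partial>?P)"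
    by (subst lborel_vec_eq_PiM, subst nn_integral_distr[OF meas]) simp_all
  also have "\<dots> = (\<Prod>j\<in>UNIV. \<integral>\<^sup>+x. f j x \<partial>lborel)"
    by (intro product_nn_integral_prod) simp_all
  finally show ?thesis .
qed

text \<open>Both sides are integrals of \<open>g\<close>; the measures on the line agree on every \<open>{..<t}\<close>
  by the scaling \<open>x \<mapsto> t x\<close>.\<close>

lemma nn_integral_radial:
  fixes h :: "'a::euclidean_space \<Rightarrow> ennreal" and g :: "real \<Rightarrow> ennreal"
  assumes h[measurable]: "h \<in> borel_measurable borel" and g[measurable]: "g \<in> borel_measurable borel"
    and hom: "\<And>r x. r > 0 \<Longrightarrow> h (r *\<^sub>R x) = h x"
    and fin: "(\<integral>\<^sup>+x\<in>ball 0 1. h x \<partial>lborel) < \<infinity>"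
  shows "(\<integral>\<^sup>+x. h x * g (norm x) \<partial>lborel) =
    (\<integral>\<^sup>+x\<in>ball 0 1. h x \<partial>lborel) *
    (\<integral>\<^sup>+r. g r * ennreal (DIM('a) * r ^ (DIM('a) - 1)) * indicator {0..} r \<partial>lborel)"
proof -
  let ?D = "DIM('a)"
  define I where "I = (\<integral>\<^sup>+x\<in>ball 0 1. h x \<partial>lborel)"
  define M1 where "M1 = distr (density lborel h) borel norm"
  define M2 where "M2 = density lborel (\<lambda>r. I * (ennreal (?D * r ^ (?D - 1)) * indicator {0..} r))"
  \<comment> \<open>Substitution x -> t x: homogeneity of degree 0 leaves \<open>h\<close>
    unchanged, and only the Jacobian t^D remains.\<close>
  have ball: "(\<integral>\<^sup>+x\<in>ball 0 t. h x \<partial>lborel) = ennreal (t ^ ?D) * I" if t: "t > 0" for t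
  proof -
    have hI: "(\<lambda>x. h x * indicator (ball 0 t) x) \<in> borel_measurable borel"
      by (intro borel_measurable_times_ennreal h borel_measurable_indicator) simp
    have "(\<integral>\<^sup>+x\<in>ball 0 t. h x \<partial>lborel) =
       (\<integral>\<^sup>+x. h x * indicator (ball 0 t) x \<partial>density (distr lborel borel (\<lambda>x. 0 + t *\<^sub>R x)) (\<lambda>_. \<bar>t\<bar> ^ ?D))"
      using lborel_affine[of t "0 :: 'a"] t by simp
    also have "\<dots> = ennreal (\<bar>t\<bar> ^ ?D) * (\<integral>\<^sup>+x. h (t *\<^sub>R x) * indicator (ball 0 t) (t *\<^sub>R x) \<partial>lborel)"
      by (subst nn_integral_density, simp_all add: hI) (subst nn_integral_cmult, simp_all add: hI nn_integral_distr)
    also have "(\<lambda>x :: 'a. h (t *\<^sub>R x) * indicator (ball 0 t) (t *\<^sub>R x)) = (\<lambda>x. h x * indicator (ball 0 1) x)"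
      using t by (auto simp: hom indicator_def fun_eq_iff)
    finally show ?thesis using t by (simp add: I_def)
  qed
  have e1: "emeasure M1 {..<t} = (if t > 0 then ennreal (t ^ ?D) * I else 0)" for t
  proof -
    have "norm -` {..<t} = ball (0 :: 'a) t" by auto
    then have "emeasure M1 {..<t} = (\<integral>\<^sup>+x\<in>ball 0 t. h x \<partial>lborel)"
      by (simp add: M1_def emeasure_distr emeasure_density)
    then show ?thesis using ball[of t] by (simp add: ball_empty)
  qed
  have e2: "emeasure M2 {..<t} = (if t > 0 then ennreal (t ^ ?D) * I else 0)" for t
  proof (cases "t > 0")
    case True
    have "emeasure M2 {..<t} = (\<integral>\<^sup>+r. I * (ennreal (?D * r ^ (?D - 1)) * indicator {0..} r) * indicator {..<t} r \<partial>lborel)"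
      by (simp add: M2_def emeasure_density)
    \<comment> \<open>Adding the endpoint t changes a null set only and gives a closed interval, on
      which the fundamental theorem applies with primitive r^D.\<close>
    also have "\<dots> = (\<integral>\<^sup>+r. I * (ennreal (?D * r ^ (?D - 1)) * indicator {0..t} r) \<partial>lborel)"
    proof (rule nn_integral_cong_AE)
      show "AE r in lborel. I * (ennreal (?D * r ^ (?D - 1)) * indicator {0..} r) * indicator {..<t} r =
          I * (ennreal (?D * r ^ (?D - 1)) * indicator {0..t} r)"
        using AE_lborel_singleton[of t] by eventually_elim (simp split: split_indicator)
    qed
    also have "\<dots> = I * (\<integral>\<^sup>+r. ennreal (?D * r ^ (?D - 1)) * indicator {0..t} r \<partial>lborel)"
      by (rule nn_integral_cmult) simp
    also have "(\<integral>\<^sup>+r. ennreal (?D * r ^ (?D - 1)) * indicator {0..t} r \<partial>lborel) = ennreal (t ^ ?D - 0 ^ ?D)"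
      using True by (intro nn_integral_FTC_Icc) (auto intro!: derivative_eq_intros)
    finally show ?thesis using True by (simp add: mult.commute zero_power)
  next
    case False
    have "emeasure M2 {..<t} = (\<integral>\<^sup>+r. I * (ennreal (?D * r ^ (?D - 1)) * indicator {0..} r) * indicator {..<t} r \<partial>lborel)"
      by (simp add: M2_def emeasure_density)
    also have "\<dots> = (\<integral>\<^sup>+r. 0 \<partial>(lborel :: real measure))"
      using False by (intro nn_integral_cong) (auto split: split_indicator)
    finally show ?thesis using False by simp
  qed
  have "M1 = M2"
  proof (rule measure_eqI_generator_eq_countable[where E = "range lessThan" and \<Omega> = UNIV and A = "range (\<lambda>n. {..<real n})"])
    show "Int_stable (range lessThan :: real set set)"
    proof -
      have "{..<a} \<inter> {..<b} = {..<min a b}" for a b :: real by auto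
      then show ?thesis by (auto simp: Int_stable_def)
    qed
    show "sets M1 = sigma_sets UNIV (range lessThan)" "sets M2 = sigma_sets UNIV (range lessThan)"
      by (simp_all add: M1_def M2_def borel_Iio)
    show "\<Union> (range (\<lambda>n. {..<real n})) = UNIV"
      using reals_Archimedean2 by auto
    show "emeasure M1 a \<noteq> \<infinity>" if "a \<in> range (\<lambda>n. {..<real n})" for a
      using that fin[folded I_def] by (auto simp: e1 ennreal_mult_eq_top_iff split: if_splits)
  qed (auto simp: e1 e2)
  have "(\<integral>\<^sup>+x. h x * g (norm x) \<partial>lborel) = (\<integral>\<^sup>+r. g r \<partial>M1)"
    by (simp add: M1_def nn_integral_distr nn_integral_density)
  also have "\<dots> = (\<integral>\<^sup>+r. g r \<partial>M2)" by (simp add: \<open>M1 = M2\<close>)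
  also have "\<dots> = (\<integral>\<^sup>+r. I * (g r * ennreal (?D * r ^ (?D - 1)) * indicator {0..} r) \<partial>lborel)"
    unfolding M2_def by (subst nn_integral_density) (auto simp: mult_ac)
  also have "\<dots> = I * (\<integral>\<^sup>+r. g r * ennreal (?D * r ^ (?D - 1)) * indicator {0..} r \<partial>lborel)"
    by (rule nn_integral_cmult) simp
  finally show ?thesis by (simp add: I_def)
qed

text \<open>In dimension 2(d+1) the radial density is 2(d+1) r^(2d+1), and the Gaussian moment of
  the odd order 2(m+d)+1 over the half-line is (m+d)!/2. Their product is the constant on the
  right.\<close>

lemma nn_integral_radial_gaussian:
  fixes h :: "'a::euclidean_space \<Rightarrow> ennreal"
  assumes h: "h \<in> borel_measurable borel" "\<And>r x. r > 0 \<Longrightarrow> h (r *\<^sub>R x) = h x"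
    "(\<integral>\<^sup>+x\<in>ball 0 1. h x \<partial>lborel) < \<infinity>"
    and D: "DIM('a) = 2 * Suc d"
  shows "(\<integral>\<^sup>+x. h x * ennreal (norm x ^ (2 * m) * exp (- (norm x)\<^sup>2)) \<partial>lborel) =
    (\<integral>\<^sup>+x\<in>ball 0 1. h x \<partial>lborel) * ennreal (Suc d * fact (m + d))"
proof -
  have hb: "has_bochner_integral lborel
      (\<lambda>x. real (2 * Suc d) * (indicator {0..} x *\<^sub>R (exp (- x\<^sup>2) * x ^ (2 * (m + d) + 1))))
      (real (2 * Suc d) * (fact (m + d) / 2))"
    by (intro has_bochner_integral_mult_right gaussian_moment_odd_pos)
  have "(\<integral>\<^sup>+r. ennreal (r ^ (2 * m) * exp (- r\<^sup>2)) * ennreal (DIM('a) * r ^ (DIM('a) - 1)) * indicator {0..} r \<partial>lborel)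
    = (\<integral>\<^sup>+r. ennreal (real (2 * Suc d) * (indicator {0..} r *\<^sub>R (exp (- r\<^sup>2) * r ^ (2 * (m + d) + 1)))) \<partial>lborel)"
    by (intro nn_integral_cong)
      (auto simp: D ennreal_mult'[symmetric] power_add algebra_simps split: split_indicator)
  also have "\<dots> = ennreal (real (2 * Suc d) * (fact (m + d) / 2))"
    using hb by (subst nn_integral_eq_integral)
      (auto simp: has_bochner_integral_iff split: split_indicator)
  finally show ?thesis
    by (subst nn_integral_radial[OF h(1) _ h(2,3)]) (simp_all add: algebra_simps)
qed

text \<open>The radial formula in the plane, with \<open>h = 1\<close>; the factor pi is the area of
  the unit disc.\<close>

lemma nn_integral_complex_gaussian:
  "(\<integral>\<^sup>+w. ennreal (cmod w ^ (2 * k) * exp (- (cmod w)\<^sup>2)) \<partial>lborel) = ennreal (pi * fact k)"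
proof -
  have "(\<integral>\<^sup>+x\<in>ball 0 1. (1 :: ennreal) \<partial>(lborel :: complex measure)) = ennreal pi"
    using unit_ball_vol_even[of 1] by (simp add: emeasure_ball)
  then show ?thesis
    using nn_integral_radial_gaussian[of "\<lambda>_ :: complex. 1" 0 k]
    by (simp add: ennreal_mult')
qed

section \<open>Monomials and their mean squares on the sphere\<close>

lemma mmonom_scaleR: "mmonom (r *\<^sub>R z) \<beta> = of_real (r ^ msize \<beta>) * mmonom z \<beta>"
proof -
  have "(r *\<^sub>R z) $ j = of_real r * z $ j" for j
    by (simp add: scaleR_conv_of_real[where 'a = complex])
  then show ?thesis
    by (simp add: mmonom_def msize_def power_mult_distrib prod.distrib power_sum)
qed

lemma borel_measurable_mmonom[measurable]: "(\<lambda>z. mmonom z \<beta>) \<in> borel_measurable borel"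
  unfolding mmonom_def by (intro borel_measurable_continuous_onI continuous_intros)

lemma cmod_mmonom_le: 
  assumes "norm z \<le> 1" shows "cmod (mmonom z \<beta>) \<le> 1"
proof -
  have "cmod (z $ j) \<le> 1" for j
    using assms Finite_Cartesian_Product.norm_nth_le[of z j] by simp
  then show ?thesis
    unfolding mmonom_def prod_norm[symmetric] norm_power by (intro prod_le_1 conjI power_le_one) simp_all
qed

text \<open>The cone construction of \<open>sphere_measure\<close> turns the left side into a
  quotient of two integrals over the unit ball, for the exponents \<open>\<beta>\<close> and 0. Each
  is known from a Gaussian integral, and the powers of pi and the factor \<open>Suc d\<close> cancel
  in the quotient.\<close>

lemma integral_sphere_mmonom:
  fixes \<beta> :: "'d::finite \<Rightarrow> nat"
  shows "(\<integral>z. (cmod (mmonom z \<beta>))\<^sup>2 \<partial>sphere_measure) =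
    (\<Prod>j\<in>UNIV. fact (\<beta> j)) * fact (CARD('d) - 1) / fact (msize \<beta> + (CARD('d) - 1))"
proof -
  define d where "d = CARD('d) - 1"
  have card: "CARD('d) = Suc d" by (simp add: d_def)
  then have D: "DIM(complex ^ 'd) = 2 * Suc d" by simp
  \<comment> \<open>The extension of |z^\<gamma>|^2 from the sphere to a function homogeneous of
    degree 0, as the polar formula requires. At the origin the argument of the monomial is
    0.\<close>
  define h where "h \<gamma> z = ennreal ((cmod (mmonom (z /\<^sub>R norm z) \<gamma>))\<^sup>2)" for \<gamma> and z :: "complex ^ 'd"
  define I where "I \<gamma> = (\<integral>\<^sup>+z\<in>ball 0 1. h \<gamma> z \<partial>lborel)" for \<gamma>
  have meas: "h \<gamma> \<in> borel_measurable borel" for \<gamma>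
    unfolding h_def by measurable
  have hle: "h \<gamma> z \<le> 1" for \<gamma> z
    by (cases "z = 0") (simp_all add: h_def cmod_mmonom_le power_le_one)
  have fin: "I \<gamma> < \<infinity>" for \<gamma>
  proof -
    have "I \<gamma> \<le> (\<integral>\<^sup>+z. indicator (ball 0 1) z \<partial>(lborel :: (complex ^ 'd) measure))"
      unfolding I_def by (intro nn_integral_mono) (auto simp: hle split: split_indicator)
    also have "\<dots> < \<infinity>" by (simp add: emeasure_ball)
    finally show ?thesis .
  qed
  have hom: "h \<gamma> (r *\<^sub>R z) = h \<gamma> z" if "r > 0" for r z \<gamma>
    using that by (cases "z = 0") (simp_all add: h_def field_simps)
  have mono: "ennreal ((cmod (mmonom z \<gamma>))\<^sup>2) = h \<gamma> z * ennreal (norm z ^ (2 * msize \<gamma>))" for z \<gamma>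
  proof -
    have "norm z *\<^sub>R (z /\<^sub>R norm z) = z" by (cases "z = 0") simp_all
    then have "mmonom z \<gamma> = of_real (norm z ^ msize \<gamma>) * mmonom (z /\<^sub>R norm z) \<gamma>"
      by (metis mmonom_scaleR)
    then have "(cmod (mmonom z \<gamma>))\<^sup>2 = (cmod (mmonom (z /\<^sub>R norm z) \<gamma>))\<^sup>2 * norm z ^ (2 * msize \<gamma>)"
      by (simp add: norm_mult norm_power power_mult_distrib power_even_eq mult.commute flip: power_mult)
    then show ?thesis
      by (simp add: h_def ennreal_mult')
  qed
  \<comment> \<open>The Gaussian integral of \<open>\<bar>z\<^sup>\<gamma>\<bar>\<^sup>2\<close>, once in polar coordinates and once as a product over the coordinates.\<close>
  have key: "I \<gamma> * ennreal (Suc d * fact (msize \<gamma> + d)) = ennreal (pi ^ Suc d * (\<Prod>j\<in>UNIV. fact (\<gamma> j)))" for \<gamma>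
  proof -
    have "I \<gamma> * ennreal (Suc d * fact (msize \<gamma> + d)) =
      (\<integral>\<^sup>+z. h \<gamma> z * ennreal (norm z ^ (2 * msize \<gamma>) * exp (- (norm z)\<^sup>2)) \<partial>lborel)"
      unfolding I_def
      by (rule nn_integral_radial_gaussian[symmetric]) (use meas hom fin D in \<open>auto simp: I_def\<close>)
    also have "\<dots> = (\<integral>\<^sup>+z. (\<Prod>j\<in>UNIV. ennreal (cmod (z $ j) ^ (2 * \<gamma> j) * exp (- (cmod (z $ j))\<^sup>2))) \<partial>lborel)"
    proof (intro nn_integral_cong)
      fix z :: "complex ^ 'd"
      have "exp (- (norm z)\<^sup>2) = (\<Prod>j\<in>UNIV. exp (- (cmod (z $ j))\<^sup>2))"
        by (simp add: norm_vec_def L2_set_def sum_nonneg exp_sum[symmetric] sum_negf)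
      moreover have "(cmod (mmonom z \<gamma>))\<^sup>2 = (\<Prod>j\<in>UNIV. cmod (z $ j) ^ (2 * \<gamma> j))"
        by (simp add: mmonom_def prod_norm[symmetric] norm_power prod_power_distrib[symmetric] power_even_eq)
      ultimately have "(\<Prod>j\<in>UNIV. ennreal (cmod (z $ j) ^ (2 * \<gamma> j) * exp (- (cmod (z $ j))\<^sup>2))) =
          ennreal ((cmod (mmonom z \<gamma>))\<^sup>2) * ennreal (exp (- (norm z)\<^sup>2))"
        by (simp add: prod_ennreal prod.distrib ennreal_mult')
      then show "h \<gamma> z * ennreal (norm z ^ (2 * msize \<gamma>) * exp (- (norm z)\<^sup>2)) =
        (\<Prod>j\<in>UNIV. ennreal (cmod (z $ j) ^ (2 * \<gamma> j) * exp (- (cmod (z $ j))\<^sup>2)))"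
        by (simp add: mono ennreal_mult' mult.assoc)
    qed
    also have "\<dots> = (\<Prod>j\<in>UNIV. ennreal (pi * fact (\<gamma> j)))"
      by (subst nn_integral_lborel_vec_prod) (simp_all only: nn_integral_complex_gaussian, measurable)
    also have "\<dots> = ennreal (pi ^ Suc d * (\<Prod>j\<in>UNIV. fact (\<gamma> j)))"
      by (simp add: prod_ennreal prod.distrib card)
    finally show ?thesis .
  qed
  define P where "P \<gamma> = (\<Prod>j\<in>UNIV. fact (\<gamma> j) :: real)" for \<gamma> :: "'d \<Rightarrow> nat"
  define J where "J \<gamma> = enn2real (I \<gamma>)" for \<gamma>
  have IJ: "I \<gamma> = ennreal (J \<gamma>)" for \<gamma>
    using fin[of \<gamma>] by (simp add: J_def)
  have J0: "J \<gamma> \<ge> 0" for \<gamma> by (simp add: J_def)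
  have Jeq: "J \<gamma> * (Suc d * fact (msize \<gamma> + d)) = pi ^ Suc d * P \<gamma>" for \<gamma>
  proof -
    have "ennreal (J \<gamma> * (Suc d * fact (msize \<gamma> + d))) = ennreal (pi ^ Suc d * P \<gamma>)"
      using key[of \<gamma>] J0[of \<gamma>] by (simp only: IJ P_def ennreal_mult')
    then show ?thesis using J0[of \<gamma>] by (subst (asm) ennreal_inj) (auto simp: P_def intro!: prod_nonneg mult_nonneg_nonneg)
  qed
  \<comment> \<open>For exponent 0 the monomial is 1 everywhere, also at the origin, so the integral
    is the volume that normalises \<open>sphere_measure\<close>.\<close>
  have vol: "emeasure lborel (ball (0 :: complex ^ 'd) 1) = I (\<lambda>_. 0)"
    by (simp add: I_def h_def mmonom_def)
  have "(\<integral>\<^sup>+z. ennreal ((cmod (mmonom z \<beta>))\<^sup>2) \<partial>sphere_measure) =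
      (\<integral>\<^sup>+z. h \<beta> z \<partial>uniform_measure lborel (ball 0 1))"
    unfolding sphere_measure_def h_def by (subst nn_integral_distr) auto
  also have "\<dots> = I \<beta> / I (\<lambda>_. 0)"
    by (subst nn_integral_uniform_measure) (use meas in \<open>simp_all add: vol I_def\<close>)
  also have "\<dots> = ennreal (P \<beta> * fact d / fact (msize \<beta> + d))"
  proof -
    have z: "J (\<lambda>_. 0) * (Suc d * fact d) = pi ^ Suc d"
      using Jeq[of "\<lambda>_. 0"] by (simp add: P_def msize_def)
    then have "J (\<lambda>_. 0) \<noteq> 0" by auto
    then have pos: "J (\<lambda>_. 0) > 0" using J0[of "\<lambda>_. 0"] by simp
    have "J \<beta> * (Suc d * fact (msize \<beta> + d)) = J (\<lambda>_. 0) * (Suc d * fact d) * P \<beta>"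
      using Jeq[of \<beta>] z by simp
    then have "real (Suc d) * (J \<beta> * fact (msize \<beta> + d)) = real (Suc d) * (J (\<lambda>_. 0) * fact d * P \<beta>)"
      by (simp only: mult_ac of_nat_mult of_nat_fact)
    then have "J \<beta> * fact (msize \<beta> + d) = J (\<lambda>_. 0) * fact d * P \<beta>"
      by (subst (asm) mult_left_cancel) simp_all
    then have "J \<beta> / J (\<lambda>_. 0) = P \<beta> * fact d / fact (msize \<beta> + d)"
      using pos by (simp add: field_simps)
    then show ?thesis using pos J0 by (simp add: IJ divide_ennreal)
  qed
  finally have nn: "(\<integral>\<^sup>+z. ennreal ((cmod (mmonom z \<beta>))\<^sup>2) \<partial>sphere_measure) = ennreal (P \<beta> * fact d / fact (msize \<beta> + d))" .
  have "(\<integral>z. (cmod (mmonom z \<beta>))\<^sup>2 \<partial>sphere_measure) =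
      enn2real (\<integral>\<^sup>+z. ennreal ((cmod (mmonom z \<beta>))\<^sup>2) \<partial>sphere_measure)"
    by (rule integral_eq_nn_integral) (simp_all add: sphere_measure_def)
  also have "\<dots> = P \<beta> * fact d / fact (msize \<beta> + d)"
    unfolding nn by (rule enn2real_ennreal) (simp add: P_def prod_nonneg)
  finally show ?thesis by (simp add: P_def d_def)
qed


section \<open>The norm of powers of the multishift\<close>

lemma msize_upd_Suc: "msize (\<beta>(j := Suc (\<beta> j))) = Suc (msize \<beta>)"
  unfolding msize_def by (subst (1 2) sum.remove[of UNIV j]) simp_all

lemma moment_seq_pos: "(\<And>n. c n > 0) \<Longrightarrow> moment_seq c n > 0"
  by (simp add: moment_seq_def prod_pos)

lemma moment_seq_Suc: "moment_seq c (Suc n) = c n * moment_seq c n"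
  by (simp add: moment_seq_def)

text \<open>For \<open>\<beta>\<close> the depth of v, this is the squared norm of
  \<open>S\<^sub>j e\<^sub>v\<close>: the cardinality in each squared weight cancels against the
  number of children.\<close>

definition shift_factor :: "(nat \<Rightarrow> real) \<Rightarrow> 'd::finite \<Rightarrow> ('d \<Rightarrow> nat) \<Rightarrow> real" where
  "shift_factor c j \<beta> = c (msize \<beta>) * ((real (\<beta> j) + 1) / (real (msize \<beta>) + real CARD('d)))"

text \<open>Q of the overview, with the sphere integral in closed form. It is also the squared norm
  of S^beta applied to the basis vector of the root; its value at exponent 0 is 1.\<close>

definition shift_moment :: "(nat \<Rightarrow> real) \<Rightarrow> ('d::finite \<Rightarrow> nat) \<Rightarrow> real" where
  "shift_moment c \<beta> = moment_seq c (msize \<beta>) *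
     ((\<Prod>j\<in>UNIV. fact (\<beta> j)) * fact (CARD('d) - 1) / fact (msize \<beta> + (CARD('d) - 1)))"

lemma shift_moment_pos: "(\<And>n. c n > 0) \<Longrightarrow> shift_moment c \<beta> > 0"
  by (simp add: shift_moment_def moment_seq_pos prod_pos)

text \<open>Thus the factors along a lattice path from beta to beta + alpha telescope to Q(beta +
  alpha) / Q(beta), whatever the order of the steps.\<close>

lemma shift_moment_upd_Suc:
  "shift_moment c (\<beta>(j := Suc (\<beta> j))) = shift_factor c j \<beta> * shift_moment c \<beta>"
  for \<beta> :: "'d::finite \<Rightarrow> nat"
proof -
  obtain d where d: "CARD('d) = Suc d"
    using zero_less_card_finite by (metis gr0_implies_Suc)
  have "(\<Prod>i\<in>UNIV. fact ((\<beta>(j := Suc (\<beta> j))) i) :: real) = (real (\<beta> j) + 1) * (\<Prod>i\<in>UNIV. fact (\<beta> i))"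
    by (subst (1 2) prod.remove[of UNIV j]) (simp_all add: algebra_simps)
  then show ?thesis
    unfolding shift_moment_def shift_factor_def msize_upd_Suc moment_seq_Suc d
    by (simp add: algebra_simps)
qed

text \<open>The numbers \<open>\<beta> j + 1\<close> add up to the common denominator |beta| + d.
  This is what later leaves a bare value of \<open>c\<close> in the recursion for the moments of
  \<open>\<rho> u\<close>.\<close>

lemma sum_shift_factor: "(\<Sum>j\<in>UNIV. shift_factor c j \<beta>) = c (msize \<beta>)"
  for \<beta> :: "'d::finite \<Rightarrow> nat"
proof -
  have "(\<Sum>j\<in>UNIV. shift_factor c j \<beta>) = c (msize \<beta>) * ((\<Sum>j\<in>UNIV. real (\<beta> j) + 1) / (real (msize \<beta>) + real CARD('d)))"
    by (simp add: shift_factor_def sum_distrib_left sum_divide_distrib)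
  also have "(\<Sum>j\<in>UNIV. real (\<beta> j) + 1) = real (msize \<beta>) + real CARD('d)"
    by (simp add: sum.distrib msize_def)
  also have "real (msize \<beta>) + real CARD('d) \<noteq> 0"
    by (simp add: add_nonneg_eq_0_iff)
  then have "c (msize \<beta>) * ((real (msize \<beta>) + real CARD('d)) / (real (msize \<beta>) + real CARD('d))) = c (msize \<beta>)"
    by simp
  finally show ?thesis .
qed

lemma shift_factor_le:
  fixes \<beta> :: "'d::finite \<Rightarrow> nat"
  assumes "c (msize \<beta>) \<le> b" "c (msize \<beta>) \<ge> 0"
  shows "shift_factor c j \<beta> \<le> b"
proof -
  have "\<beta> j \<le> msize \<beta>" unfolding msize_def by (intro member_le_sum) auto
  then have "real (\<beta> j) + 1 \<le> real (msize \<beta>) + real CARD('d)"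
    using zero_less_card_finite[where 'a = 'd] by linarith
  then have "(real (\<beta> j) + 1) / (real (msize \<beta>) + real CARD('d)) \<le> 1"
    by (intro divide_le_eq_1[THEN iffD2]) auto
  then have "shift_factor c j \<beta> \<le> c (msize \<beta>) * 1"
    unfolding shift_factor_def using assms by (intro mult_left_mono) auto
  then show ?thesis using assms by simp
qed

lemma shift_factor_pos:
  assumes "c (msize \<beta>) > 0" shows "shift_factor c j \<beta> > 0"
proof -
  have "real (msize \<beta>) + real CARD('d) > 0" for \<beta> :: "'d::finite \<Rightarrow> nat"
    by (simp add: add_nonneg_pos)
  then show ?thesis using assms unfolding shift_factor_def by (intro mult_pos_pos divide_pos_pos) simp_all
qed

lemma finite_depth_le:
  assumes T: "rooted_directed_tree G" and fin: "locally_finite G"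
  shows "finite {x \<in> pverts G. depth G x \<le> n}"
proof (induction n)
  case 0
  have "{x \<in> pverts G. depth G x \<le> 0} \<subseteq> {root G}"
    using par_arc[OF T] depth_chi[OF T] by (force simp: chi_def)
  then show ?case by (rule finite_subset) simp
next
  case (Suc n)
  have "{x \<in> pverts G. depth G x \<le> Suc n} \<subseteq> insert (root G) (\<Union>y\<in>{x \<in> pverts G. depth G x \<le> n}. chi G y)"
  proof
    fix x assume x: "x \<in> {x \<in> pverts G. depth G x \<le> Suc n}"
    show "x \<in> insert (root G) (\<Union>y\<in>{x \<in> pverts G. depth G x \<le> n}. chi G y)"
    proof (cases "x = root G")
      case False
      then have ch: "x \<in> chi G (par G x)" using par_arc[OF T] x by (auto simp: chi_def)
      then have "par G x \<in> pverts G" "depth G (par G x) \<le> n"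
        using chi_par(3)[OF T ch] depth_chi[OF T ch] x by auto
      then show ?thesis using ch by auto
    qed simp
  qed
  then show ?case
    by (rule finite_subset) (use Suc fin in \<open>auto simp: locally_finite_def\<close>)
qed

section \<open>Finitely supported functions and adjoints in \<open>l2\<close>\<close>

lemma l2_inner_basis_vec:
  assumes "v \<in> V" shows "l2_inner V (basis_vec v) h = cnj (h v)"
proof -
  have "l2_inner V (basis_vec v) h = (\<Sum>\<^sub>\<infinity>u\<in>{v}. cnj (h u))"
    unfolding l2_inner_def using assms by (intro infsum_cong_neutral) (auto simp: basis_vec_def)
  then show ?thesis by simp
qed

lemma l2_finite_support:
  assumes "finite A" "A \<subseteq> V" "\<And>v. v \<notin> A \<Longrightarrow> f v = 0" shows "f \<in> l2 V"
proof -
  have "(\<lambda>v. (cmod (f v))\<^sup>2) summable_on V \<longleftrightarrow> (\<lambda>v. (cmod (f v))\<^sup>2) summable_on A"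
    using assms by (intro summable_on_cong_neutral) auto
  then show ?thesis using assms by (auto simp: l2_def)
qed

lemma basis_vec_in_l2: "v \<in> V \<Longrightarrow> basis_vec v \<in> l2 V"
  by (rule l2_finite_support[of "{v}"]) (auto simp: basis_vec_def)

text \<open>Inner products with basis vectors recover every coordinate, so the definite description
  in \<open>l2_adjoint\<close> has at most one solution; exhibiting one evaluates it.\<close>

lemma l2_adjoint_eqI:
  assumes "h \<in> l2 V" "\<And>g. g \<in> l2 V \<Longrightarrow> l2_inner V (S g) f = l2_inner V g h"
  shows "l2_adjoint V S f = h"
  unfolding l2_adjoint_def
proof (rule the_equality)
  fix h' assume h': "h' \<in> l2 V \<and> (\<forall>g\<in>l2 V. l2_inner V (S g) f = l2_inner V g h')"
  show "h' = h"
  proof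
    fix v
    show "h' v = h v"
    proof (cases "v \<in> V")
      case True
      then have "l2_inner V (basis_vec v) h' = l2_inner V (basis_vec v) h"
        using h' assms basis_vec_in_l2 by metis
      then show ?thesis using True by (simp add: l2_inner_basis_vec)
    next
      case False
      then show ?thesis using h' assms(1) by (simp add: l2_def)
    qed
  qed
qed (use assms in auto)

section \<open>Sums over children in a product of trees\<close>

locale product_tree =
  fixes T :: "'d::finite \<Rightarrow> 'a pair_pre_digraph"
  assumes tree: "\<And>j. rooted_directed_tree (T j)"
    and leafless: "\<And>j. leafless (T j)"
    and locally_finite: "\<And>j. locally_finite (T j)"
begin

abbreviation "V \<equiv> prod_verts T"

lemma V_iff: "v \<in> V \<longleftrightarrow> (\<forall>j. v j \<in> pverts (T j))"
  by (simp add: dcprod_def)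

lemma prod_chi_iff:
  assumes "v \<in> V"
  shows "w \<in> prod_chi T j v \<longleftrightarrow> w \<in> V \<and> w j \<noteq> root (T j) \<and> prod_par T j w = v"
proof
  assume w: "w \<in> prod_chi T j v"
  then show "w \<in> V \<and> w j \<noteq> root (T j) \<and> prod_par T j w = v"
    using chi_par[OF tree, of "w j" j "v j"] by (auto simp: prod_chi_def prod_par_def fun_eq_iff)
next
  assume "w \<in> V \<and> w j \<noteq> root (T j) \<and> prod_par T j w = v"
  then show "w \<in> prod_chi T j v"
    using par_arc[OF tree, of "w j" j] by (auto simp: prod_chi_def prod_par_def chi_def V_iff)
qed

lemma prod_par_in_V:
  assumes "w \<in> V" "w j \<noteq> root (T j)" shows "prod_par T j w \<in> V"
  using assms par_arc[OF tree, of "w j" j] chi_par(3)[OF tree, of "w j" j "par (T j) (w j)"]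
  by (auto simp: V_iff prod_par_def chi_def)

lemma finite_prod_chi: "v \<in> V \<Longrightarrow> finite (prod_chi T j v)"
  using multishift_basis_vec(1)[OF tree locally_finite] .

lemma prod_chi_nonempty: assumes "v \<in> V" shows "prod_chi T j v \<noteq> {}"
proof -
  obtain x where x: "x \<in> chi (T j) (v j)"
    using leafless[of j] assms by (auto simp: leafless_def V_iff)
  then have "v(j := x) \<in> prod_chi T j v"
    using chi_par(4)[OF tree x] assms by (auto simp: prod_chi_def V_iff)
  then show ?thesis by auto
qed

lemma prod_depth_chi:
  assumes "w \<in> prod_chi T j v"
  shows "prod_depth T w = (prod_depth T v)(j := Suc (prod_depth T v j))"
  using assms depth_chi[OF tree, of "w j" j "v j"] by (auto simp: prod_chi_def prod_depth_def fun_eq_iff)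

lemma weight_chi:
  assumes "v \<in> V" "w \<in> prod_chi T j v"
  shows "weight T c j w = sqrt (shift_factor c j (prod_depth T v) / card (prod_chi T j v))"
proof -
  have "prod_par T j w = v" using assms prod_chi_iff by blast
  then show ?thesis
    by (simp add: weight_def shift_factor_def Let_def real_sqrt_mult real_sqrt_divide)
qed

lemma weight_pos:
  assumes "v \<in> V" "w \<in> prod_chi T j v" "\<And>n. c n > 0"
  shows "weight T c j w > 0"
proof -
  have "card (prod_chi T j v) > 0"
    using finite_prod_chi assms card_gt_0_iff by blast
  then show ?thesis
    using shift_factor_pos[of c "prod_depth T v" j] assms(3) by (simp add: weight_chi[OF assms(1,2)])
qed

lemma sum_weight_sq:
  assumes "v \<in> V" "\<And>n. c n > 0"
  shows "(\<Sum>w\<in>prod_chi T j v. (weight T c j w)\<^sup>2) = shift_factor c j (prod_depth T v)"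
proof -
  have "card (prod_chi T j v) > 0"
    using finite_prod_chi prod_chi_nonempty assms card_gt_0_iff by blast
  moreover have "shift_factor c j (prod_depth T v) \<ge> 0"
    using shift_factor_pos[of c "prod_depth T v" j] assms(2) by (simp add: less_imp_le)
  ultimately show ?thesis using assms(1) by (simp add: weight_chi)
qed

definition nonroot :: "'d \<Rightarrow> ('d \<Rightarrow> 'a) set" where
  "nonroot j = {w \<in> V. w j \<noteq> root (T j)}"

text \<open>Every vertex whose j-th coordinate is not a root has exactly one parent in direction j,
  so these vertices are fibred over V with fibres \<open>prod_chi T j v\<close>. Sums involving
  \<open>S\<^sub>j\<close> and its adjoint are rearranged along this fibration.\<close>

lemma bij_betw_chi: "bij_betw snd (Sigma V (prod_chi T j)) (nonroot j)"
proof (rule bij_betwI[where g = "\<lambda>w. (prod_par T j w, w)"])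
qed (auto simp: prod_chi_iff nonroot_def prod_par_in_V)

text \<open>All children of v in direction j have the same depth, so g is constant on each fibre,
  and the squared weights there add up to the shift factor. Keeping g arbitrary allows
  iteration.\<close>

lemma multishift_sum:
  assumes c: "\<And>n. c n > 0" and g: "\<And>\<beta>. g \<beta> \<ge> 0"
    and sum: "((\<lambda>v. (cmod (f v))\<^sup>2 * (shift_factor c j (prod_depth T v) *
        g ((prod_depth T v)(j := Suc (prod_depth T v j))))) has_sum s) V"
  shows "((\<lambda>w. (cmod (multishift T c j f w))\<^sup>2 * g (prod_depth T w)) has_sum s) V"
proof -
  let ?F = "\<lambda>w. (weight T c j w)\<^sup>2 * (cmod (f (prod_par T j w)))\<^sup>2 * g (prod_depth T w)"
  have inner: "((\<lambda>w. ?F w) has_sum ((cmod (f v))\<^sup>2 * (shift_factor c j (prod_depth T v) *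
        g ((prod_depth T v)(j := Suc (prod_depth T v j)))))) (prod_chi T j v)" if v: "v \<in> V" for v
  proof -
    have "(\<Sum>w\<in>prod_chi T j v. ?F w) = (\<Sum>w\<in>prod_chi T j v. (weight T c j w)\<^sup>2 *
        ((cmod (f v))\<^sup>2 * g ((prod_depth T v)(j := Suc (prod_depth T v j)))))"
    proof (intro sum.cong refl)
      fix w assume w: "w \<in> prod_chi T j v"
      then have "prod_par T j w = v" using prod_chi_iff[OF v] by blast
      then show "?F w = (weight T c j w)\<^sup>2 * ((cmod (f v))\<^sup>2 * g ((prod_depth T v)(j := Suc (prod_depth T v j))))"
        by (simp add: prod_depth_chi[OF w])
    qed
    also have "\<dots> = (cmod (f v))\<^sup>2 * (shift_factor c j (prod_depth T v) *
        g ((prod_depth T v)(j := Suc (prod_depth T v j))))"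
      unfolding sum_distrib_right[symmetric] sum_weight_sq[OF v c] by (simp add: mult_ac)
    finally show ?thesis using has_sum_finite[OF finite_prod_chi[OF v], of ?F j] by simp
  qed
  have "((\<lambda>p. ?F (snd p)) has_sum s) (Sigma V (prod_chi T j))"
  proof (rule has_sum_SigmaI)
    show "((\<lambda>w. ?F (snd (v, w))) has_sum ((cmod (f v))\<^sup>2 * (shift_factor c j (prod_depth T v) *
        g ((prod_depth T v)(j := Suc (prod_depth T v j)))))) (prod_chi T j v)" if v: "v \<in> V" for v
      using inner[OF v] by simp
    show "(\<lambda>p. ?F (snd p)) summable_on Sigma V (prod_chi T j)"
      by (rule summable_on_SigmaI) (use inner sum g in \<open>auto simp: summable_on_def\<close>)
  qed (rule sum)
  then have "(?F has_sum s) (nonroot j)"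
    using has_sum_reindex_bij_betw[OF bij_betw_chi, of ?F] by simp
  also have "(?F has_sum s) (nonroot j) \<longleftrightarrow>
      ((\<lambda>w. (cmod (multishift T c j f w))\<^sup>2 * g (prod_depth T w)) has_sum s) V"
    by (rule has_sum_cong_neutral) (auto simp: nonroot_def multishift_def norm_mult power_mult_distrib)
  finally show ?thesis .
qed

text \<open>After division by \<open>shift_moment\<close> the multishift merely translates the depth, which is what
  makes the iteration over all powers trivial.\<close>

lemma multishift_normalized_sum:
  assumes c: "\<And>n. c n > 0" and g: "\<And>\<beta>. g \<beta> \<ge> 0"
    and sum: "((\<lambda>v. (cmod (f v))\<^sup>2 * (g ((prod_depth T v)(j := Suc (prod_depth T v j))) / shift_moment c (prod_depth T v))) has_sum s) V"
  shows "((\<lambda>w. (cmod (multishift T c j f w))\<^sup>2 * (g (prod_depth T w) / shift_moment c (prod_depth T w))) has_sum s) V"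
proof (rule multishift_sum[OF c])
  show "g \<beta> / shift_moment c \<beta> \<ge> 0" for \<beta>
    using g shift_moment_pos[of c \<beta>] c by (simp add: less_imp_le)
  have "shift_factor c j \<beta> \<noteq> 0" for \<beta> :: "'d \<Rightarrow> nat"
    using shift_factor_pos[of c \<beta> j] c by auto
  then show "((\<lambda>v. (cmod (f v))\<^sup>2 * (shift_factor c j (prod_depth T v) *
        (g ((prod_depth T v)(j := Suc (prod_depth T v j))) / shift_moment c ((prod_depth T v)(j := Suc (prod_depth T v j)))))) has_sum s) V"
    using sum by (simp add: shift_moment_upd_Suc)
qed

text \<open>The induction varies g: the outermost \<open>S\<^sub>j\<close> replaces g by its
  translate in direction j, to which the hypothesis for the remaining powers applies.\<close>

lemma multishift_funpow_normalized_sum: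
  assumes c: "\<And>n. c n > 0" and g: "\<And>\<beta>. g \<beta> \<ge> 0"
    and sum: "((\<lambda>v. (cmod (f v))\<^sup>2 * (g ((prod_depth T v)(j := prod_depth T v j + n)) / shift_moment c (prod_depth T v))) has_sum s) V"
  shows "((\<lambda>w. (cmod ((multishift T c j ^^ n) f w))\<^sup>2 * (g (prod_depth T w) / shift_moment c (prod_depth T w))) has_sum s) V"
  using g sum
proof (induction n arbitrary: g)
  case (Suc n)
  have "((\<lambda>w. (cmod ((multishift T c j ^^ n) f w))\<^sup>2 *
      (g ((prod_depth T w)(j := Suc (prod_depth T w j))) / shift_moment c (prod_depth T w))) has_sum s) V"
  proof (rule Suc.IH[where g = "\<lambda>\<beta>. g (\<beta>(j := Suc (\<beta> j)))"])
    have "(\<beta>(j := \<beta> j + n))(j := Suc ((\<beta>(j := \<beta> j + n)) j)) = \<beta>(j := \<beta> j + Suc n)" for \<beta> :: "'d \<Rightarrow> nat"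
      by simp
    then show "((\<lambda>v. (cmod (f v))\<^sup>2 * (g (((prod_depth T v)(j := prod_depth T v j + n))
        (j := Suc (((prod_depth T v)(j := prod_depth T v j + n)) j))) / shift_moment c (prod_depth T v))) has_sum s) V"
      using Suc.prems(2) by (simp only:)
  qed (rule Suc.prems)
  then have "((\<lambda>w. (cmod (multishift T c j ((multishift T c j ^^ n) f) w))\<^sup>2 *
      (g (prod_depth T w) / shift_moment c (prod_depth T w))) has_sum s) V"
    by (rule multishift_normalized_sum[OF c Suc.prems(1)])
  then show ?case by simp
qed simp

lemma comp_fun_commute_multishift:
  "comp_fun_commute (\<lambda>j R. (multishift T c j ^^ \<alpha> j) \<circ> R)"
proof -
  let ?m = "multishift T c"
  have c2: "(?m i ^^ m) (?m j x) = ?m j ((?m i ^^ m) x)" for i j m x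
    by (induction m) (simp_all add: multishift_commute[OF tree, where i = i and j = j])
  have c3: "(?m i ^^ m) ((?m j ^^ n) x) = (?m j ^^ n) ((?m i ^^ m) x)" for i j m n x
    by (induction n) (simp_all add: c2)
  show ?thesis by standard (simp add: fun_eq_iff c3[unfolded fun_eq_iff])
qed

text \<open>The fold is unrolled over a growing set A of directions, and the depths are translated
  by \<open>\<alpha>\<close> only in the directions of A. Again g varies, being translated in the
  direction that joins A.\<close>

lemma multi_power_normalized_sum:
  assumes c: "\<And>n. c n > 0" and g: "\<And>\<beta>. g \<beta> \<ge> 0"
    and sum: "((\<lambda>v. (cmod (f v))\<^sup>2 * (g (\<lambda>j. prod_depth T v j + \<alpha> j) / shift_moment c (prod_depth T v))) has_sum s) V"
  shows "((\<lambda>w. (cmod (multi_power (multishift T c) \<alpha> f w))\<^sup>2 * (g (prod_depth T w) / shift_moment c (prod_depth T w))) has_sum s) V"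
proof -
  interpret comp_fun_commute "\<lambda>j R. (multishift T c j ^^ \<alpha> j) \<circ> R"
    by (rule comp_fun_commute_multishift)
  let ?R = "\<lambda>A. Finite_Set.fold (\<lambda>j R. (multishift T c j ^^ \<alpha> j) \<circ> R) id A"
  have "((\<lambda>w. (cmod (?R A f w))\<^sup>2 * (g (prod_depth T w) / shift_moment c (prod_depth T w))) has_sum s) V"
    if "finite A" "\<And>\<beta>. g \<beta> \<ge> 0"
      "((\<lambda>v. (cmod (f v))\<^sup>2 * (g (\<lambda>j. if j \<in> A then prod_depth T v j + \<alpha> j else prod_depth T v j) / shift_moment c (prod_depth T v))) has_sum s) V" for A g
    using that
  proof (induction A arbitrary: g)
    case (insert j A)
    define g' where "g' \<beta> = g (\<beta>(j := \<beta> j + \<alpha> j))" for \<beta>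
    have "(\<lambda>i. if i \<in> insert j A then \<beta> i + \<alpha> i else \<beta> i) = (\<lambda>i. if i \<in> A then \<beta> i + \<alpha> i else \<beta> i)(j := (if j \<in> A then \<beta> j + \<alpha> j else \<beta> j) + \<alpha> j)" for \<beta>
      using insert.hyps by auto
    then have eq: "g (\<lambda>i. if i \<in> insert j A then \<beta> i + \<alpha> i else \<beta> i) = g' (\<lambda>i. if i \<in> A then \<beta> i + \<alpha> i else \<beta> i)" for \<beta>
      by (simp add: g'_def)
    have "((\<lambda>w. (cmod (?R A f w))\<^sup>2 * (g' (prod_depth T w) / shift_moment c (prod_depth T w))) has_sum s) V"
      using insert.prems by (intro insert.IH) (simp_all only: eq g'_def)
    then have "((\<lambda>w. (cmod ((multishift T c j ^^ \<alpha> j) (?R A f) w))\<^sup>2 * (g (prod_depth T w) / shift_moment c (prod_depth T w))) has_sum s) V"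
      unfolding g'_def by (rule multishift_funpow_normalized_sum[OF c insert.prems(1)])
    then show ?case
      unfolding fold_insert[OF insert.hyps] by simp
  qed simp
  from this[of UNIV g] show ?thesis
    using g sum by (simp add: multi_power_def)
qed

section \<open>The adjoint of the multishift and the equations of its joint cokernel\<close>

lemma chi_summable:
  fixes F :: "('d \<Rightarrow> 'a) \<Rightarrow> 'b::banach"
  assumes "F summable_on V" shows "(\<lambda>(v, w). F w) summable_on Sigma V (prod_chi T j)"
proof -
  have "F summable_on nonroot j"
    using assms by (rule summable_on_subset_banach) (auto simp: nonroot_def)
  then show ?thesis
    using summable_on_reindex_bij_betw[OF bij_betw_chi, of F] by (simp add: case_prod_beta')
qed

text \<open>The adjoint of \<open>S\<^sub>j\<close> in coordinates; the weights are real, so no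
  conjugation appears.\<close>

definition chi_sum :: "(nat \<Rightarrow> real) \<Rightarrow> 'd \<Rightarrow> (('d \<Rightarrow> 'a) \<Rightarrow> complex) \<Rightarrow> ('d \<Rightarrow> 'a) \<Rightarrow> complex" where
  "chi_sum c j f v = (if v \<in> V then \<Sum>w\<in>prod_chi T j v. of_real (weight T c j w) * f w else 0)"

text \<open>Cauchy-Schwarz on each set of children, where the squared weights sum to a shift factor
  and hence to at most an upper bound of \<open>c\<close>. The remaining sums of |f(w)|^2 run over
  disjoint fibres.\<close>

lemma chi_sum_in_l2:
  assumes c: "\<And>n. c n > 0" "bdd_above (range c)" and f: "f \<in> l2 V"
  shows "chi_sum c j f \<in> l2 V"
proof -
  obtain b where b: "\<And>n. c n \<le> b" using c(2) by (auto simp: bdd_above_def)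
  have bound: "(cmod (chi_sum c j f v))\<^sup>2 \<le> b * (\<Sum>w\<in>prod_chi T j v. (cmod (f w))\<^sup>2)" if v: "v \<in> V" for v
  proof -
    have "cmod (chi_sum c j f v) \<le> (\<Sum>w\<in>prod_chi T j v. \<bar>weight T c j w\<bar> * cmod (f w))"
      using v by (auto simp: chi_sum_def norm_mult intro!: order_trans[OF norm_sum])
    then have "(cmod (chi_sum c j f v))\<^sup>2 \<le> (\<Sum>w\<in>prod_chi T j v. \<bar>weight T c j w\<bar> * cmod (f w))\<^sup>2"
      by (intro power_mono) auto
    also have "\<dots> \<le> (\<Sum>w\<in>prod_chi T j v. \<bar>weight T c j w\<bar>\<^sup>2) * (\<Sum>w\<in>prod_chi T j v. (cmod (f w))\<^sup>2)"
      by (rule Cauchy_Schwarz_ineq_sum)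
    also have "(\<Sum>w\<in>prod_chi T j v. \<bar>weight T c j w\<bar>\<^sup>2) = shift_factor c j (prod_depth T v)"
      using sum_weight_sq[OF v, of c j] c by simp
    also have "shift_factor c j (prod_depth T v) * (\<Sum>w\<in>prod_chi T j v. (cmod (f w))\<^sup>2) \<le> b * (\<Sum>w\<in>prod_chi T j v. (cmod (f w))\<^sup>2)"
      using b c by (intro mult_right_mono shift_factor_le sum_nonneg) (auto intro: less_imp_le)
    finally show ?thesis .
  qed
  have "(\<lambda>v. infsum (\<lambda>w. (cmod (f w))\<^sup>2) (prod_chi T j v)) summable_on V"
    using summable_on_Sigma_banach[OF chi_summable[of "\<lambda>w. (cmod (f w))\<^sup>2" j]] f
    by (simp add: l2_def)
  then have "(\<lambda>v. b * (\<Sum>w\<in>prod_chi T j v. (cmod (f w))\<^sup>2)) summable_on V"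
    by (intro summable_on_cmult_right) (simp add: finite_prod_chi cong: summable_on_cong)
  then have "(\<lambda>v. (cmod (chi_sum c j f v))\<^sup>2) summable_on V"
    using bound by (rule summable_on_comparison_test) auto
  then show ?thesis by (auto simp: l2_def chi_sum_def)
qed

text \<open>Both sides are one double sum over pairs (v, w) with w a child of v, summed in two ways.
  Absolute summability follows from 2xy <= x^2 + y^2, as |f(w)|^2 and weight^2 |g(v)|^2 are each
  summable over the pairs.\<close>

lemma l2_inner_multishift:
  assumes c: "\<And>n. c n > 0" "bdd_above (range c)" and f: "f \<in> l2 V" and g: "g \<in> l2 V"
  shows "l2_inner V (multishift T c j g) f = l2_inner V g (chi_sum c j f)"
proof -
  obtain b where b: "\<And>n. c n \<le> b" using c(2) by (auto simp: bdd_above_def)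
  let ?L = "\<lambda>w. of_real (weight T c j w) :: complex"
  let ?F = "\<lambda>w. ?L w * g (prod_par T j w) * cnj (f w)"
  let ?S = "Sigma V (prod_chi T j)"
  have s1: "(\<lambda>(v, w). (cmod (f w))\<^sup>2) summable_on ?S"
    using f by (intro chi_summable) (simp add: l2_def)
  have s2: "(\<lambda>(v, w). (weight T c j w)\<^sup>2 * (cmod (g v))\<^sup>2) summable_on ?S"
  proof (rule summable_on_SigmaI)
    show "((\<lambda>w. case (v, w) of (v, w) \<Rightarrow> (weight T c j w)\<^sup>2 * (cmod (g v))\<^sup>2) has_sum
        shift_factor c j (prod_depth T v) * (cmod (g v))\<^sup>2) (prod_chi T j v)" if v: "v \<in> V" for v
      using has_sum_finite[OF finite_prod_chi[OF v], of "\<lambda>w. (weight T c j w)\<^sup>2 * (cmod (g v))\<^sup>2" j]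
      by (simp add: sum_distrib_right[symmetric] sum_weight_sq[OF v] c)
    have "(\<lambda>v. b * (cmod (g v))\<^sup>2) summable_on V"
      using g by (intro summable_on_cmult_right) (simp add: l2_def)
    then show "(\<lambda>v. shift_factor c j (prod_depth T v) * (cmod (g v))\<^sup>2) summable_on V"
    proof (rule summable_on_comparison_test)
      fix v
      show "shift_factor c j (prod_depth T v) * (cmod (g v))\<^sup>2 \<le> b * (cmod (g v))\<^sup>2"
        by (intro mult_right_mono shift_factor_le b less_imp_le[OF c(1)]) simp
      show "0 \<le> shift_factor c j (prod_depth T v) * (cmod (g v))\<^sup>2"
        using shift_factor_pos[of c "prod_depth T v" j] c(1) by (simp add: less_imp_le)
    qed
  qed auto
  have "(\<lambda>p. (case p of (v, w) \<Rightarrow> (cmod (f w))\<^sup>2) + (case p of (v, w) \<Rightarrow> (weight T c j w)\<^sup>2 * (cmod (g v))\<^sup>2)) summable_on ?S"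
    using s1 s2 by (rule summable_on_add)
  then have "(\<lambda>p. norm (?F (snd p))) summable_on ?S"
  proof (rule summable_on_comparison_test)
    fix p assume p: "p \<in> ?S"
    have "2 * (x * y) \<le> x\<^sup>2 + y\<^sup>2" for x y :: real
      using sum_squares_bound[of x y] by simp
    from this[of "\<bar>weight T c j (snd p)\<bar> * cmod (g (fst p))" "cmod (f (snd p))"]
    have "\<bar>weight T c j (snd p)\<bar> * cmod (g (fst p)) * cmod (f (snd p)) \<le>
        (cmod (f (snd p)))\<^sup>2 + (weight T c j (snd p))\<^sup>2 * (cmod (g (fst p)))\<^sup>2"
      by (simp add: power_mult_distrib) (smt (verit) mult_nonneg_nonneg norm_ge_zero abs_ge_zero)
    moreover have "prod_par T j (snd p) = fst p" using p prod_chi_iff by auto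
    ultimately show "norm (?F (snd p)) \<le> (case p of (v, w) \<Rightarrow> (cmod (f w))\<^sup>2) + (case p of (v, w) \<Rightarrow> (weight T c j w)\<^sup>2 * (cmod (g v))\<^sup>2)"
      by (simp add: norm_mult case_prod_beta)
  qed simp
  then have sum: "(\<lambda>p. ?F (snd p)) summable_on ?S"
    by (rule abs_summable_summable)
  have "l2_inner V (multishift T c j g) f = infsum ?F (nonroot j)"
    unfolding l2_inner_def
    by (rule infsum_cong_neutral) (auto simp: nonroot_def multishift_def)
  also have "\<dots> = infsum (\<lambda>p. ?F (snd p)) ?S"
    by (rule infsum_reindex_bij_betw[OF bij_betw_chi, symmetric])
  also have "\<dots> = infsum (\<lambda>v. infsum (\<lambda>w. ?F (snd (v, w))) (prod_chi T j v)) V"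
    by (rule infsum_Sigma_banach[OF sum, symmetric])
  also have "\<dots> = l2_inner V g (chi_sum c j f)"
    unfolding l2_inner_def
  proof (rule infsum_cong)
    fix v assume v: "v \<in> V"
    have "infsum (\<lambda>w. ?F (snd (v, w))) (prod_chi T j v) = (\<Sum>w\<in>prod_chi T j v. g v * cnj (?L w * f w))"
      using v by (simp add: finite_prod_chi prod_chi_iff mult_ac)
    then show "infsum (\<lambda>w. ?F (snd (v, w))) (prod_chi T j v) = g v * cnj (chi_sum c j f v)"
      using v by (simp add: chi_sum_def sum_distrib_left)
  qed
  finally show ?thesis .
qed

lemma l2_adjoint_multishift:
  assumes "\<And>n. c n > 0" "bdd_above (range c)" "f \<in> l2 V"
  shows "l2_adjoint V (multishift T c j) f = chi_sum c j f"
  by (rule l2_adjoint_eqI[OF chi_sum_in_l2[OF assms] l2_inner_multishift[OF assms]])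

text \<open>Since the adjoints are explicit, E is cut out by finite linear equations, one for each
  vertex and direction; the later arguments about E work with these.\<close>

lemma joint_cokernel_iff:
  assumes "\<And>n. c n > 0" "bdd_above (range c)"
  shows "f \<in> joint_cokernel T c \<longleftrightarrow>
    f \<in> l2 V \<and> (\<forall>j. \<forall>v\<in>V. (\<Sum>w\<in>prod_chi T j v. of_real (weight T c j w) * f w) = 0)"
proof -
  have "(chi_sum c j f = (\<lambda>_. 0)) \<longleftrightarrow> (\<forall>v\<in>V. (\<Sum>w\<in>prod_chi T j v. of_real (weight T c j w) * f w) = 0)" for j
    by (auto simp: chi_sum_def fun_eq_iff)
  then show ?thesis
    using l2_adjoint_multishift[OF assms] by (auto simp: joint_cokernel_def)
qed

text \<open>An only child \<open>w\<close> occurs alone in its kernel equation, so \<open>f w = 0\<close>.\<close>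

lemma joint_cokernel_finite_support:
  assumes c: "\<And>n. c n > 0" "bdd_above (range c)" and fin: "finite_joint_branching_index T"
  obtains W where "finite W" "W \<subseteq> V" "\<And>f v. f \<in> joint_cokernel T c \<Longrightarrow> v \<notin> W \<Longrightarrow> f v = 0"
proof -
  obtain N where N: "\<And>j x. x \<in> branching_vertices (T j) \<Longrightarrow> depth (T j) x \<le> N j"
    using fin unfolding finite_joint_branching_index_def bdd_above_def by (metis image_eqI)
  \<comment> \<open>Beyond depth \<open>N j + 1\<close> the parent lies deeper than
    \<open>N j\<close> and cannot branch. The root is listed explicitly so that a vertex outside
    \<open>A j\<close> visibly has a parent.\<close>
  define A where "A j = insert (root (T j)) {x \<in> pverts (T j). depth (T j) x \<le> Suc (N j)}" for j
  have finA: "finite (A j)" for j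
    unfolding A_def using finite_depth_le[OF tree locally_finite] by simp
  let ?W = "V \<inter> (\<Pi>\<^sub>E j\<in>UNIV. A j)"
  have "finite (\<Pi>\<^sub>E j\<in>UNIV. A j)" using finA by (intro finite_PiE) auto
  moreover have "f w = 0" if f: "f \<in> joint_cokernel T c" and w: "w \<notin> ?W" for f w
  proof (cases "w \<in> V")
    case True
    then obtain j where j: "w j \<notin> A j" using w by (auto simp: PiE_def)
    let ?v = "prod_par T j w"
    have r: "w j \<noteq> root (T j)" using j by (auto simp: A_def)
    have v: "?v \<in> V" using prod_par_in_V[OF True r] .
    have w': "w \<in> prod_chi T j ?v" using prod_chi_iff[OF v] True r by blast
    have "depth (T j) (w j) > Suc (N j)" using j True by (auto simp: A_def V_iff)
    moreover have "depth (T j) (w j) = Suc (depth (T j) (?v j))"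
      using depth_chi[OF tree, of "w j" j "?v j"] w' by (simp add: prod_chi_def)
    ultimately have "?v j \<notin> branching_vertices (T j)" using N[of "?v j" j] by auto
    then have "u = w" if "u \<in> prod_chi T j ?v" for u
      using that w' v unfolding branching_vertices_def prod_chi_def V_iff by (auto simp: fun_eq_iff) metis
    then have "prod_chi T j ?v = {w}" using w' by blast
    moreover have "(\<Sum>u\<in>prod_chi T j ?v. of_real (weight T c j u) * f u) = 0"
      using f v joint_cokernel_iff[OF c] by blast
    ultimately have "of_real (weight T c j w) * f w = 0" by simp
    then show ?thesis using weight_pos[of ?v w j c] v w' c(1) by simp
  next
    case False
    then show ?thesis using f by (auto simp: joint_cokernel_def l2_def)
  qed
  ultimately show ?thesis by (intro that[of ?W]) auto
qed

end


section \<open>Products of measures on an interval and on the sphere\<close>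

text \<open>Bundles the conditions imposed on each \<open>\<rho> u\<close> and
  \<open>\<nu> u\<close> by \<open>representing_measure\<close> and on the measure in
  \<open>hausdorff_representing\<close>. K is carried along because signs and bounds of the
  integrands are known only there.\<close>

definition finite_measure_on :: "'a::topological_space set \<Rightarrow> 'a measure \<Rightarrow> bool" where
  "finite_measure_on K M \<longleftrightarrow> finite_measure M \<and> sets M = sets borel \<and> emeasure M (- K) = 0"

lemma finite_measure_on_AE:
  assumes "finite_measure_on K M" "K \<in> sets borel" shows "AE x in M. x \<in> K"
  by (rule AE_I'[of "- K"]) (use assms in \<open>auto simp: null_sets_def finite_measure_on_def\<close>)

lemma finite_measure_on_measurable:
  "finite_measure_on K M \<Longrightarrow> f \<in> borel_measurable borel \<Longrightarrow> f \<in> borel_measurable M"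
  by (simp add: finite_measure_on_def measurable_cong_sets[of M borel borel borel])

lemma finite_measure_on_integrable:
  fixes f :: "'a::topological_space \<Rightarrow> real"
  assumes M: "finite_measure_on K M" "K \<in> sets borel"
    and f: "f \<in> borel_measurable borel" "\<And>x. x \<in> K \<Longrightarrow> \<bar>f x\<bar> \<le> B"
  shows "integrable M f"
proof (rule finite_measure.integrable_const_bound)
  show "finite_measure M" using M by (simp add: finite_measure_on_def)
  show "AE x in M. norm (f x) \<le> B"
    using finite_measure_on_AE[OF M] by eventually_elim (simp add: f)
qed (rule finite_measure_on_measurable[OF M(1) f(1)])

lemma finite_measure_on_set_integral:
  fixes f :: "'a::topological_space \<Rightarrow> real"
  assumes M: "finite_measure_on K M" "K \<in> sets borel" and f: "f \<in> borel_measurable borel"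
  shows "(LINT x:K|M. f x) = (\<integral>x. f x \<partial>M)"
  unfolding set_lebesgue_integral_def
proof (rule integral_cong_AE)
  show "AE x in M. indicator K x *\<^sub>R f x = f x"
    using finite_measure_on_AE[OF M] by eventually_elim simp
qed (use f M(2) in \<open>auto intro!: finite_measure_on_measurable[OF M(1)] borel_measurable_scaleR borel_measurable_indicator\<close>)

lemma finite_measure_on_set_nn_integral:
  fixes f :: "'a::topological_space \<Rightarrow> real"
  assumes M: "finite_measure_on K M" "K \<in> sets borel"
    and f: "f \<in> borel_measurable borel" "\<And>x. x \<in> K \<Longrightarrow> 0 \<le> f x \<and> f x \<le> B"
  shows "(\<integral>\<^sup>+x\<in>K. ennreal (f x) \<partial>M) = ennreal (\<integral>x. f x \<partial>M)"
proof -
  have "(\<integral>\<^sup>+x\<in>K. ennreal (f x) \<partial>M) = (\<integral>\<^sup>+x. ennreal (f x) \<partial>M)"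
  proof (rule nn_integral_cong_AE)
    show "AE x in M. ennreal (f x) * indicator K x = ennreal (f x)"
      using finite_measure_on_AE[OF M] by eventually_elim simp
  qed
  also have "\<dots> = ennreal (\<integral>x. f x \<partial>M)"
  proof (rule nn_integral_eq_integral)
    show "integrable M f" by (rule finite_measure_on_integrable[OF M f(1), of B]) (use f in auto)
    show "AE x in M. 0 \<le> f x" using finite_measure_on_AE[OF M] by eventually_elim (simp add: f)
  qed
  finally show ?thesis .
qed

lemma finite_measure_on_pair:
  fixes M :: "'a::second_countable_topology measure" and N :: "'b::second_countable_topology measure"
  assumes M: "finite_measure_on K M" "K \<in> sets borel" and N: "finite_measure_on L N" "L \<in> sets borel"
  shows "finite_measure_on (K \<times> L) (M \<Otimes>\<^sub>M N)"
proof -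
  interpret M: finite_measure M using M by (simp add: finite_measure_on_def)
  interpret N: finite_measure N using N by (simp add: finite_measure_on_def)
  have sets: "sets (M \<Otimes>\<^sub>M N) = sets borel"
    using M(1) N(1) by (simp add: finite_measure_on_def sets_pair_measure_cong[of M borel N borel] borel_prod[symmetric])
  have sM: "sets M = sets borel" "sets N = sets borel" using M(1) N(1) by (auto simp: finite_measure_on_def)
  have eq: "- (K \<times> L) = (- K) \<times> UNIV \<union> UNIV \<times> (- L)" by auto
  have "(- K) \<times> (UNIV :: 'b set) \<in> null_sets (M \<Otimes>\<^sub>M N)"
    by (rule N.times_in_null_sets1) (use M sM in \<open>auto simp: null_sets_def finite_measure_on_def\<close>)
  moreover have "(UNIV :: 'a set) \<times> (- L) \<in> null_sets (M \<Otimes>\<^sub>M N)"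
    by (rule N.times_in_null_sets2) (use N sM in \<open>auto simp: null_sets_def finite_measure_on_def\<close>)
  ultimately have "- (K \<times> L) \<in> null_sets (M \<Otimes>\<^sub>M N)" unfolding eq by blast
  moreover have "finite_measure (M \<Otimes>\<^sub>M N)"
    by (rule finite_measure_pair_measure) unfold_locales
  ultimately show ?thesis using sets by (auto simp: finite_measure_on_def)
qed

lemma nn_integral_pair_mult:
  assumes "sigma_finite_measure N" and [measurable]: "f \<in> borel_measurable M" "g \<in> borel_measurable N"
  shows "(\<integral>\<^sup>+p. f (fst p) * g (snd p) \<partial>(M \<Otimes>\<^sub>M N)) = (\<integral>\<^sup>+x. f x \<partial>M) * (\<integral>\<^sup>+y. g y \<partial>N)"
proof -
  interpret N: sigma_finite_measure N by fact
  have "(\<integral>\<^sup>+p. f (fst p) * g (snd p) \<partial>(M \<Otimes>\<^sub>M N)) = (\<integral>\<^sup>+x. \<integral>\<^sup>+y. f x * g y \<partial>N \<partial>M)"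
    by (subst N.nn_integral_fst[symmetric]) simp_all
  then show ?thesis by (simp add: nn_integral_cmult nn_integral_multc)
qed

section \<open>Mixed moments on the product of an interval and the sphere\<close>

abbreviation box_integrand :: "nat \<Rightarrow> ('d::finite \<Rightarrow> nat) \<Rightarrow> real \<times> (complex ^ 'd) \<Rightarrow> real" where
  "box_integrand m \<alpha> \<equiv> \<lambda>p. fst p ^ m * (cmod (mmonom (snd p) \<alpha>))\<^sup>2"

lemma borel_measurable_box_integrand: "box_integrand m \<alpha> \<in> borel_measurable borel"
proof -
  have "continuous_on UNIV (box_integrand m \<alpha>)"
    unfolding mmonom_def by (intro continuous_intros)
  then show ?thesis by (rule borel_measurable_continuous_onI)
qed

lemma cmod_mmonom_sphere: "z \<in> sphere 0 1 \<Longrightarrow> cmod (mmonom z \<alpha>) \<le> 1"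
  by (rule cmod_mmonom_le) simp

lemma finite_measure_on_pow:
  assumes "finite_measure_on {0..b} \<rho>"
  shows "integrable \<rho> (\<lambda>s. s ^ m)" "(\<integral>\<^sup>+s\<in>{0..b}. ennreal (s ^ m) \<partial>\<rho>) = ennreal (\<integral>s. s ^ m \<partial>\<rho>)"
    "(LINT s:{0..b}|\<rho>. s ^ m) = (\<integral>s. s ^ m \<partial>\<rho>)" "(\<integral>s. s ^ m \<partial>\<rho>) \<ge> 0"
proof -
  show "integrable \<rho> (\<lambda>s. s ^ m)"
    by (rule finite_measure_on_integrable[OF assms, of _ "b ^ m"]) (auto intro: power_mono)
  show "(\<integral>\<^sup>+s\<in>{0..b}. ennreal (s ^ m) \<partial>\<rho>) = ennreal (\<integral>s. s ^ m \<partial>\<rho>)"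
    by (rule finite_measure_on_set_nn_integral[OF assms, of _ "b ^ m"]) (auto intro: power_mono)
  show "(LINT s:{0..b}|\<rho>. s ^ m) = (\<integral>s. s ^ m \<partial>\<rho>)"
    by (rule finite_measure_on_set_integral[OF assms]) auto
  have "AE s in \<rho>. 0 \<le> s ^ m"
    using finite_measure_on_AE[OF assms borel_closed[OF closed_atLeastAtMost]] by eventually_elim simp
  then show "(\<integral>s. s ^ m \<partial>\<rho>) \<ge> 0" by (rule integral_nonneg_AE)
qed

lemma finite_measure_on_mmonom:
  fixes \<nu> :: "(complex ^ 'd::finite) measure"
  assumes "finite_measure_on (sphere 0 1) \<nu>"
  shows "integrable \<nu> (\<lambda>z. (cmod (mmonom z \<alpha>))\<^sup>2)"
    "(\<integral>\<^sup>+z\<in>sphere 0 1. ennreal ((cmod (mmonom z \<alpha>))\<^sup>2) \<partial>\<nu>) = ennreal (\<integral>z. (cmod (mmonom z \<alpha>))\<^sup>2 \<partial>\<nu>)"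
proof -
  have le: "(cmod (mmonom z \<alpha>))\<^sup>2 \<le> 1" if "z \<in> sphere 0 1" for z
    using cmod_mmonom_sphere[OF that] by (simp add: power_le_one)
  show "integrable \<nu> (\<lambda>z. (cmod (mmonom z \<alpha>))\<^sup>2)"
    by (rule finite_measure_on_integrable[OF assms, of _ 1]) (use le in auto)
  show "(\<integral>\<^sup>+z\<in>sphere 0 1. ennreal ((cmod (mmonom z \<alpha>))\<^sup>2) \<partial>\<nu>) = ennreal (\<integral>z. (cmod (mmonom z \<alpha>))\<^sup>2 \<partial>\<nu>)"
    by (rule finite_measure_on_set_nn_integral[OF assms, of _ 1]) (use le in auto)
qed

text \<open>Tonelli, once the indicator of the product set is split into its two factors. On that
  set s^m is nonnegative, so \<open>ennreal\<close> respects the product.\<close>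

lemma set_nn_integral_box:
  fixes \<nu> :: "(complex ^ 'd::finite) measure"
  assumes \<rho>: "finite_measure_on {0..b} \<rho>" and \<nu>: "finite_measure_on (sphere 0 1) \<nu>"
  shows "(\<integral>\<^sup>+p\<in>{0..b} \<times> sphere 0 1. ennreal (box_integrand m \<alpha> p) \<partial>(\<rho> \<Otimes>\<^sub>M \<nu>)) =
    ennreal ((\<integral>s. s ^ m \<partial>\<rho>) * (\<integral>z. (cmod (mmonom z \<alpha>))\<^sup>2 \<partial>\<nu>))"
proof -
  have N: "sigma_finite_measure \<nu>"
    using \<nu> by (simp add: finite_measure_on_def finite_measure.sigma_finite_measure finite_measure_def)
  have [measurable]: "sphere (0 :: complex ^ 'd) 1 \<in> sets borel" by simp
  have "(\<integral>\<^sup>+p\<in>{0..b} \<times> sphere 0 1. ennreal (box_integrand m \<alpha> p) \<partial>(\<rho> \<Otimes>\<^sub>M \<nu>)) =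
    (\<integral>\<^sup>+p. (ennreal (fst p ^ m) * indicator {0..b} (fst p)) *
       (ennreal ((cmod (mmonom (snd p) \<alpha>))\<^sup>2) * indicator (sphere 0 1) (snd p)) \<partial>(\<rho> \<Otimes>\<^sub>M \<nu>))"
    by (intro nn_integral_cong) (auto simp: ennreal_mult split: split_indicator)
  also have "\<dots> = (\<integral>\<^sup>+s\<in>{0..b}. ennreal (s ^ m) \<partial>\<rho>) *
      (\<integral>\<^sup>+z\<in>sphere 0 1. ennreal ((cmod (mmonom z \<alpha>))\<^sup>2) \<partial>\<nu>)"
    by (rule nn_integral_pair_mult[OF N])
      (intro finite_measure_on_measurable[OF \<rho>] finite_measure_on_measurable[OF \<nu>], measurable)+
  also have "\<dots> = ennreal ((\<integral>s. s ^ m \<partial>\<rho>) * (\<integral>z. (cmod (mmonom z \<alpha>))\<^sup>2 \<partial>\<nu>))"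
    using finite_measure_on_pow(2,4)[OF \<rho>] finite_measure_on_mmonom(2)[OF \<nu>] by (simp add: ennreal_mult')
  finally show ?thesis .
qed

text \<open>Passes to nonnegative integrals, where scaling and summing of measures need no
  integrability. It covers divergence too: both sides are then 0 by convention.\<close>

lemma set_integral_box_eq_nn:
  fixes N :: "(real \<times> (complex ^ 'd::finite)) measure"
  assumes "sets N = sets borel"
  shows "(LINT p:{0..b} \<times> sphere 0 1|N. box_integrand m \<alpha> p) =
    enn2real (\<integral>\<^sup>+p\<in>{0..b} \<times> sphere 0 1. ennreal (box_integrand m \<alpha> p) \<partial>N)"
proof -
  have "(LINT p:{0..b} \<times> sphere 0 1|N. box_integrand m \<alpha> p) =
     enn2real (\<integral>\<^sup>+p. ennreal (indicator ({0..b} \<times> sphere 0 1) p *\<^sub>R box_integrand m \<alpha> p) \<partial>N)"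
    unfolding set_lebesgue_integral_def
  proof (rule integral_eq_nn_integral)
    have "{0..b} \<times> sphere (0 :: complex ^ 'd) 1 \<in> sets borel"
      by (intro borel_closed closed_Times) auto
    then show "(\<lambda>p. indicator ({0..b} \<times> sphere 0 1) p *\<^sub>R box_integrand m \<alpha> p) \<in> borel_measurable N"
      using borel_measurable_box_integrand[of m \<alpha>]
      by (subst measurable_cong_sets[OF assms refl]) (intro borel_measurable_scaleR borel_measurable_indicator)
  qed (auto split: split_indicator)
  also have "(\<integral>\<^sup>+p. ennreal (indicator ({0..b} \<times> sphere 0 1) p *\<^sub>R box_integrand m \<alpha> p) \<partial>N) =
      (\<integral>\<^sup>+p\<in>{0..b} \<times> sphere 0 1. ennreal (box_integrand m \<alpha> p) \<partial>N)"
    by (intro nn_integral_cong) (auto split: split_indicator)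
  finally show ?thesis .
qed

lemma mmonom_add: "mmonom z (\<lambda>j. \<alpha> j + \<beta> j) = mmonom z \<alpha> * mmonom z \<beta>"
  by (simp add: mmonom_def power_add prod.distrib)

text \<open>Raising the j-th exponent multiplies the squared modulus by |z_j|^2, and these add up to
  |z|^2 = 1.\<close>

lemma sum_mmonom_upd_Suc:
  assumes "z \<in> sphere 0 1"
  shows "(\<Sum>j\<in>UNIV. (cmod (mmonom z (\<alpha>(j := Suc (\<alpha> j)))))\<^sup>2) = (cmod (mmonom z \<alpha>))\<^sup>2"
proof -
  have "mmonom z (\<alpha>(j := Suc (\<alpha> j))) = z $ j * mmonom z \<alpha>" for j
    unfolding mmonom_def by (subst (1 2) prod.remove[of UNIV j]) simp_all
  then have "(\<Sum>j\<in>UNIV. (cmod (mmonom z (\<alpha>(j := Suc (\<alpha> j)))))\<^sup>2) = (\<Sum>j\<in>UNIV. (cmod (z $ j))\<^sup>2) * (cmod (mmonom z \<alpha>))\<^sup>2"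
    by (simp add: norm_mult power_mult_distrib sum_distrib_right)
  also have "(\<Sum>j\<in>UNIV. (cmod (z $ j))\<^sup>2) = (norm z)\<^sup>2"
    by (simp add: norm_vec_def L2_set_def sum_nonneg)
  also have "norm z = 1" using assms by simp
  finally show ?thesis by (simp only: power_one mult_1)
qed

lemma sum_integral_mmonom_upd_Suc:
  fixes \<nu> :: "(complex ^ 'd::finite) measure"
  assumes \<nu>: "finite_measure_on (sphere 0 1) \<nu>"
  shows "(\<Sum>j\<in>UNIV. \<integral>z. (cmod (mmonom z (\<alpha>(j := Suc (\<alpha> j)))))\<^sup>2 \<partial>\<nu>) = (\<integral>z. (cmod (mmonom z \<alpha>))\<^sup>2 \<partial>\<nu>)"
proof -
  have "(\<Sum>j\<in>UNIV. \<integral>z. (cmod (mmonom z (\<alpha>(j := Suc (\<alpha> j)))))\<^sup>2 \<partial>\<nu>) =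
      (\<integral>z. (\<Sum>j\<in>UNIV. (cmod (mmonom z (\<alpha>(j := Suc (\<alpha> j)))))\<^sup>2) \<partial>\<nu>)"
    by (simp add: finite_measure_on_mmonom(1)[OF \<nu>])
  also have "\<dots> = (\<integral>z. (cmod (mmonom z \<alpha>))\<^sup>2 \<partial>\<nu>)"
  proof (rule integral_cong_AE)
    have "AE z in \<nu>. z \<in> sphere 0 1" by (rule finite_measure_on_AE[OF \<nu>]) auto
    then show "AE z in \<nu>. (\<Sum>j\<in>UNIV. (cmod (mmonom z (\<alpha>(j := Suc (\<alpha> j)))))\<^sup>2) = (cmod (mmonom z \<alpha>))\<^sup>2"
      by eventually_elim (rule sum_mmonom_upd_Suc)
  qed (intro finite_measure_on_measurable[OF \<nu>], measurable)+
  finally show ?thesis .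
qed

text \<open>Pulled back along \<open>\<Psi>\<close>, the polynomials s^m times the product of r_j^(2
  alpha_j) become the box integrands, whose integrals factor into the given moments. Closure under
  products mixes the exponents, so \<open>eq\<close> must be known for m and \<open>\<alpha>\<close>
  of unrelated size.\<close>

lemma modulus_image_eqI:
  fixes \<nu> \<nu>' :: "(complex ^ 'd::finite) measure"
  assumes \<rho>: "finite_measure_on {0..b} \<rho>" "finite_measure_on {0..b} \<rho>'"
    and \<nu>: "finite_measure_on (sphere 0 1) \<nu>" "finite_measure_on (sphere 0 1) \<nu>'"
    and eq: "\<And>m \<alpha>. (\<integral>s. s ^ m \<partial>\<rho>) * (\<integral>z. (cmod (mmonom z \<alpha>))\<^sup>2 \<partial>\<nu>) =
       (\<integral>s. s ^ m \<partial>\<rho>') * (\<integral>z. (cmod (mmonom z \<alpha>))\<^sup>2 \<partial>\<nu>')"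
  shows "modulus_image \<rho> \<nu> = modulus_image \<rho>' \<nu>'"
proof -
  define \<Psi> :: "real \<times> (complex ^ 'd) \<Rightarrow> real \<times> (real ^ 'd)" where "\<Psi> = (\<lambda>(s, z). (s, \<chi> j. cmod (z $ j)))"
  define K :: "(real \<times> (real ^ 'd)) set" where "K = {0..b} \<times> {r. \<forall>j. r $ j \<in> {0..1}}"
  define mon where "mon m \<alpha> = (\<lambda>p :: real \<times> (real ^ 'd). fst p ^ m * (\<Prod>j\<in>UNIV. (snd p $ j) ^ (2 * \<alpha> j)))" for m \<alpha>
  define B where "B = {mon m \<alpha> | m \<alpha>. True}"
  have \<Psi>: "\<Psi> \<in> borel_measurable borel"
    unfolding \<Psi>_def by (intro borel_measurable_continuous_onI) (auto simp: case_prod_beta intro!: continuous_intros)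
  have mon\<Psi>: "mon m \<alpha> (\<Psi> p) = box_integrand m \<alpha> p" for m \<alpha> p
    by (simp add: mon_def \<Psi>_def case_prod_beta mmonom_def prod_norm[symmetric] norm_power
        prod_power_distrib[symmetric] power_even_eq)
  have compact: "compact {r :: real ^ 'd. \<forall>j. r $ j \<in> {0..1}}"
  proof -
    have "{r :: real ^ 'd. \<forall>j. r $ j \<in> {0..1}} = cbox 0 1" by (auto simp: mem_box_cart)
    then show ?thesis by simp
  qed
  have K: "compact K"
    unfolding K_def using compact by (intro compact_Times) auto
  have sphere: "\<Psi> p \<in> K" if "p \<in> {0..b} \<times> sphere 0 1" for p
    using that Finite_Cartesian_Product.norm_nth_le[of "snd p"] by (auto simp: \<Psi>_def K_def)
  have M: "finite_measure (modulus_image \<rho> \<nu>)" "sets (modulus_image \<rho> \<nu>) = sets borel"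
      "emeasure (modulus_image \<rho> \<nu>) (- K) = 0"
      "(\<integral>p. mon m \<alpha> p \<partial>modulus_image \<rho> \<nu>) = (\<integral>s. s ^ m \<partial>\<rho>) * (\<integral>z. (cmod (mmonom z \<alpha>))\<^sup>2 \<partial>\<nu>)"
    if \<rho>: "finite_measure_on {0..b} \<rho>" and \<nu>: "finite_measure_on (sphere 0 1) \<nu>"
    for \<rho> and \<nu> :: "(complex ^ 'd) measure" and m \<alpha>
  proof -
    let ?P = "\<rho> \<Otimes>\<^sub>M \<nu>"
    have mi: "modulus_image \<rho> \<nu> = distr ?P borel \<Psi>" by (simp add: modulus_image_def \<Psi>_def)
    have P: "finite_measure_on ({0..b} \<times> sphere 0 1) ?P"
      by (rule finite_measure_on_pair[OF \<rho> _ \<nu>]) auto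
    have box: "{0..b} \<times> sphere (0 :: complex ^ 'd) 1 \<in> sets borel"
      by (intro borel_closed closed_Times) auto
    have sets: "sets ?P = sets borel" using P by (simp add: finite_measure_on_def)
    have [measurable]: "\<Psi> \<in> measurable ?P borel"
      using \<Psi> by (rule finite_measure_on_measurable[OF P])
    show "finite_measure (modulus_image \<rho> \<nu>)"
      unfolding mi using P by (intro finite_measure.finite_measure_distr) (auto simp: finite_measure_on_def)
    show "sets (modulus_image \<rho> \<nu>) = sets borel" by (simp add: mi)
    have "- K \<in> sets borel" using K by (simp add: compact_imp_closed borel_open open_Compl)
    then have "emeasure (modulus_image \<rho> \<nu>) (- K) = emeasure ?P (\<Psi> -` (- K))"
      unfolding mi using sets_eq_imp_space_eq[OF sets] by (subst emeasure_distr) auto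
    also have "\<dots> \<le> emeasure ?P (- ({0..b} \<times> sphere 0 1))"
    proof (rule emeasure_mono)
      show "\<Psi> -` (- K) \<subseteq> - ({0..b} \<times> sphere 0 1)" using sphere by blast
    qed (use box sets in simp)
    finally show "emeasure (modulus_image \<rho> \<nu>) (- K) = 0"
      using P by (simp add: finite_measure_on_def)
    have "continuous_on UNIV (mon m \<alpha>)" unfolding mon_def by (intro continuous_intros)
    then have "(\<integral>p. mon m \<alpha> p \<partial>modulus_image \<rho> \<nu>) = (\<integral>p. box_integrand m \<alpha> p \<partial>?P)"
      unfolding mi by (subst integral_distr) (auto simp: mon\<Psi> intro: borel_measurable_continuous_onI)
    also have "\<dots> = (LINT p:{0..b} \<times> sphere 0 1|?P. box_integrand m \<alpha> p)"
      by (rule finite_measure_on_set_integral[OF P box borel_measurable_box_integrand, symmetric])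
    also have "\<dots> = (\<integral>s. s ^ m \<partial>\<rho>) * (\<integral>z. (cmod (mmonom z \<alpha>))\<^sup>2 \<partial>\<nu>)"
      unfolding set_integral_box_eq_nn[OF sets] set_nn_integral_box[OF \<rho> \<nu>]
      using finite_measure_on_pow(4)[OF \<rho>] by (intro enn2real_ennreal mult_nonneg_nonneg integral_nonneg) auto
    finally show "(\<integral>p. mon m \<alpha> p \<partial>modulus_image \<rho> \<nu>) = (\<integral>s. s ^ m \<partial>\<rho>) * (\<integral>z. (cmod (mmonom z \<alpha>))\<^sup>2 \<partial>\<nu>)" .
  qed
  show ?thesis
  proof (rule finite_measure_eqI_moments[OF M(1-3)[OF \<rho>(1) \<nu>(1)] M(1-3)[OF \<rho>(2) \<nu>(2)] K, where B = B])
    show "(\<lambda>_. 1) \<in> B"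
      unfolding B_def by (auto simp: mon_def intro!: exI[of _ 0] exI[of _ "\<lambda>_. 0"])
    show "continuous_on UNIV f" if "f \<in> B" for f
      using that unfolding B_def mon_def by (auto intro!: continuous_intros)
    show "(\<lambda>x. f x * g x) \<in> B" if fg: "f \<in> B" "g \<in> B" for f g
    proof -
      obtain m \<alpha> n \<beta> where "f = mon m \<alpha>" "g = mon n \<beta>" using fg by (auto simp: B_def)
      then have "(\<lambda>x. f x * g x) = mon (m + n) (\<lambda>j. \<alpha> j + \<beta> j)"
        by (auto simp: mon_def power_add prod.distrib distrib_left mult_ac)
      then show ?thesis by (auto simp: B_def)
    qed
    \<comment> \<open>Squares of the coordinates separate points because all moduli are nonnegative.\<close>
    show "\<exists>f\<in>B. f x \<noteq> f y" if xy: "x \<in> K" "y \<in> K" "x \<noteq> y" for x y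
    proof (cases "fst x = fst y")
      case True
      then obtain j where j: "snd x $ j \<noteq> snd y $ j"
        using xy(3) by (auto simp: prod_eq_iff vec_eq_iff)
      have "mon 0 (\<lambda>i. if i = j then 1 else 0) p = (snd p $ j)\<^sup>2" for p
        unfolding mon_def by (subst prod.remove[of UNIV j]) auto
      moreover have "(snd x $ j)\<^sup>2 \<noteq> (snd y $ j)\<^sup>2"
        using j xy(1,2) by (auto simp: K_def power2_eq_iff_nonneg)
      ultimately show ?thesis unfolding B_def by (metis (mono_tags, lifting) mem_Collect_eq)
    next
      case False
      have "mon 1 (\<lambda>_. 0) p = fst p" for p by (simp add: mon_def)
      then show ?thesis using False unfolding B_def by (metis (mono_tags, lifting) mem_Collect_eq)
    qed
    show "(\<integral>x. f x \<partial>modulus_image \<rho> \<nu>) = (\<integral>x. f x \<partial>modulus_image \<rho>' \<nu>')" if "f \<in> B" for f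
      using that M(4)[OF \<rho>(1) \<nu>(1)] M(4)[OF \<rho>(2) \<nu>(2)] eq by (auto simp: B_def)
  qed
qed

section \<open>Hausdorff moment sequences: determinacy and size of the support\<close>

lemma hausdorff_representing_iff:
  "hausdorff_representing b a \<mu> \<longleftrightarrow> finite_measure_on {0..b} \<mu> \<and> (\<forall>n. a n = (\<integral>s. s ^ n \<partial>\<mu>))"
  unfolding hausdorff_representing_def finite_measure_on_def[symmetric] conj_assoc[symmetric]
  by (auto simp: finite_measure_on_def[symmetric] conj_assoc finite_measure_on_pow(3))

text \<open>The powers of s contain the constant 1, are closed under products, and already s itself
  separates points.\<close>

lemma hausdorff_representing_unique:
  assumes "hausdorff_representing b a \<mu>" "hausdorff_representing b a \<mu>'"
  shows "\<mu> = \<mu>'"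
proof (rule finite_measure_eqI_moments[where K = "{0..b}" and B = "{\<lambda>s. s ^ n | n. True}"])
  show "(\<lambda>_. 1) \<in> {\<lambda>s. s ^ n | n. True}" by (auto intro!: exI[of _ 0])
  show "\<exists>f\<in>{\<lambda>s. s ^ n | n. True}. f x \<noteq> f y" if "x \<noteq> y" for x y :: real
    using that by (auto intro!: exI[of _ 1])
  show "(\<lambda>x. f x * g x) \<in> {\<lambda>s. s ^ n | n. True}" if "f \<in> {\<lambda>s. s ^ n | n. True}" "g \<in> {\<lambda>s. s ^ n | n. True}" for f g :: "real \<Rightarrow> real"
    using that by (auto simp: power_add[symmetric])
qed (use assms in \<open>auto simp: hausdorff_representing_iff finite_measure_on_def intro!: continuous_intros\<close>)

text \<open>For t > s, t^n times the mass of [t, \<infinity>) is at most a_n <= s^n, so this mass is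
  at most (s/t)^n for all n and vanishes. Countably many such t exhaust everything beyond s.\<close>

lemma hausdorff_representing_shrink:
  assumes \<mu>: "hausdorff_representing b a \<mu>" and s: "s > 0" "\<And>n. a n \<le> s ^ n"
  shows "hausdorff_representing s a \<mu>"
proof -
  have on: "finite_measure_on {0..b} \<mu>" and a: "\<And>n. a n = (\<integral>x. x ^ n \<partial>\<mu>)"
    using \<mu> by (auto simp: hausdorff_representing_iff)
  interpret finite_measure \<mu> using on by (simp add: finite_measure_on_def)
  have sets: "sets \<mu> = sets borel" using on by (simp add: finite_measure_on_def)
  have null: "measure \<mu> {t..} = 0" if t: "t > s" for t
  proof -
    have le: "measure \<mu> {t..} \<le> (s / t) ^ n" for n
    proof -
      have "t ^ n * measure \<mu> {t..} = (\<integral>x. t ^ n * indicator {t..} x \<partial>\<mu>)"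
        using sets_eq_imp_space_eq[OF sets] by simp
      also have "\<dots> \<le> (\<integral>x. x ^ n \<partial>\<mu>)"
      proof (rule integral_mono_AE)
        show "integrable \<mu> (\<lambda>x. t ^ n * indicator {t..} x)"
          using sets by (intro integrable_mult_right integrable_real_indicator) (auto simp: less_top[symmetric])
        have "AE x in \<mu>. x \<in> {0..b}" by (rule finite_measure_on_AE[OF on]) simp
        then show "AE x in \<mu>. t ^ n * indicator {t..} x \<le> x ^ n"
          by eventually_elim (use t s in \<open>auto split: split_indicator intro: power_mono\<close>)
      qed (rule finite_measure_on_pow[OF on])
      also have "\<dots> \<le> s ^ n" using s(2)[of n] a by simp
      finally show ?thesis using t s by (simp add: field_simps)
    qed
    have "(\<lambda>n. (s / t) ^ n) \<longlonglongrightarrow> 0"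
      using t s by (intro LIMSEQ_realpow_zero) auto
    then have "measure \<mu> {t..} \<le> 0"
      by (rule LIMSEQ_le_const) (use le in auto)
    then show ?thesis by (simp add: measure_le_0_iff)
  qed
  have "emeasure \<mu> (\<Union>n. {s + 1 / real (Suc n)..}) = 0"
    using null sets by (intro emeasure_UN_eq_0) (auto simp: emeasure_eq_measure)
  moreover have "(\<Union>n. {s + 1 / real (Suc n)..}) = {s<..}"
  proof (intro equalityI subsetI)
    fix x assume "x \<in> {s<..}"
    then obtain n where "inverse (real (Suc n)) < x - s" using reals_Archimedean[of "x - s"] by auto
    then show "x \<in> (\<Union>n. {s + 1 / real (Suc n)..})" by (auto simp: inverse_eq_divide intro!: exI[of _ n])
  next
    fix x assume "x \<in> (\<Union>n. {s + 1 / real (Suc n)..})"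
    then obtain n where "s + 1 / real (Suc n) \<le> x" by auto
    moreover have "1 / real (Suc n) > 0" by simp
    ultimately have "s < x" by linarith
    then show "x \<in> {s<..}" by simp
  qed
  ultimately have "{s<..} \<in> null_sets \<mu>" using sets by auto
  moreover have "- {0..b} \<in> null_sets \<mu>" using on by (auto simp: finite_measure_on_def)
  ultimately have "{s<..} \<union> - {0..b} \<in> null_sets \<mu>" by auto
  then have "- {0..s} \<in> null_sets \<mu>" by (rule null_sets_subset) (use sets in auto)
  then show ?thesis using on a by (auto simp: hausdorff_representing_iff finite_measure_on_def)
qed


section \<open>Representing measures and their moments\<close>

lemma l2_norm_finite_support:
  assumes "finite A" "A \<subseteq> V" "\<And>v. v \<notin> A \<Longrightarrow> f v = 0"
  shows "(l2_norm V f)\<^sup>2 = (\<Sum>v\<in>A. (cmod (f v))\<^sup>2)"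
proof -
  have "(\<Sum>\<^sub>\<infinity>v\<in>V. (cmod (f v))\<^sup>2) = (\<Sum>\<^sub>\<infinity>v\<in>A. (cmod (f v))\<^sup>2)"
    using assms by (intro infsum_cong_neutral) auto
  then show ?thesis using assms(1) by (simp add: l2_norm_def sum_nonneg)
qed

lemma shift_moment_eq:
  "shift_moment c \<beta> = moment_seq c (msize \<beta>) * (\<integral>z. (cmod (mmonom z \<beta>))\<^sup>2 \<partial>sphere_measure)"
  by (simp add: shift_moment_def integral_sphere_mmonom)

lemma msize_add: "msize (\<lambda>j. \<alpha> j + \<beta> j) = msize \<alpha> + msize \<beta>"
  by (simp add: msize_def sum.distrib)

lemma sphere_measure_on: "finite_measure_on (sphere 0 1) (sphere_measure :: 'n::euclidean_space measure)"
  unfolding finite_measure_on_def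
proof (intro conjI)
  show "finite_measure (sphere_measure :: 'n measure)"
    using prob_space_sphere_measure by (rule prob_space.axioms(1))
  show "sets (sphere_measure :: 'n measure) = sets borel" by (simp add: sphere_measure_def)
qed (rule emeasure_sphere_measure_Compl_sphere)

text \<open>The density is nonnegative only on K, as with odd powers of s on \<open>{0..b}\<close>.
  Off K \<open>ennreal\<close> truncates negative values to 0, which changes nothing because K
  carries M.\<close>

lemma finite_measure_on_density:
  fixes f :: "'a::topological_space \<Rightarrow> real"
  assumes M: "finite_measure_on K M" "K \<in> sets borel"
    and f: "f \<in> borel_measurable borel" "\<And>x. x \<in> K \<Longrightarrow> 0 \<le> f x" "(\<integral>x. f x \<partial>M) = 1" 
  shows "prob_space (density M (\<lambda>x. ennreal (f x)))" "finite_measure_on K (density M (\<lambda>x. ennreal (f x)))"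
    "\<And>g :: 'a \<Rightarrow> real. g \<in> borel_measurable borel \<Longrightarrow> (\<integral>x. g x \<partial>density M (\<lambda>x. ennreal (f x))) = (\<integral>x. f x * g x \<partial>M)"
proof -
  note [measurable] = finite_measure_on_measurable[OF M(1) f(1)]
  have ae: "AE x in M. 0 \<le> f x" using finite_measure_on_AE[OF M] by eventually_elim (rule f)
  \<comment> \<open>A non-integrable function has integral 0 by convention, so the value 1 forces
    integrability.\<close>
  have "integrable M f" using f(3) not_integrable_integral_eq by fastforce
  then have nn: "(\<integral>\<^sup>+x. ennreal (f x) \<partial>M) = 1"
    using nn_integral_eq_integral[OF _ ae] f(3) by simp
  show p: "prob_space (density M (\<lambda>x. ennreal (f x)))"
    by (rule prob_spaceI) (simp add: emeasure_density nn cong: nn_integral_cong)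
  have "- K \<in> null_sets M" using M by (auto simp: finite_measure_on_def)
  then have "AE x in M. x \<in> - K \<longrightarrow> ennreal (f x) = 0"
    using finite_measure_on_AE[OF M] by eventually_elim simp
  then have "- K \<in> null_sets (density M (\<lambda>x. ennreal (f x)))"
    using \<open>- K \<in> null_sets M\<close> by (auto simp: null_sets_density_iff elim: AE_mp)
  then show "finite_measure_on K (density M (\<lambda>x. ennreal (f x)))"
    using M p by (auto simp: finite_measure_on_def null_sets_def intro: prob_space.axioms(1))
  show "(\<integral>x. g x \<partial>density M (\<lambda>x. ennreal (f x))) = (\<integral>x. f x * g x \<partial>M)" if "g \<in> borel_measurable borel" for g
    by (subst integral_density) (use ae in \<open>auto intro!: finite_measure_on_measurable[OF M(1)] that\<close>)
qed

text \<open>The values of a set function determine \<open>measure_of\<close>. Agreement with a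
  genuine measure N makes countable additivity automatic.\<close>

lemma quadratic_measure_eqI:
  fixes N :: "'p::topological_space measure"
  assumes N: "sets N = sets borel"
    and eq: "\<And>A. A \<in> sets borel \<Longrightarrow> ennreal (Re (l2_inner V (R A f) f)) = emeasure N A"
  shows "quadratic_measure V R f = N"
proof -
  have "quadratic_measure V R f = measure_of UNIV (sets borel) (emeasure N)"
    unfolding quadratic_measure_def
  proof (rule measure_of_eq)
    have "sigma_sets UNIV (sets borel) = sets (borel :: 'p measure)"
      using sets.sigma_sets_eq[of borel] by simp
    then show "ennreal (Re (l2_inner V (R A f) f)) = emeasure N A" if "A \<in> sigma_sets UNIV (sets borel)" for A
      using that eq by simp
  qed simp
  also have "\<dots> = N"
    using measure_of_of_measure[of N] N sets_eq_imp_space_eq[OF N] by simp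
  finally show ?thesis .
qed

lemma set_integral_box:
  fixes \<nu> :: "(complex ^ 'd::finite) measure"
  assumes \<rho>: "finite_measure_on {0..b} \<rho>" and \<nu>: "finite_measure_on (sphere 0 1) \<nu>" and k: "k \<ge> 0"
  shows "(LINT p:{0..b} \<times> sphere 0 1|density (\<rho> \<Otimes>\<^sub>M \<nu>) (\<lambda>_. ennreal k). box_integrand m \<alpha> p) =
    k * ((\<integral>s. s ^ m \<partial>\<rho>) * (\<integral>z. (cmod (mmonom z \<alpha>))\<^sup>2 \<partial>\<nu>))"
proof -
  let ?P = "\<rho> \<Otimes>\<^sub>M \<nu>"
  have on: "finite_measure_on ({0..b} \<times> sphere 0 1) ?P"
    by (rule finite_measure_on_pair[OF \<rho> _ \<nu>]) auto
  have sets: "sets ?P = sets borel"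
    using on by (simp add: finite_measure_on_def)
  have box: "{0..b} \<times> sphere (0 :: complex ^ 'd) 1 \<in> sets borel"
    by (intro borel_closed closed_Times) auto
  have meas: "(\<lambda>p. ennreal (box_integrand m \<alpha> p) * indicator ({0..b} \<times> sphere 0 1) p) \<in> borel_measurable ?P"
    using borel_measurable_box_integrand[of m \<alpha>] box
    by (subst measurable_cong_sets[OF sets refl])
      (intro borel_measurable_times_ennreal borel_measurable_indicator measurable_compose[OF _ measurable_ennreal])
  have "(\<integral>\<^sup>+p\<in>{0..b} \<times> sphere 0 1. ennreal (box_integrand m \<alpha> p) \<partial>density ?P (\<lambda>_. ennreal k)) =
      ennreal k * (\<integral>\<^sup>+p\<in>{0..b} \<times> sphere 0 1. ennreal (box_integrand m \<alpha> p) \<partial>?P)"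
    using meas by (simp add: nn_integral_density nn_integral_cmult)
  also have "\<dots> = ennreal (k * ((\<integral>s. s ^ m \<partial>\<rho>) * (\<integral>z. (cmod (mmonom z \<alpha>))\<^sup>2 \<partial>\<nu>)))"
    unfolding set_nn_integral_box[OF \<rho> \<nu>] using k by (simp add: ennreal_mult')
  finally show ?thesis
    using set_integral_box_eq_nn[of "density ?P (\<lambda>_. ennreal k)" b m \<alpha>] sets k finite_measure_on_pow(4)[OF \<rho>]
    by (simp add: mult_nonneg_nonneg)
qed

text \<open>Only the products \<open>r m * n \<alpha>\<close> with \<open>m = \<bar>\<alpha>\<bar>\<close> are given. Summing over the neighbours of \<open>\<alpha>\<close>
  yields the recursion \<open>r (k + 1) = c (\<bar>\<beta>\<bar> + k) * r k\<close>, hence the remaining products.\<close>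

lemma pair_moments_determined:
  fixes r :: "nat \<Rightarrow> real" and n :: "('d::finite \<Rightarrow> nat) \<Rightarrow> real" and \<beta> :: "'d \<Rightarrow> nat"
  assumes c: "\<And>k. c k > 0"
    and eq: "\<And>\<alpha>. r (msize \<alpha>) * n \<alpha> = shift_moment c (\<lambda>j. \<beta> j + \<alpha> j) / shift_moment c \<beta>"
    and step: "\<And>\<alpha>. (\<Sum>j\<in>UNIV. n (\<alpha>(j := Suc (\<alpha> j)))) = n \<alpha>"
  shows "r m * n \<alpha> = moment_seq c (msize \<beta> + m) / moment_seq c (msize \<beta> + msize \<alpha>) *
    (shift_moment c (\<lambda>j. \<beta> j + \<alpha> j) / shift_moment c \<beta>)"
proof -
  have pos: "r (msize \<alpha>) * n \<alpha> > 0" for \<alpha>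
    unfolding eq using shift_moment_pos[of c] c by (metis divide_pos_pos)
  have r_Suc: "r (Suc k) = c (msize \<beta> + k) * r k" for k
  proof -
    obtain j0 :: 'd where True by simp
    \<comment> \<open>A multi-index of size k, concentrated in one arbitrary direction. Its factor
      \<open>n \<gamma>\<close> is nonzero by \<open>pos\<close> and is cancelled at the
      end.\<close>
    define \<gamma> :: "'d \<Rightarrow> nat" where "\<gamma> = (\<lambda>j. if j = j0 then k else 0)"
    have k: "msize \<gamma> = k" by (simp add: msize_def \<gamma>_def)
    have "r (Suc k) * n \<gamma> = (\<Sum>j\<in>UNIV. r (Suc k) * n (\<gamma>(j := Suc (\<gamma> j))))"
      by (simp add: step[of \<gamma>, symmetric] sum_distrib_left)
    also have "\<dots> = (\<Sum>j\<in>UNIV. shift_factor c j (\<lambda>j. \<beta> j + \<gamma> j) * (shift_moment c (\<lambda>j. \<beta> j + \<gamma> j) / shift_moment c \<beta>))"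
    proof (rule sum.cong[OF refl])
      fix j
      have "(\<lambda>i. \<beta> i + (\<gamma>(j := Suc (\<gamma> j))) i) = (\<lambda>i. \<beta> i + \<gamma> i)(j := Suc (\<beta> j + \<gamma> j))" by auto
      then show "r (Suc k) * n (\<gamma>(j := Suc (\<gamma> j))) = shift_factor c j (\<lambda>j. \<beta> j + \<gamma> j) * (shift_moment c (\<lambda>j. \<beta> j + \<gamma> j) / shift_moment c \<beta>)"
        using eq[of "\<gamma>(j := Suc (\<gamma> j))"] shift_moment_upd_Suc[of c "\<lambda>i. \<beta> i + \<gamma> i" j]
        by (simp add: msize_upd_Suc k)
    qed
    also have "\<dots> = c (msize \<beta> + k) * (r k * n \<gamma>)"
      by (simp only: sum_distrib_right[symmetric] sum_shift_factor msize_add k eq[of \<gamma>, unfolded k])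
    finally show ?thesis using pos[of \<gamma>] by auto
  qed
  \<comment> \<open>Both sides are compared through \<open>r 0\<close>; the cross-multiplied form
    leaves only the positive factor \<open>moment_seq c (msize \<beta>)\<close> to cancel.\<close>
  have r: "r m * moment_seq c (msize \<beta> + k) = r k * moment_seq c (msize \<beta> + m)" for k m
  proof -
    have "r k * moment_seq c (msize \<beta>) = r 0 * moment_seq c (msize \<beta> + k)" for k
      by (induction k) (simp_all add: r_Suc moment_seq_Suc)
    note r0 = this
    have "(r m * moment_seq c (msize \<beta> + k)) * moment_seq c (msize \<beta>) = (r m * moment_seq c (msize \<beta>)) * moment_seq c (msize \<beta> + k)"
      by (simp only: mult_ac)
    also have "\<dots> = (r k * moment_seq c (msize \<beta>)) * moment_seq c (msize \<beta> + m)"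
      unfolding r0 by (simp only: mult_ac)
    also have "\<dots> = (r k * moment_seq c (msize \<beta> + m)) * moment_seq c (msize \<beta>)"
      by (simp only: mult_ac)
    finally show ?thesis using moment_seq_pos[of c "msize \<beta>"] c by simp
  qed
  have "moment_seq c (msize \<beta> + msize \<alpha>) \<noteq> 0"
    using moment_seq_pos[of c "msize \<beta> + msize \<alpha>"] c by simp
  then have "r m = moment_seq c (msize \<beta> + m) / moment_seq c (msize \<beta> + msize \<alpha>) * r (msize \<alpha>)"
    using r[of m "msize \<alpha>"] by (simp add: field_simps)
  then show ?thesis unfolding eq[symmetric] by (simp add: mult.assoc)
qed

section \<open>The joint cokernel and the norms of monomials\<close>

locale tree_multishift = product_tree T for T :: "'d::finite \<Rightarrow> 'a pair_pre_digraph" +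
  fixes c :: "nat \<Rightarrow> real" and \<Omega> :: "'d set \<Rightarrow> ('d \<Rightarrow> 'a) set"
  assumes branching: "finite_joint_branching_index T"
    and c_pos: "\<And>n. c n > 0" and c_bdd: "bdd_above (range c)"
    and transversal: "\<And>F. sib_transversal T F (\<Omega> F)"
begin

abbreviation "E \<equiv> joint_cokernel T c"
abbreviation "b \<equiv> SUP n. c n"

lemma c_le: "c n \<le> b" by (rule cSUP_upper[OF UNIV_I c_bdd])

lemma b_pos: "b > 0" using c_le[of 0] c_pos[of 0] by linarith

lemma moment_seq_le: "moment_seq c n \<le> b ^ n"
proof -
  have "moment_seq c n \<le> (\<Prod>j<n. b)"
    unfolding moment_seq_def by (rule prod_mono) (use c_le c_pos in \<open>auto intro: less_imp_le\<close>)
  then show ?thesis by simp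
qed

text \<open>The common support of E. Sums over V that involve members of E collapse to it, and the
  finite joint branching index makes it finite.\<close>

definition supp :: "('d \<Rightarrow> 'a) set" where "supp = {v. \<exists>f\<in>E. f v \<noteq> 0}"

lemma supp: "finite supp" "supp \<subseteq> V" "f \<in> E \<Longrightarrow> v \<notin> supp \<Longrightarrow> f v = 0"
proof -
  obtain W where W: "finite W" "W \<subseteq> V" "\<And>f v. f \<in> E \<Longrightarrow> v \<notin> W \<Longrightarrow> f v = 0"
    using joint_cokernel_finite_support[OF c_pos c_bdd branching] by blast
  then have "supp \<subseteq> W" by (auto simp: supp_def)
  then show "finite supp" "supp \<subseteq> V" using W finite_subset by auto
qed (auto simp: supp_def)

lemma infsum_supp:
  fixes F :: "('d \<Rightarrow> 'a) \<Rightarrow> 'b::{comm_monoid_add, t2_space}"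
  assumes "\<And>v. v \<notin> supp \<Longrightarrow> F v = 0"
  shows "(\<Sum>\<^sub>\<infinity>v\<in>V. F v) = (\<Sum>v\<in>supp. F v)"
proof -
  have "(\<Sum>\<^sub>\<infinity>v\<in>V. F v) = (\<Sum>\<^sub>\<infinity>v\<in>supp. F v)"
    using supp assms by (intro infsum_cong_neutral) auto
  then show ?thesis using supp(1) by simp
qed

lemma E_scale:
  assumes f: "f \<in> E" and k: "\<And>v w. prod_depth T v = prod_depth T w \<Longrightarrow> k v = k w"
  shows "(\<lambda>v. k v * f v) \<in> E"
  unfolding joint_cokernel_iff[OF c_pos c_bdd]
proof (intro conjI allI ballI)
  show "(\<lambda>v. k v * f v) \<in> l2 V"
    by (rule l2_finite_support[OF supp(1,2)]) (simp add: supp(3)[OF f])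
  fix j v assume v: "v \<in> V"
  obtain w0 where w0: "w0 \<in> prod_chi T j v" using prod_chi_nonempty[OF v] by blast
  have "(\<Sum>w\<in>prod_chi T j v. of_real (weight T c j w) * (k w * f w)) =
      (\<Sum>w\<in>prod_chi T j v. k w0 * (of_real (weight T c j w) * f w))"
  proof (rule sum.cong[OF refl])
    fix w assume "w \<in> prod_chi T j v"
    then have "k w = k w0" using w0 by (intro k) (simp add: prod_depth_chi)
    then show "of_real (weight T c j w) * (k w * f w) = k w0 * (of_real (weight T c j w) * f w)" by simp
  qed
  also have "\<dots> = 0"
    unfolding sum_distrib_left[symmetric] using f v joint_cokernel_iff[OF c_pos c_bdd] by simp
  finally show "(\<Sum>w\<in>prod_chi T j v. of_real (weight T c j w) * (k w * f w)) = 0" .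
qed

lemma l2_norm_multi_power:
  assumes "\<And>v. v \<notin> supp \<Longrightarrow> f v = 0"
  shows "(l2_norm V (multi_power (multishift T c) \<alpha> f))\<^sup>2 =
    (\<Sum>v\<in>supp. (cmod (f v))\<^sup>2 * (shift_moment c (\<lambda>j. prod_depth T v j + \<alpha> j) / shift_moment c (prod_depth T v)))"
    (is "_ = ?s")
proof -
  have "((\<lambda>v. (cmod (f v))\<^sup>2 * (shift_moment c (\<lambda>j. prod_depth T v j + \<alpha> j) / shift_moment c (prod_depth T v))) has_sum ?s) V"
    using has_sum_finite[OF supp(1)]
    by (rule has_sum_cong_neutral[THEN iffD1, rotated 3]) (use assms supp(2) in auto)
  moreover have pos: "shift_moment c \<beta> > 0" for \<beta> :: "'d \<Rightarrow> nat" by (rule shift_moment_pos[of c, OF c_pos])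
  \<comment> \<open>With \<open>g = shift_moment c\<close> the weight after applying the power is
    Q/Q = 1, so the sum becomes the plain squared norm.\<close>
  ultimately have "((\<lambda>w. (cmod (multi_power (multishift T c) \<alpha> f w))\<^sup>2 * (shift_moment c (prod_depth T w) / shift_moment c (prod_depth T w))) has_sum ?s) V"
    by (intro multi_power_normalized_sum[OF c_pos]) (auto intro: less_imp_le)
  moreover have "shift_moment c \<beta> / shift_moment c \<beta> = 1" for \<beta> :: "'d \<Rightarrow> nat" using pos[of \<beta>] by simp
  ultimately have "(\<Sum>\<^sub>\<infinity>w\<in>V. (cmod (multi_power (multishift T c) \<alpha> f w))\<^sup>2) = ?s"
    by (simp add: infsumI)
  moreover have "(\<Sum>\<^sub>\<infinity>w\<in>V. (cmod (multi_power (multishift T c) \<alpha> f w))\<^sup>2) \<ge> 0"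
    by (rule infsum_nonneg) simp
  ultimately show ?thesis by (simp only: l2_norm_def real_sqrt_pow2)
qed

lemma model_norm_monomial:
  assumes f: "f \<in> E"
  shows "(model_norm T c (multi_power coord_mult \<alpha> (const_series f)))\<^sup>2 =
    (\<Sum>v\<in>supp. (cmod (f v))\<^sup>2 * (shift_moment c (\<lambda>j. prod_depth T v j + \<alpha> j) / shift_moment c (prod_depth T v)))"
proof -
  let ?N = "\<lambda>\<beta> f. (l2_norm V (multi_power (multishift T c) \<beta> f))\<^sup>2"
  have "(\<Sum>\<^sub>\<infinity>\<beta>. ?N \<beta> (if \<beta> = \<alpha> then f else (\<lambda>_. 0))) \<ge> 0"
    by (rule infsum_nonneg) simp
  then have "(model_norm T c (multi_power coord_mult \<alpha> (const_series f)))\<^sup>2 =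
      (\<Sum>\<^sub>\<infinity>\<beta>. ?N \<beta> (if \<beta> = \<alpha> then f else (\<lambda>_. 0)))"
    unfolding model_norm_def multi_power_coord_mult by (rule real_sqrt_pow2)
  also have "\<dots> = (\<Sum>\<^sub>\<infinity>\<beta>\<in>{\<alpha>}. ?N \<beta> f)"
    by (rule infsum_cong_neutral) (auto simp: l2_norm_multi_power)
  finally show ?thesis by (simp add: l2_norm_multi_power supp(3)[OF f])
qed

section \<open>The spaces L_{u,F} inside the joint cokernel\<close>

lemma Lspace_zero: "(\<lambda>_. 0) \<in> Lspace T c F u"
  by (simp add: Lspace_def l2_def)

lemma Lspace_outside:
  assumes "f \<in> Lspace T c F u" "v \<notin> sib_on T F u" shows "f v = 0"
proof -
  have "f \<in> l2 (sib_on T F u)" using assms(1) by (simp add: Lspace_def)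
  then show ?thesis using assms(2) by (simp add: l2_def)
qed

text \<open>A sibling is a child of the same parent and hence equally deep. The representative u can
  therefore stand for every vertex at which f is nonzero, in any formula that depends on depth
  alone.\<close>

lemma Lspace_depth:
  assumes u: "u \<in> Phi T F" and f: "f \<in> Lspace T c F u" and v: "f v \<noteq> 0"
  shows "v \<in> sib_on T F u" "prod_depth T v = prod_depth T u"
proof -
  show "v \<in> sib_on T F u" using Lspace_outside[OF f] v by blast
  then have s: "v j \<in> sib (T j) (u j)" if "j \<in> F" for j using that by (simp add: sib_on_def)
  have e: "v j = u j" if "j \<notin> F" for j using \<open>v \<in> sib_on T F u\<close> that by (simp add: sib_on_def)
  show "prod_depth T v = prod_depth T u"
  proof
    fix j
    show "prod_depth T v j = prod_depth T u j"
    proof (cases "j \<in> F")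
      case True
      then have "u j \<in> chi (T j) (par (T j) (u j))"
        using u par_arc[OF tree, of "u j" j] by (simp add: Phi_def V_iff chi_def)
      then show ?thesis
        using s[OF True] depth_chi[OF tree] by (simp add: prod_depth_def sib_def)
    qed (simp add: prod_depth_def e)
  qed
qed

text \<open>The cokernel equation at (j, v) is trivial unless some child w of v carries a nonzero
  value of f. Then w lies in sib_F(u), which forces j into F and makes v_j the parent of u_j, and
  the equation is one of those defining \<open>Lspace\<close>.\<close>

lemma Lspace_subset:
  assumes u: "u \<in> Phi T F" and f: "f \<in> Lspace T c F u"
  shows "f \<in> E"
  unfolding joint_cokernel_iff[OF c_pos c_bdd]
proof (intro conjI allI ballI)
  have f0: "f v = 0" if "v \<notin> sib_on T F u" for v using Lspace_outside[OF f that] .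
  have "sib_on T F u \<subseteq> V" by (auto simp: sib_on_def)
  then have "(\<lambda>v. (cmod (f v))\<^sup>2) summable_on V \<longleftrightarrow> (\<lambda>v. (cmod (f v))\<^sup>2) summable_on sib_on T F u"
    using f0 by (intro summable_on_cong_neutral) auto
  moreover have "(\<lambda>v. (cmod (f v))\<^sup>2) summable_on sib_on T F u"
    using f by (simp add: Lspace_def l2_def)
  ultimately show "f \<in> l2 V"
    using f0 \<open>sib_on T F u \<subseteq> V\<close> by (auto simp: l2_def)
  fix j v assume v: "v \<in> V"
  show "(\<Sum>w\<in>prod_chi T j v. of_real (weight T c j w) * f w) = 0"
  proof (cases "\<exists>w\<in>prod_chi T j v. f w \<noteq> 0")
    case True
    then obtain w where w: "w \<in> prod_chi T j v" "f w \<noteq> 0" by blast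
    then have ws: "w \<in> sib_on T F u" using f0 by blast
    have wj: "w j \<in> chi (T j) (v j)" and wi: "\<And>i. i \<noteq> j \<Longrightarrow> w i = v i" using w(1) by (auto simp: prod_chi_def)
    have j: "j \<in> F"
    proof (rule ccontr)
      assume "j \<notin> F"
      then have "w j = root (T j)" using ws u by (simp add: sib_on_def Phi_def)
      then show False using chi_par(2)[OF tree wj] by simp
    qed
    have "w j \<in> sib (T j) (u j)" using ws j by (simp add: sib_on_def)
    then have par: "par (T j) (u j) = v j"
      using chi_par(1)[OF tree wj] chi_par(1)[OF tree] by (simp add: sib_def)
    \<comment> \<open>Off direction j this vertex agrees with v: coordinates in F are kept, and
      those outside F are roots in w already. Replacing its j-th coordinate by \<open>u j\<close>
      gives a child of v, whose siblings are all the children of v.\<close>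
    define x where "x = restrict_to T (F - {j}) w"
    have x: "x \<in> sib_on_restrict T F (F - {j}) u" using ws by (auto simp: x_def sib_on_restrict_def)
    have xi: "x i = v i" if "i \<noteq> j" for i
      using that wi[OF that] ws u by (auto simp: x_def restrict_to_def sib_on_def Phi_def)
    have "prod_sib T j (x(j := u j)) = prod_chi T j v"
      by (auto simp: prod_sib_def prod_chi_def xi sib_def par)
    moreover have "(\<Sum>w\<in>prod_sib T j (x(j := u j)). f w * of_real (weight T c j w)) = 0"
      using f j x by (simp add: Lspace_def)
    ultimately show ?thesis by (simp add: mult.commute)
  qed (auto intro: sum.neutral)
qed

lemma \<Omega>_Phi: "u \<in> \<Omega> F \<Longrightarrow> u \<in> Phi T F"
  using transversal by (auto simp: sib_transversal_def)

text \<open>For F = {} the sibling class of the root is a singleton, so every choice of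
  representatives contains the root itself.\<close>

lemma prod_root: "prod_root T \<in> \<Omega> {}" "prod_depth T (prod_root T) = (\<lambda>_. 0)" "basis_vec (prod_root T) \<in> Lspace T c {} (prod_root T)"
proof -
  have r: "prod_root T \<in> V" using root_in(1)[OF tree] by (simp add: V_iff prod_root_def)
  have s: "sib_on T {} (prod_root T) = {prod_root T}"
    using r by (auto simp: sib_on_def)
  have "prod_root T \<in> Phi T {}" using r by (auto simp: Phi_def prod_root_def)
  then have "\<exists>!x. x \<in> \<Omega> {} \<and> x \<in> sib_on T {} (prod_root T)"
    using transversal[of "{}"] unfolding sib_transversal_def by blast
  then show "prod_root T \<in> \<Omega> {}" unfolding s by auto
  show "prod_depth T (prod_root T) = (\<lambda>_. 0)"
    using depth_eqI[OF tree, of _ _ 0] by (auto simp: prod_depth_def prod_root_def)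
  show "basis_vec (prod_root T) \<in> Lspace T c {} (prod_root T)"
    by (simp add: Lspace_def s basis_vec_in_l2)
qed

section \<open>What a representing measure determines\<close>

lemma representing_measureD:
  assumes rep: "representing_measure T c \<Omega> b R \<rho> \<nu>" and u: "u \<in> \<Omega> F"
  shows "finite_measure_on {0..b} (\<rho> u)" "finite_measure_on (sphere 0 1) (\<nu> u)"
  using rep u by (auto simp: representing_measure_def finite_measure_on_def)

text \<open>Condition (2) is applied to the family whose only nonzero member is f, in position (F,
  u); both sums then have a single term.\<close>

lemma representing_measure_Lspace:
  assumes rep: "representing_measure T c \<Omega> b R \<rho> \<nu>" and u: "u \<in> \<Omega> F" and f: "f \<in> Lspace T c F u"
    and A: "A \<in> sets borel"
  shows "R A f = (\<lambda>v. of_real (measure (\<rho> u \<Otimes>\<^sub>M \<nu> u) A) * f v)"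
proof -
  define g where "g F' u' = (if F' = F \<and> u' = u then f else (\<lambda>_. 0))" for F' u'
  have "\<forall>F. \<forall>u\<in>\<Omega> F. g F u \<in> Lspace T c F u"
    using f by (auto simp: g_def Lspace_zero)
  then have eq: "R A (\<lambda>v. \<Sum>F\<in>UNIV. \<Sum>\<^sub>\<infinity>u\<in>\<Omega> F. g F u v) =
           (\<lambda>v. \<Sum>F\<in>UNIV. \<Sum>\<^sub>\<infinity>u\<in>\<Omega> F. of_real (measure (\<rho> u \<Otimes>\<^sub>M \<nu> u) A) * g F u v)"
    using rep A unfolding representing_measure_def by blast
  have "(\<Sum>F'\<in>UNIV. \<Sum>\<^sub>\<infinity>u'\<in>\<Omega> F'. k u' * g F' u' v) = k u * f v" for k :: "_ \<Rightarrow> complex" and v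
  proof -
    have "(\<Sum>\<^sub>\<infinity>u'\<in>\<Omega> F'. k u' * g F' u' v) = (if F' = F then k u * f v else 0)" for F'
    proof (cases "F' = F")
      case True
      have "(\<Sum>\<^sub>\<infinity>u'\<in>\<Omega> F. k u' * g F u' v) = (\<Sum>\<^sub>\<infinity>u'\<in>{u}. k u' * g F u' v)"
        using u by (intro infsum_cong_neutral) (auto simp: g_def)
      then show ?thesis using True by (simp add: g_def)
    qed (simp add: g_def)
    then show ?thesis by simp
  qed
  from this[of "\<lambda>_. 1"] this[of "\<lambda>u. of_real (measure (\<rho> u \<Otimes>\<^sub>M \<nu> u) A)"] show ?thesis
    using eq by simp
qed

text \<open>On L_{u,F} the operators act as scalars, so the quadratic measure of a nonzero f is k
  times \<open>\<rho> u \<Otimes>\<^sub>M \<nu> u\<close> with k the squared norm of f. Division of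
  condition (1) by k gives the products with m = |alpha|, from which the recursion yields all
  others.\<close>

lemma representing_measure_moments:
  assumes rep: "representing_measure T c \<Omega> b R \<rho> \<nu>" and u: "u \<in> \<Omega> F" and ne: "Lspace T c F u \<noteq> {\<lambda>_. 0}"
  shows "(\<integral>s. s ^ m \<partial>\<rho> u) * (\<integral>z. (cmod (mmonom z \<alpha>))\<^sup>2 \<partial>\<nu> u) =
    moment_seq c (msize (prod_depth T u) + m) / moment_seq c (msize (prod_depth T u) + msize \<alpha>) *
    (shift_moment c (\<lambda>j. prod_depth T u j + \<alpha> j) / shift_moment c (prod_depth T u))"
proof (rule pair_moments_determined[where r = "\<lambda>m. \<integral>s. s ^ m \<partial>\<rho> u" and n = "\<lambda>\<alpha>. \<integral>z. (cmod (mmonom z \<alpha>))\<^sup>2 \<partial>\<nu> u", OF c_pos])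
  note on = representing_measureD[OF rep u]
  show "(\<Sum>j\<in>UNIV. \<integral>z. (cmod (mmonom z (\<alpha>(j := Suc (\<alpha> j)))))\<^sup>2 \<partial>\<nu> u) = (\<integral>z. (cmod (mmonom z \<alpha>))\<^sup>2 \<partial>\<nu> u)" for \<alpha>
    by (rule sum_integral_mmonom_upd_Suc[OF on(2)])
  fix \<alpha>
  obtain f where f: "f \<in> Lspace T c F u" "f \<noteq> (\<lambda>_. 0)" using ne Lspace_zero by blast
  then obtain v0 where v0: "f v0 \<noteq> 0" by auto
  have fE: "f \<in> E" using Lspace_subset[OF \<Omega>_Phi[OF u] f(1)] .
  define k where "k = (\<Sum>v\<in>supp. (cmod (f v))\<^sup>2)"
  have "v0 \<in> supp" using v0 fE by (auto simp: supp_def)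
  then have k: "k > 0" unfolding k_def using v0 supp(1) by (intro sum_pos2[of _ v0]) auto
  let ?P = "\<rho> u \<Otimes>\<^sub>M \<nu> u"
  have P: "finite_measure_on ({0..b} \<times> sphere 0 1) ?P"
    by (rule finite_measure_on_pair[OF on(1) _ on(2)]) auto
  then interpret P: finite_measure ?P by (simp add: finite_measure_on_def)
  have sets: "sets ?P = sets borel" using P by (simp add: finite_measure_on_def)
  have "quadratic_measure V R f = density ?P (\<lambda>_. ennreal k)"
  proof (rule quadratic_measure_eqI)
    show "sets (density ?P (\<lambda>_. ennreal k)) = sets borel" using sets by simp
    fix A :: "(real \<times> (complex ^ 'd)) set" assume A: "A \<in> sets borel"
    have "l2_inner V (R A f) f = (\<Sum>v\<in>supp. of_real (measure ?P A) * f v * cnj (f v))"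
      unfolding l2_inner_def representing_measure_Lspace[OF rep u f(1) A]
      by (rule infsum_supp) (simp add: supp(3)[OF fE])
    also have "\<dots> = of_real (measure ?P A * k)"
      by (simp add: k_def sum_distrib_left mult.assoc complex_norm_square[symmetric])
    finally have "ennreal (Re (l2_inner V (R A f) f)) = ennreal (measure ?P A * k)" by simp
    also have "\<dots> = emeasure (density ?P (\<lambda>_. ennreal k)) A"
      using A sets k by (simp add: emeasure_density_const P.emeasure_eq_measure ennreal_mult' mult.commute)
    finally show "ennreal (Re (l2_inner V (R A f) f)) = emeasure (density ?P (\<lambda>_. ennreal k)) A" .
  qed
  then have "(model_norm T c (multi_power coord_mult \<alpha> (const_series f)))\<^sup>2 =
      k * ((\<integral>s. s ^ msize \<alpha> \<partial>\<rho> u) * (\<integral>z. (cmod (mmonom z \<alpha>))\<^sup>2 \<partial>\<nu> u))"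
    using rep fE set_integral_box[OF on less_imp_le[OF k], of "msize \<alpha>" \<alpha>]
    unfolding representing_measure_def by simp
  moreover have "(model_norm T c (multi_power coord_mult \<alpha> (const_series f)))\<^sup>2 =
      k * (shift_moment c (\<lambda>j. prod_depth T u j + \<alpha> j) / shift_moment c (prod_depth T u))"
    unfolding model_norm_monomial[OF fE] k_def sum_distrib_right
  proof (rule sum.cong[OF refl])
    fix v
    show "(cmod (f v))\<^sup>2 * (shift_moment c (\<lambda>j. prod_depth T v j + \<alpha> j) / shift_moment c (prod_depth T v)) =
        (cmod (f v))\<^sup>2 * (shift_moment c (\<lambda>j. prod_depth T u j + \<alpha> j) / shift_moment c (prod_depth T u))"
      using Lspace_depth(2)[OF \<Omega>_Phi[OF u] f(1), of v] by (cases "f v = 0") auto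
  qed
  ultimately have "k * ((\<integral>s. s ^ msize \<alpha> \<partial>\<rho> u) * (\<integral>z. (cmod (mmonom z \<alpha>))\<^sup>2 \<partial>\<nu> u)) =
      k * (shift_moment c (\<lambda>j. prod_depth T u j + \<alpha> j) / shift_moment c (prod_depth T u))"
    by (simp only:)
  then show "(\<integral>s. s ^ msize \<alpha> \<partial>\<rho> u) * (\<integral>z. (cmod (mmonom z \<alpha>))\<^sup>2 \<partial>\<nu> u) =
      shift_moment c (\<lambda>j. prod_depth T u j + \<alpha> j) / shift_moment c (prod_depth T u)"
    by (subst (asm) mult_left_cancel) (use k in auto)
qed

lemma representing_measure_modulus_unique:
  assumes rep: "representing_measure T c \<Omega> b R \<rho> \<nu>" "representing_measure T c \<Omega> b R' \<rho>' \<nu>'"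
    and u: "u \<in> \<Omega> F" and ne: "Lspace T c F u \<noteq> {\<lambda>_. 0}"
  shows "modulus_image (\<rho> u) (\<nu> u) = modulus_image (\<rho>' u) (\<nu>' u)"
  by (rule modulus_image_eqI[OF representing_measureD(1)[OF rep(1) u] representing_measureD(1)[OF rep(2) u]
        representing_measureD(2)[OF rep(1) u] representing_measureD(2)[OF rep(2) u]])
    (simp add: representing_measure_moments[OF rep(1) u ne] representing_measure_moments[OF rep(2) u ne])

text \<open>The zeroth moment of the probability measure at the root of \<open>\<nu>\<close> is 1,
  so exponent \<open>\<alpha>\<close> = 0 isolates the moments of \<open>\<rho>\<close>. The depth
  of the root is 0, so they are the numbers a_n themselves.\<close>

lemma representing_measure_root:
  assumes rep: "representing_measure T c \<Omega> b R \<rho> \<nu>"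
  shows "hausdorff_representing b (moment_seq c) (\<rho> (prod_root T))"
  unfolding hausdorff_representing_iff
proof (intro conjI allI)
  let ?r = "prod_root T"
  show "finite_measure_on {0..b} (\<rho> ?r)" by (rule representing_measureD(1)[OF rep prod_root(1)])
  have "basis_vec ?r \<noteq> (\<lambda>_. 0)" by (metis basis_vec_def one_neq_zero)
  then have ne: "Lspace T c {} ?r \<noteq> {\<lambda>_. 0}" using prod_root(3) by auto
  have "prob_space (\<nu> ?r)" using rep by (simp add: representing_measure_def)
  then have "(\<integral>z. (cmod (mmonom z (\<lambda>_. 0)))\<^sup>2 \<partial>\<nu> ?r) = 1"
    by (simp add: mmonom_def prob_space.prob_space)
  moreover have "shift_moment c (\<lambda>_ :: 'd. 0) > 0" by (rule shift_moment_pos[of c, OF c_pos])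
  ultimately show "moment_seq c n = (\<integral>s. s ^ n \<partial>\<rho> ?r)" for n
    using representing_measure_moments[OF rep prod_root(1) ne, of n "\<lambda>_. 0"]
    by (simp add: prod_root(2) msize_def moment_seq_def[of c 0])
qed

end


section \<open>The representing measure of a Hausdorff moment sequence\<close>

text \<open>Serves to integrate against a finite combination of measures, encoded as one density
  with respect to a common M.\<close>

lemma nn_integral_density_sum:
  assumes "finite I" and [measurable]: "\<And>i. i \<in> I \<Longrightarrow> h i \<in> borel_measurable M" "f \<in> borel_measurable M"
  shows "(\<integral>\<^sup>+x. f x \<partial>density M (\<lambda>x. \<Sum>i\<in>I. k i * h i x)) = (\<Sum>i\<in>I. k i * (\<integral>\<^sup>+x. f x \<partial>density M (h i)))"
proof -
  have "(\<integral>\<^sup>+x. f x \<partial>density M (\<lambda>x. \<Sum>i\<in>I. k i * h i x)) = (\<integral>\<^sup>+x. (\<Sum>i\<in>I. k i * (h i x * f x)) \<partial>M)"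
    by (subst nn_integral_density) (auto simp: sum_distrib_right mult.assoc)
  also have "\<dots> = (\<Sum>i\<in>I. \<integral>\<^sup>+x. k i * (h i x * f x) \<partial>M)"
    by (rule nn_integral_sum) simp
  also have "\<dots> = (\<Sum>i\<in>I. k i * (\<integral>\<^sup>+x. f x \<partial>density M (h i)))"
    by (intro sum.cong refl) (simp add: nn_integral_cmult nn_integral_density)
  finally show ?thesis .
qed

context tree_multishift
begin

context
  fixes \<mu> assumes \<mu>: "hausdorff_representing b (moment_seq c) \<mu>"
begin

section \<open>Total mass and moments of the formula measures\<close>

lemma \<mu>_on: "finite_measure_on {0..b} \<mu>" and \<mu>_moment: "(\<integral>s. s ^ n \<partial>\<mu>) = moment_seq c n"
  using \<mu> by (auto simp: hausdorff_representing_iff)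

lemma rho_formula_props:
  shows "prob_space (rho_formula T c \<mu> u)" "finite_measure_on {0..b} (rho_formula T c \<mu> u)"
    "(\<integral>s. s ^ m \<partial>rho_formula T c \<mu> u) = moment_seq c (msize (prod_depth T u) + m) / moment_seq c (msize (prod_depth T u))"
proof -
  define n where "n = msize (prod_depth T u)"
  have rho: "rho_formula T c \<mu> u = density \<mu> (\<lambda>s. ennreal (s ^ n / moment_seq c n))"
    by (simp add: rho_formula_def n_def Let_def)
  have pos: "moment_seq c n > 0" by (rule moment_seq_pos[OF c_pos])
  have I: "(\<integral>s. s ^ n / moment_seq c n \<partial>\<mu>) = 1" using pos by (simp add: \<mu>_moment)
  have nn: "0 \<le> s ^ n / moment_seq c n" if "s \<in> {0..b}" for s using that pos by simp
  note d = finite_measure_on_density[OF \<mu>_on _ _ nn I]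
  show "prob_space (rho_formula T c \<mu> u)" "finite_measure_on {0..b} (rho_formula T c \<mu> u)"
    unfolding rho by (rule d; simp)+
  have "(\<integral>s. s ^ m \<partial>rho_formula T c \<mu> u) = (\<integral>s. s ^ n / moment_seq c n * s ^ m \<partial>\<mu>)"
    unfolding rho by (rule d(3)) simp_all
  also have "\<dots> = moment_seq c (n + m) / moment_seq c n"
    by (simp add: \<mu>_moment power_add[symmetric])
  finally show "(\<integral>s. s ^ m \<partial>rho_formula T c \<mu> u) = moment_seq c (msize (prod_depth T u) + m) / moment_seq c (msize (prod_depth T u))"
    by (simp add: n_def)
qed

lemma nu_formula_props:
  shows "prob_space (nu_formula T u)" "finite_measure_on (sphere 0 1) (nu_formula T u)"
    "(\<integral>z. (cmod (mmonom z \<alpha>))\<^sup>2 \<partial>nu_formula T u) =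
      (\<integral>z. (cmod (mmonom z (\<lambda>j. prod_depth T u j + \<alpha> j)))\<^sup>2 \<partial>sphere_measure) /
      (\<integral>z. (cmod (mmonom z (prod_depth T u)))\<^sup>2 \<partial>sphere_measure)"
proof -
  define \<beta> where "\<beta> = prod_depth T u"
  define N where "N = (\<integral>z. (cmod (mmonom z \<beta>))\<^sup>2 \<partial>sphere_measure)"
  have nu: "nu_formula T u = density sphere_measure (\<lambda>z. ennreal ((cmod (mmonom z \<beta>))\<^sup>2 / N))"
    by (simp add: nu_formula_def \<beta>_def N_def)
  have pos: "N > 0" by (simp add: N_def integral_sphere_mmonom prod_pos)
  have I: "(\<integral>z. (cmod (mmonom z \<beta>))\<^sup>2 / N \<partial>sphere_measure) = 1" using pos by (simp add: N_def)
  have nn: "0 \<le> (cmod (mmonom z \<beta>))\<^sup>2 / N" for z using pos by simp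
  note d = finite_measure_on_density[OF sphere_measure_on _ _ nn I]
  show "prob_space (nu_formula T u)" "finite_measure_on (sphere 0 1) (nu_formula T u)"
    unfolding nu by (rule d; simp)+
  have "(\<integral>z. (cmod (mmonom z \<alpha>))\<^sup>2 \<partial>nu_formula T u) = (\<integral>z. (cmod (mmonom z \<beta>))\<^sup>2 / N * (cmod (mmonom z \<alpha>))\<^sup>2 \<partial>sphere_measure)"
    unfolding nu by (rule d(3)) simp_all
  also have "\<dots> = (\<integral>z. (cmod (mmonom z (\<lambda>j. \<beta> j + \<alpha> j)))\<^sup>2 \<partial>sphere_measure) / N"
    by (simp add: mmonom_add norm_mult power_mult_distrib)
  finally show "(\<integral>z. (cmod (mmonom z \<alpha>))\<^sup>2 \<partial>nu_formula T u) =
      (\<integral>z. (cmod (mmonom z (\<lambda>j. prod_depth T u j + \<alpha> j)))\<^sup>2 \<partial>sphere_measure) /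
      (\<integral>z. (cmod (mmonom z (prod_depth T u)))\<^sup>2 \<partial>sphere_measure)"
    by (simp add: \<beta>_def N_def)
qed

text \<open>Formed at every vertex, not only at the chosen representatives, so that an operator on E
  can be defined coordinate by coordinate.\<close>

definition vertex_measure :: "('d \<Rightarrow> 'a) \<Rightarrow> (real \<times> (complex ^ 'd)) measure" where
  "vertex_measure u = rho_formula T c \<mu> u \<Otimes>\<^sub>M nu_formula T u"

text \<open>Taken relative to \<open>\<mu> \<Otimes>\<^sub>M sphere_measure\<close>, the same for
  all vertices, so that sums of vertex measures become sums of densities.\<close>

definition vertex_density :: "('d \<Rightarrow> 'a) \<Rightarrow> real \<times> (complex ^ 'd) \<Rightarrow> ennreal" where
  "vertex_density u = (\<lambda>(s, z). ennreal (s ^ msize (prod_depth T u) / moment_seq c (msize (prod_depth T u))) *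
     ennreal ((cmod (mmonom z (prod_depth T u)))\<^sup>2 / (\<integral>z. (cmod (mmonom z (prod_depth T u)))\<^sup>2 \<partial>sphere_measure)))"

lemma vertex_measure_cong: "prod_depth T u = prod_depth T v \<Longrightarrow> vertex_measure u = vertex_measure v"
  by (simp add: vertex_measure_def rho_formula_def nu_formula_def)

lemma vertex_measure_on: "finite_measure_on ({0..b} \<times> sphere 0 1) (vertex_measure u)"
  unfolding vertex_measure_def
  by (rule finite_measure_on_pair[OF rho_formula_props(2) _ nu_formula_props(2)]) auto

lemma sets_vertex_measure: "sets (vertex_measure u) = sets borel"
  using vertex_measure_on by (simp add: finite_measure_on_def)

lemma prob_space_vertex_measure: "prob_space (vertex_measure u)"
proof -
  interpret R: prob_space "rho_formula T c \<mu> u" by (rule rho_formula_props)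
  interpret N: prob_space "nu_formula T u" by (rule nu_formula_props)
  interpret pair_prob_space "rho_formula T c \<mu> u" "nu_formula T u" ..
  show ?thesis unfolding vertex_measure_def by unfold_locales
qed

lemma vertex_measure_density: "vertex_measure u = density (\<mu> \<Otimes>\<^sub>M sphere_measure) (vertex_density u)"
  unfolding vertex_measure_def vertex_density_def rho_formula_def nu_formula_def Let_def
proof (rule pair_measure_density)
  show "sigma_finite_measure (sphere_measure :: (complex ^ 'd) measure)"
    by (intro finite_measure.sigma_finite_measure prob_space.axioms(1) prob_space_sphere_measure)
  show "sigma_finite_measure (density sphere_measure (\<lambda>z. ennreal ((cmod (mmonom z (prod_depth T u)))\<^sup>2 /
      (\<integral>z. (cmod (mmonom z (prod_depth T u)))\<^sup>2 \<partial>sphere_measure))))"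
    using nu_formula_props(1)[of u]
    unfolding nu_formula_def by (intro finite_measure.sigma_finite_measure prob_space.axioms(1))
qed (intro finite_measure_on_measurable[OF \<mu>_on] finite_measure_on_measurable[OF sphere_measure_on], measurable)+

lemma borel_measurable_vertex_density: "vertex_density u \<in> borel_measurable (\<mu> \<Otimes>\<^sub>M sphere_measure)"
proof -
  have [measurable]: "(\<lambda>s. s) \<in> borel_measurable \<mu>"
    by (rule finite_measure_on_measurable[OF \<mu>_on]) simp
  have [measurable]: "(\<lambda>z. mmonom z \<alpha>) \<in> borel_measurable sphere_measure" for \<alpha> :: "'d \<Rightarrow> nat"
    by (rule finite_measure_on_measurable[OF sphere_measure_on]) simp
  show ?thesis unfolding vertex_density_def by measurable
qed

text \<open>The first factor contributes the quotient of two values of a, the second that of two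
  sphere integrals; together they form the quotient of two values of Q.\<close>

lemma set_nn_integral_vertex_measure:
  "(\<integral>\<^sup>+p\<in>{0..b} \<times> sphere 0 1. ennreal (box_integrand (msize \<alpha>) \<alpha> p) \<partial>vertex_measure u) =
    ennreal (shift_moment c (\<lambda>j. prod_depth T u j + \<alpha> j) / shift_moment c (prod_depth T u))"
  unfolding vertex_measure_def set_nn_integral_box[OF rho_formula_props(2) nu_formula_props(2)]
    rho_formula_props(3) nu_formula_props(3) shift_moment_eq msize_add
  by simp

section \<open>The operator measure built from the vertex measures\<close>

definition vertex_operator :: "(real \<times> (complex ^ 'd)) set \<Rightarrow> (('d \<Rightarrow> 'a) \<Rightarrow> complex) \<Rightarrow> ('d \<Rightarrow> 'a) \<Rightarrow> complex" where
  "vertex_operator A f = (\<lambda>v. of_real (measure (vertex_measure v) A) * f v)"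

lemma vertex_operator_in_E:
  assumes "f \<in> E" shows "vertex_operator A f \<in> E"
  unfolding vertex_operator_def
proof (rule E_scale[OF assms])
  fix v w assume "prod_depth T v = prod_depth T w"
  then have "vertex_measure v = vertex_measure w" by (rule vertex_measure_cong)
  then show "complex_of_real (measure (vertex_measure v) A) = complex_of_real (measure (vertex_measure w) A)"
    by simp
qed

text \<open>The operators are diagonal with entries in [0, 1], because the vertex measures are
  probability measures; hence the bound 1. Inner products are finite sums over \<open>supp\<close>,
  so countable additivity passes through term by term.\<close>

lemma operator_measure_vertex_operator: "operator_measure V E vertex_operator"
  unfolding operator_measure_def
proof (intro conjI ballI allI impI)
  fix A :: "(real \<times> (complex ^ 'd)) set"
  show "vertex_operator A f \<in> E" if "f \<in> E" for f by (rule vertex_operator_in_E[OF that])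
  show "vertex_operator A (\<lambda>v. f v + g v) = (\<lambda>v. vertex_operator A f v + vertex_operator A g v)" for f g
    by (simp add: vertex_operator_def algebra_simps)
  show "vertex_operator A (\<lambda>v. k * f v) = (\<lambda>v. k * vertex_operator A f v)" for f k
    by (simp add: vertex_operator_def algebra_simps)
  show "\<exists>K. \<forall>f\<in>E. l2_norm V (vertex_operator A f) \<le> K * l2_norm V f"
  proof (intro exI[of _ 1] ballI)
    fix f assume f: "f \<in> E"
    have "(\<Sum>v\<in>supp. (cmod (vertex_operator A f v))\<^sup>2) \<le> (\<Sum>v\<in>supp. (cmod (f v))\<^sup>2)"
    proof (rule sum_mono)
      fix v
      have "measure (vertex_measure v) A \<le> 1" by (rule prob_space.prob_le_1[OF prob_space_vertex_measure])
      then show "(cmod (vertex_operator A f v))\<^sup>2 \<le> (cmod (f v))\<^sup>2"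
        by (intro power_mono) (auto simp: vertex_operator_def norm_mult intro!: mult_left_le_one_le)
    qed
    then have "(l2_norm V (vertex_operator A f))\<^sup>2 \<le> (l2_norm V f)\<^sup>2"
      by (simp add: l2_norm_finite_support[OF supp(1,2)] supp(3) f vertex_operator_in_E)
    moreover have "l2_norm V f \<ge> 0" by (simp add: l2_norm_def infsum_nonneg)
    ultimately have "l2_norm V (vertex_operator A f) \<le> l2_norm V f"
      by (rule power2_le_imp_le)
    then show "l2_norm V (vertex_operator A f) \<le> 1 * l2_norm V f" by simp
  qed
next
  fix A :: "nat \<Rightarrow> (real \<times> (complex ^ 'd)) set" and f g
  assume A: "range A \<subseteq> sets borel \<and> disjoint_family A" and f: "f \<in> E" and g: "g \<in> E"
  have inner: "l2_inner V (vertex_operator B f) g =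
      (\<Sum>v\<in>supp. of_real (measure (vertex_measure v) B) * (f v * cnj (g v)))" for B
    unfolding l2_inner_def vertex_operator_def mult.assoc
    by (rule infsum_supp) (simp add: supp(3)[OF f])
  show "(\<lambda>n. l2_inner V (vertex_operator (A n) f) g) sums l2_inner V (vertex_operator (\<Union>n. A n) f) g"
    unfolding inner
  proof (intro sums_sum sums_mult2 sums_of_real)
    fix v
    have "finite_measure (vertex_measure v)" using vertex_measure_on by (simp add: finite_measure_on_def)
    then show "(\<lambda>n. measure (vertex_measure v) (A n)) sums measure (vertex_measure v) (\<Union>n. A n)"
      using A by (intro finite_measure.finite_measure_UNION) (auto simp: sets_vertex_measure)
  qed
qed

text \<open>A general f in E mixes depths, so its quadratic measure is not a multiple of one product
  but the sum over v in \<open>supp\<close> of |f(v)|^2 times the vertex measure of v. The measure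
  \<open>N\<close> realises this sum, and its moments are the terms of the norm formula.\<close>

lemma vertex_operator_moment:
  assumes f: "f \<in> E"
  shows "(model_norm T c (multi_power coord_mult \<alpha> (const_series f)))\<^sup>2 =
    (LINT p : {0..b} \<times> sphere 0 1 | quadratic_measure V vertex_operator f. box_integrand (msize \<alpha>) \<alpha> p)"
proof -
  let ?P = "\<mu> \<Otimes>\<^sub>M (sphere_measure :: (complex ^ 'd) measure)"
  let ?k = "\<lambda>v. ennreal ((cmod (f v))\<^sup>2)"
  define N where "N = density ?P (\<lambda>p. \<Sum>v\<in>supp. ?k v * vertex_density v p)"
  have "finite_measure_on ({0..b} \<times> sphere 0 1) ?P"
    by (rule finite_measure_on_pair[OF \<mu>_on _ sphere_measure_on]) auto
  then have P: "sets ?P = sets borel" by (simp add: finite_measure_on_def)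
  then have setsN: "sets N = sets borel" by (simp add: N_def)
  have nnN: "(\<integral>\<^sup>+p. g p \<partial>N) = (\<Sum>v\<in>supp. ?k v * (\<integral>\<^sup>+p. g p \<partial>vertex_measure v))"
    if "g \<in> borel_measurable borel" for g
  proof -
    have "g \<in> borel_measurable ?P" using that by (simp add: measurable_cong_sets[OF P refl])
    then show ?thesis
      unfolding N_def vertex_measure_density
      by (intro nn_integral_density_sum supp(1) borel_measurable_vertex_density)
  qed
  have "quadratic_measure V vertex_operator f = N"
  proof (rule quadratic_measure_eqI[OF setsN])
    fix A :: "(real \<times> (complex ^ 'd)) set" assume A: "A \<in> sets borel"
    have "l2_inner V (vertex_operator A f) f = (\<Sum>v\<in>supp. of_real (measure (vertex_measure v) A) * (f v * cnj (f v)))"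
      unfolding l2_inner_def vertex_operator_def mult.assoc
      by (rule infsum_supp) (simp add: supp(3)[OF f])
    also have "\<dots> = of_real (\<Sum>v\<in>supp. (cmod (f v))\<^sup>2 * measure (vertex_measure v) A)"
      by (simp add: complex_norm_square[symmetric] mult.commute)
    finally have "ennreal (Re (l2_inner V (vertex_operator A f) f)) = ennreal (\<Sum>v\<in>supp. (cmod (f v))\<^sup>2 * measure (vertex_measure v) A)"
      by simp
    also have "\<dots> = (\<Sum>v\<in>supp. ?k v * emeasure (vertex_measure v) A)"
      using prob_space.axioms(1)[OF prob_space_vertex_measure]
      by (simp add: sum_ennreal[symmetric] ennreal_mult' finite_measure.emeasure_eq_measure)
    also have "\<dots> = emeasure N A"
      using nnN[of "indicator A"] A by (simp add: setsN sets_vertex_measure)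
    finally show "ennreal (Re (l2_inner V (vertex_operator A f) f)) = emeasure N A" .
  qed
  moreover have "(\<integral>\<^sup>+p\<in>{0..b} \<times> sphere 0 1. ennreal (box_integrand (msize \<alpha>) \<alpha> p) \<partial>N) =
      ennreal (\<Sum>v\<in>supp. (cmod (f v))\<^sup>2 * (shift_moment c (\<lambda>j. prod_depth T v j + \<alpha> j) / shift_moment c (prod_depth T v)))"
  proof -
    have box: "{0..b} \<times> sphere (0 :: complex ^ 'd) 1 \<in> sets borel"
      by (intro borel_closed closed_Times) auto
    have meas: "(\<lambda>p. ennreal (box_integrand (msize \<alpha>) \<alpha> p) * indicator ({0..b} \<times> sphere 0 1) p) \<in> borel_measurable borel"
      using borel_measurable_box_integrand[of "msize \<alpha>" \<alpha>] box
      by (intro borel_measurable_times_ennreal borel_measurable_indicator measurable_compose[OF _ measurable_ennreal])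
    have pos: "shift_moment c (\<lambda>j. prod_depth T v j + \<alpha> j) / shift_moment c (prod_depth T v) \<ge> 0" for v
      by (intro divide_nonneg_nonneg less_imp_le shift_moment_pos[of c, OF c_pos])
    show ?thesis
      unfolding nnN[OF meas] set_nn_integral_vertex_measure
      by (subst sum_ennreal[symmetric], intro mult_nonneg_nonneg pos zero_le_power2, simp only: ennreal_mult' zero_le_power2)
  qed
  moreover have "(\<Sum>v\<in>supp. (cmod (f v))\<^sup>2 * (shift_moment c (\<lambda>j. prod_depth T v j + \<alpha> j) / shift_moment c (prod_depth T v))) \<ge> 0"
    unfolding model_norm_monomial[OF f, symmetric] by simp
  ultimately show ?thesis
    unfolding model_norm_monomial[OF f] using set_integral_box_eq_nn[OF setsN, of b "msize \<alpha>" \<alpha>] by simp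
qed

lemma representing_measure_formula:
  "representing_measure T c \<Omega> b vertex_operator (rho_formula T c \<mu>) (nu_formula T)"
  unfolding representing_measure_def
proof (intro conjI allI ballI impI)
  show "b > 0" by (rule b_pos)
  show "operator_measure V E vertex_operator" by (rule operator_measure_vertex_operator)
  show "(model_norm T c (multi_power coord_mult \<alpha> (const_series f)))\<^sup>2 =
      (LINT p : {0..b} \<times> sphere 0 1 | quadratic_measure V vertex_operator f. box_integrand (msize \<alpha>) \<alpha> p)" if "f \<in> E" for f \<alpha>
    by (rule vertex_operator_moment[OF that])
  show "prob_space (rho_formula T c \<mu> (prod_root T))" by (rule rho_formula_props)
  show "prob_space (nu_formula T (prod_root T))" by (rule nu_formula_props)
  fix g A assume g: "\<forall>F. \<forall>u\<in>\<Omega> F. g F u \<in> Lspace T c F u"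
  show "vertex_operator A (\<lambda>v. \<Sum>F\<in>UNIV. \<Sum>\<^sub>\<infinity>u\<in>\<Omega> F. g F u v) =
     (\<lambda>v. \<Sum>F\<in>UNIV. \<Sum>\<^sub>\<infinity>u\<in>\<Omega> F. of_real (measure (rho_formula T c \<mu> u \<Otimes>\<^sub>M nu_formula T u) A) * g F u v)"
  proof
    fix v
    \<comment> \<open>Where \<open>g F u\<close> is nonzero at v, the depths of u and v agree, so
      the scalar belonging to u can be exchanged for the one belonging to v, which does not depend
      on u and leaves the sum.\<close>
    have "(\<Sum>\<^sub>\<infinity>u\<in>\<Omega> F. of_real (measure (vertex_measure u) A) * g F u v) =
        of_real (measure (vertex_measure v) A) * (\<Sum>\<^sub>\<infinity>u\<in>\<Omega> F. g F u v)" for F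
      unfolding infsum_cmult_right'[symmetric]
    proof (rule infsum_cong)
      fix u assume u: "u \<in> \<Omega> F"
      show "of_real (measure (vertex_measure u) A) * g F u v = of_real (measure (vertex_measure v) A) * g F u v"
      proof (cases "g F u v = 0")
        case False
        then have "prod_depth T v = prod_depth T u"
          using Lspace_depth(2)[OF \<Omega>_Phi[OF u]] g u by blast
        then show ?thesis using vertex_measure_cong by metis
      qed simp
    qed
    then show "vertex_operator A (\<lambda>v. \<Sum>F\<in>UNIV. \<Sum>\<^sub>\<infinity>u\<in>\<Omega> F. g F u v) v =
     (\<Sum>F\<in>UNIV. \<Sum>\<^sub>\<infinity>u\<in>\<Omega> F. of_real (measure (rho_formula T c \<mu> u \<Otimes>\<^sub>M nu_formula T u) A) * g F u v)"
      by (simp add: vertex_operator_def vertex_measure_def sum_distrib_left)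
  qed
qed (use rho_formula_props(2) nu_formula_props(2) in \<open>auto simp: finite_measure_on_def\<close>)

end

end

theorem theorem2p15:
  fixes T :: "'d::finite \<Rightarrow> 'a pair_pre_digraph"
    and c :: "nat \<Rightarrow> real"
    and \<Omega> :: "'d set \<Rightarrow> ('d \<Rightarrow> 'a) set"
  assumes "\<And>j. rooted_directed_tree (T j)"
    and "\<And>j. countable (pverts (T j))" and "\<And>j. infinite (pverts (T j))"
    and "\<And>j. leafless (T j)"
    and "\<And>j. locally_finite (T j)"
    and "finite_joint_branching_index T"
    and "\<And>n. c n > 0" and "(INF n. c n) > 0" and "bdd_above (range c)"
    and "\<And>F. sib_transversal T F (\<Omega> F)"
  shows "((\<exists>R \<rho> \<nu>. representing_measure T c \<Omega> (SUP n. c n) R \<rho> \<nu>) \<longleftrightarrow>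
            hausdorff_moment_seq (moment_seq c)) \<and>
         ((\<exists>R \<rho> \<nu>. representing_measure T c \<Omega> (SUP n. c n) R \<rho> \<nu>) \<or>
            hausdorff_moment_seq (moment_seq c) \<longrightarrow>
          (\<exists>\<mu>. hausdorff_representing (SUP n. c n) (moment_seq c) \<mu> \<and>
             (\<forall>\<mu>'. hausdorff_representing (SUP n. c n) (moment_seq c) \<mu>' \<longrightarrow> \<mu>' = \<mu>) \<and>
             (\<exists>R. representing_measure T c \<Omega> (SUP n. c n) R (rho_formula T c \<mu>) (nu_formula T)) \<and>
             (\<forall>R \<rho> \<nu>. representing_measure T c \<Omega> (SUP n. c n) R \<rho> \<nu> \<longrightarrow>
                \<rho> (prod_root T) = \<mu> \<and>
                (\<forall>F. \<forall>u\<in>\<Omega> F. Lspace T c F u \<noteq> {\<lambda>_. 0} \<longrightarrow>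
                   modulus_image (\<rho> u) (\<nu> u) =
                   modulus_image (rho_formula T c \<mu> u) (nu_formula T u)))))"
proof -
  interpret tree_multishift T c \<Omega>
    by unfold_locales (fact assms)+
  \<comment> \<open>The interval in \<open>hausdorff_moment_seq\<close> is arbitrary, whereas the
    measures sought must live on [0, sup c].\<close>
  have hausdorff: "\<exists>\<mu>. hausdorff_representing b (moment_seq c) \<mu>" if hms: "hausdorff_moment_seq (moment_seq c)"
  proof -
    obtain b' \<mu> where "hausdorff_representing b' (moment_seq c) \<mu>"
      using hms unfolding hausdorff_moment_seq_def by blast
    from hausdorff_representing_shrink[OF this b_pos moment_seq_le] show ?thesis by blast
  qed
  have equiv: "(\<exists>R \<rho> \<nu>. representing_measure T c \<Omega> b R \<rho> \<nu>) \<longleftrightarrow> hausdorff_moment_seq (moment_seq c)"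
  proof
    assume "\<exists>R \<rho> \<nu>. representing_measure T c \<Omega> b R \<rho> \<nu>"
    then obtain R \<rho> \<nu> where "representing_measure T c \<Omega> b R \<rho> \<nu>" by blast
    from representing_measure_root[OF this] show "hausdorff_moment_seq (moment_seq c)"
      using b_pos unfolding hausdorff_moment_seq_def by blast
  next
    assume "hausdorff_moment_seq (moment_seq c)"
    then obtain \<mu> where "hausdorff_representing b (moment_seq c) \<mu>" using hausdorff by blast
    from representing_measure_formula[OF this] show "\<exists>R \<rho> \<nu>. representing_measure T c \<Omega> b R \<rho> \<nu>" by blast
  qed
  have "\<exists>\<mu>. hausdorff_representing b (moment_seq c) \<mu> \<and>
      (\<forall>\<mu>'. hausdorff_representing b (moment_seq c) \<mu>' \<longrightarrow> \<mu>' = \<mu>) \<and>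
      (\<exists>R. representing_measure T c \<Omega> b R (rho_formula T c \<mu>) (nu_formula T)) \<and>
      (\<forall>R \<rho> \<nu>. representing_measure T c \<Omega> b R \<rho> \<nu> \<longrightarrow> \<rho> (prod_root T) = \<mu> \<and>
         (\<forall>F. \<forall>u\<in>\<Omega> F. Lspace T c F u \<noteq> {\<lambda>_. 0} \<longrightarrow>
            modulus_image (\<rho> u) (\<nu> u) = modulus_image (rho_formula T c \<mu> u) (nu_formula T u)))"
    if hms: "hausdorff_moment_seq (moment_seq c)"
  proof -
    obtain \<mu> where \<mu>: "hausdorff_representing b (moment_seq c) \<mu>" using hausdorff[OF hms] by blast
    note formula = representing_measure_formula[OF \<mu>]
    show ?thesis
    proof (intro exI[of _ \<mu>] conjI allI impI ballI)
      show "\<mu>' = \<mu>" if "hausdorff_representing b (moment_seq c) \<mu>'" for \<mu>'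
        by (rule hausdorff_representing_unique[OF that \<mu>])
      show "\<rho> (prod_root T) = \<mu>" if "representing_measure T c \<Omega> b R \<rho> \<nu>" for R \<rho> \<nu>
        by (rule hausdorff_representing_unique[OF representing_measure_root[OF that] \<mu>])
      \<comment> \<open>The formula measures themselves form a representing measure, so uniqueness
        of the modulus image compares any other one with them.\<close>
      show "modulus_image (\<rho> u) (\<nu> u) = modulus_image (rho_formula T c \<mu> u) (nu_formula T u)"
        if "representing_measure T c \<Omega> b R \<rho> \<nu>" "u \<in> \<Omega> F" "Lspace T c F u \<noteq> {\<lambda>_. 0}" for R \<rho> \<nu> F u
        by (rule representing_measure_modulus_unique[OF that(1) formula that(2,3)])
    qed (use \<mu> formula in blast)+
  qed
  then show ?thesis using equiv by blast
qed

end
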